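(* Let $\psi_0: X^{m+r|n+s}\to Y^{p+r|q+s}$ be a morphism of smooth supermanifolds that is supertransversal to a subsupermanifold $Z^{p|q}$ of $Y$. Suppose that $\tilde X$ is compact, that $\tilde Z$ is a closed submanifold of $\tilde Y$, and that $\psi_t$ is a superhomotopy of $\psi_0$. Then there exists $\varepsilon>0$ such that for every $t$ with $0\le t<\varepsilon$ the morphism $\psi_t$ is also supertransversal to $Z$.
   Context: A (smooth) supermanifold $X^{m|n}=(\tilde X,\mathcal O_X)$ is a second countable Hausdorff space $\tilde X$ with a sheaf of supercommutative $\mathbb Z_2$-graded rings that is locally isomorphic to a superdomain $U^{m|n}=(U, C^\infty(\cdot)[\theta^1,\dots,\theta^n])$, $U\subset\mathbb R^m$ open. A morphism $\psi=(\tilde\psi,\psi^* )$ consists of a continuous map $\tilde\psi:\tilde X\to\tilde Y$ and a homomorphism $\psi^*:\mathcal O_Y\to\tilde\psi_*\mathcal O_X$ of sheaves of supercommutative $\mathbb Z_2$-graded rings. $T_xX$ is the super vector space of derivations of the stalk $\mathcal O_{X,x}$, and $d\psi_x:T_xX\to T_{\tilde\psi(x)}Y$ is $\eta\mapsto\eta\circ\psi^*$. A subsupermanifold $Z$ of $Y$ is a supermanifold with $\tilde Z\subset \tilde Y$ and an embedding $Z\to Y$ (an immersion, i.e. with injective differentials, whose underlying map is a homeomorphism onto its image) with underlying map the inclusion; $T_yZ\subset T_yY$ via its differential. $\psi:X\to Y$ is supertransversal to $Z$ if $\mathrm{Im}\,d\psi_x+T_yZ=T_yY$ for every $x\in\tilde\psi^{-1}(\tilde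 Z)$, $y=\tilde\psi(x)$. Superhomotopy: $\psi_t$ is a superhomotopy of $\psi_0:X\to Y$ if there is a morphism $\Psi:X\times\mathbb R^{1|0}\to Y$ with $\Psi\circ i_0=\psi_0$ and $\Psi\circ i_t=\psi_t$ for $t\in\mathbb R$, where $i_t:X\to X\times\mathbb R^{1|0}$ is the morphism with $\tilde i_t(x)=(x,t)$ given in local coordinates $(x_1,\dots,x_a,\tau;e_1,\dots,e_b)$ ($\tau$ the coordinate of $\mathbb R^{1|0}$) by $i_t^*f(x_1,\dots,x_a,\tau)=f(x_1,\dots,x_a,t)$, $i_t^*e_j=e_j$. *)

theory Defs
  imports
    "HOL-Analysis.Analysis"
    "HOL-Algebra.Module"
    "HOL-Library.Z2"
begin

section \<open>Supercommutative superalgebras over the reals\<close>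

definition real_ring :: "real ring" where
  "real_ring = \<lparr>carrier = UNIV, mult = (*), one = 1, zero = 0, add = (+)\<rparr>"

record 's superalgebra = "(real, 's) module" +
  homog :: "bit \<Rightarrow> 's set"

definition supercommutative_algebra :: "('s, 'z) superalgebra_scheme \<Rightarrow> bool" where
  "supercommutative_algebra A \<longleftrightarrow>
     ring A \<and> module real_ring A \<and>
     (\<forall>c. \<forall>f\<in>carrier A. \<forall>g\<in>carrier A.
        (c \<odot>\<^bsub>A\<^esub> f) \<otimes>\<^bsub>A\<^esub> g = c \<odot>\<^bsub>A\<^esub> (f \<otimes>\<^bsub>A\<^esub> g) \<and>
        f \<otimes>\<^bsub>A\<^esub> (c \<odot>\<^bsub>A\<^esub> g) = c \<odot>\<^bsub>A\<^esub> (f \<otimes>\<^bsub>A\<^esub> g)) \<and>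
     (\<forall>j. homog A j \<subseteq> carrier A \<and> \<zero>\<^bsub>A\<^esub> \<in> homog A j \<and>
        (\<forall>f\<in>homog A j. \<forall>g\<in>homog A j. f \<oplus>\<^bsub>A\<^esub> g \<in> homog A j) \<and>
        (\<forall>c. \<forall>f\<in>homog A j. c \<odot>\<^bsub>A\<^esub> f \<in> homog A j)) \<and>
     (\<forall>f\<in>carrier A. \<exists>!(g, h). g \<in> homog A 0 \<and> h \<in> homog A 1 \<and> f = g \<oplus>\<^bsub>A\<^esub> h) \<and>
     \<one>\<^bsub>A\<^esub> \<in> homog A 0 \<and>
     (\<forall>j k. \<forall>f\<in>homog A j. \<forall>g\<in>homog A k.
        f \<otimes>\<^bsub>A\<^esub> g \<in> homog A (j + k) \<and>
        f \<otimes>\<^bsub>A\<^esub> g = (if j = 1 \<and> k = 1 then \<ominus>\<^bsub>A\<^esub> (g \<otimes>\<^bsub>A\<^esub> f) else g \<otimes>\<^bsub>A\<^esub> f))"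

definition superring_hom ::
    "('s, 'y) superalgebra_scheme \<Rightarrow> ('t, 'z) superalgebra_scheme \<Rightarrow> ('s \<Rightarrow> 't) set" where
  "superring_hom A B = {h \<in> ring_hom A B. \<forall>j. h ` homog A j \<subseteq> homog B j}"

definition real_linear_on ::
    "('s, 'y) superalgebra_scheme \<Rightarrow> ('t, 'z) superalgebra_scheme \<Rightarrow> ('s \<Rightarrow> 't) \<Rightarrow> bool" where
  "real_linear_on A B h \<longleftrightarrow> (\<forall>c. \<forall>f\<in>carrier A. h (c \<odot>\<^bsub>A\<^esub> f) = c \<odot>\<^bsub>B\<^esub> h f)"

section \<open>Spaces with a sheaf of superalgebras, and their morphisms\<close>

text \<open>
  The algebra of sections \<open>sec X U\<close> and the restriction \<open>res X U V\<close> from \<open>U\<close> to \<open>V\<close> are only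
  meaningful for open sets \<open>V \<subseteq> U\<close>.
\<close>

record ('x, 's) superspace =
  body :: "'x topology"
  sec :: "'x set \<Rightarrow> 's superalgebra"
  res :: "'x set \<Rightarrow> 'x set \<Rightarrow> 's \<Rightarrow> 's"

definition super_ringed_space :: "('x, 's) superspace \<Rightarrow> bool" where
  "super_ringed_space X \<longleftrightarrow>
     (\<forall>U. openin (body X) U \<longrightarrow> supercommutative_algebra (sec X U)) \<and>
     (\<forall>U V. openin (body X) U \<and> openin (body X) V \<and> V \<subseteq> U \<longrightarrow>
        res X U V \<in> superring_hom (sec X U) (sec X V) \<and>
        real_linear_on (sec X U) (sec X V) (res X U V)) \<and>
     (\<forall>U. openin (body X) U \<longrightarrow> (\<forall>f\<in>carrier (sec X U). res X U U f = f)) \<and>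
     (\<forall>U V W. openin (body X) U \<and> openin (body X) V \<and> openin (body X) W \<and> W \<subseteq> V \<and> V \<subseteq> U \<longrightarrow>
        (\<forall>f\<in>carrier (sec X U). res X V W (res X U V f) = res X U W f)) \<and>
     (\<forall>\<U>. (\<forall>U\<in>\<U>. openin (body X) U) \<longrightarrow>
        (\<forall>f\<in>carrier (sec X (\<Union>\<U>)). \<forall>g\<in>carrier (sec X (\<Union>\<U>)).
           (\<forall>U\<in>\<U>. res X (\<Union>\<U>) U f = res X (\<Union>\<U>) U g) \<longrightarrow> f = g) \<and>
        (\<forall>s. (\<forall>U\<in>\<U>. s U \<in> carrier (sec X U)) \<and>
           (\<forall>U\<in>\<U>. \<forall>V\<in>\<U>. res X U (U \<inter> V) (s U) = res X V (U \<inter> V) (s V)) \<longrightarrow>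
           (\<exists>f\<in>carrier (sec X (\<Union>\<U>)). \<forall>U\<in>\<U>. res X (\<Union>\<U>) U f = s U)))"

definition open_subspace :: "('x, 's) superspace \<Rightarrow> 'x set \<Rightarrow> ('x, 's) superspace" where
  "open_subspace X U = \<lparr>body = subtopology (body X) U, sec = sec X, res = res X\<rparr>"

record ('x, 's, 'y, 't) supermap =
  underlying :: "'x \<Rightarrow> 'y"
  pull :: "'y set \<Rightarrow> 't \<Rightarrow> 's"

definition preim :: "('x, 's) superspace \<Rightarrow> ('x, 's, 'y, 't) supermap \<Rightarrow> 'y set \<Rightarrow> 'x set" where
  "preim X \<psi> V = {x \<in> topspace (body X). underlying \<psi> x \<in> V}"

text \<open>
  Morphisms are homomorphisms of sheaves of \<open>\<int>\<^sub>2\<close>-graded unital rings.  Real linearity is not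
  required; the differentials between tangent spaces of supermanifolds are real linear all the same.
\<close>

definition is_morphism ::
    "('x, 's) superspace \<Rightarrow> ('y, 't) superspace \<Rightarrow> ('x, 's, 'y, 't) supermap \<Rightarrow> bool" where
  "is_morphism X Y \<psi> \<longleftrightarrow>
     continuous_map (body X) (body Y) (underlying \<psi>) \<and>
     (\<forall>V. openin (body Y) V \<longrightarrow>
        pull \<psi> V \<in> superring_hom (sec Y V) (sec X (preim X \<psi> V))) \<and>
     (\<forall>V W. openin (body Y) V \<and> openin (body Y) W \<and> W \<subseteq> V \<longrightarrow>
        (\<forall>g\<in>carrier (sec Y V).
           res X (preim X \<psi> V) (preim X \<psi> W) (pull \<psi> V g) = pull \<psi> W (res Y V W g)))"

definition supermap_comp ::
    "('w, 'u) superspace \<Rightarrow> ('w, 'u, 'y, 't) supermap \<Rightarrow> ('x, 's, 'w, 'u) supermap \<Rightarrow>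
     ('x, 's, 'y, 't) supermap" where
  "supermap_comp W \<Psi> \<phi> =
     \<lparr>underlying = underlying \<Psi> \<circ> underlying \<phi>,
      pull = (\<lambda>V g. pull \<phi> (preim W \<Psi> V) (pull \<Psi> V g))\<rparr>"

text \<open>Equality of morphisms, disregarding the values of the HOL functions outside their domains.\<close>

definition supermap_eq ::
    "('x, 's) superspace \<Rightarrow> ('y, 't) superspace \<Rightarrow> ('x, 's, 'y, 't) supermap \<Rightarrow>
     ('x, 's, 'y, 't) supermap \<Rightarrow> bool" where
  "supermap_eq X Y \<phi> \<psi> \<longleftrightarrow>
     (\<forall>x\<in>topspace (body X). underlying \<phi> x = underlying \<psi> x) \<and>
     (\<forall>V. openin (body Y) V \<longrightarrow> (\<forall>g\<in>carrier (sec Y V). pull \<phi> V g = pull \<psi> V g))"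

section \<open>Superdomains\<close>

text \<open>
  \<open>Euclidean_space m\<close> consists of the sequences vanishing from index \<open>m\<close> on; coordinates are
  numbered from \<open>0\<close>, and \<open>m = 0\<close> is allowed.
\<close>

primrec Ck_on :: "nat \<Rightarrow> nat \<Rightarrow> (nat \<Rightarrow> real) set \<Rightarrow> ((nat \<Rightarrow> real) \<Rightarrow> real) \<Rightarrow> bool" where
  "Ck_on 0 m U f \<longleftrightarrow> continuous_map (subtopology (Euclidean_space m) U) euclideanreal f"
| "Ck_on (Suc k) m U f \<longleftrightarrow>
     continuous_map (subtopology (Euclidean_space m) U) euclideanreal f \<and>
     (\<forall>i<m. \<exists>g. Ck_on k m U g \<and>
        (\<forall>x\<in>U. ((\<lambda>s. f (x(i := s))) has_real_derivative g x) (at (x i))))"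

definition smooth_fun_on :: "nat \<Rightarrow> (nat \<Rightarrow> real) set \<Rightarrow> ((nat \<Rightarrow> real) \<Rightarrow> real) \<Rightarrow> bool" where
  "smooth_fun_on m U f \<longleftrightarrow> (\<forall>k. Ck_on k m U f)"

text \<open>
  An element \<open>\<Sum>\<^sub>I f\<^sub>I \<theta>\<^sup>I\<close> of \<open>C\<^sup>\<infinity>(U)[\<theta>\<^sup>0,\<dots>,\<theta>\<^sup>n\<^sup>-\<^sup>1]\<close>, with \<open>\<theta>\<^sup>I\<close> the product of the
  \<open>\<theta>\<^sup>i\<close>, \<open>i \<in> I\<close>, in increasing order, is represented by \<open>\<lambda>I x. f\<^sub>I(x)\<close>, extended by \<open>0\<close> to
  \<open>x \<notin> U\<close> and to index sets not contained in \<open>{..<n}\<close>.  The sign below is the one in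
  \<open>\<theta>\<^sup>I \<theta>\<^sup>J = \<plusminus> \<theta>\<^sup>I\<^sup>\<union>\<^sup>J\<close> for disjoint \<open>I\<close>, \<open>J\<close>.
\<close>

type_synonym superfun = "nat set \<Rightarrow> (nat \<Rightarrow> real) \<Rightarrow> real"

definition theta_sign :: "nat set \<Rightarrow> nat set \<Rightarrow> real" where
  "theta_sign I J = (- 1) ^ card {(i, j). i \<in> I \<and> j \<in> J \<and> j < i}"

definition superfun_carrier :: "nat \<Rightarrow> nat \<Rightarrow> (nat \<Rightarrow> real) set \<Rightarrow> superfun set" where
  "superfun_carrier m n U =
     {f. (\<forall>I x. f I x \<noteq> 0 \<longrightarrow> I \<subseteq> {..<n} \<and> x \<in> U) \<and> (\<forall>I. smooth_fun_on m U (f I))}"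

definition superfun_algebra :: "nat \<Rightarrow> nat \<Rightarrow> (nat \<Rightarrow> real) set \<Rightarrow> superfun superalgebra" where
  "superfun_algebra m n U =
     \<lparr>carrier = superfun_carrier m n U,
      mult = (\<lambda>f g K x. \<Sum>I\<in>Pow K. theta_sign I (K - I) * f I x * g (K - I) x),
      one = (\<lambda>I x. if I = {} \<and> x \<in> U then 1 else 0),
      zero = (\<lambda>I x. 0),
      add = (\<lambda>f g I x. f I x + g I x),
      smult = (\<lambda>c f I x. c * f I x),
      homog = (\<lambda>j. {f \<in> superfun_carrier m n U. \<forall>I x. f I x \<noteq> 0 \<longrightarrow> of_nat (card I) = j})\<rparr>"

definition superdomain :: "nat \<Rightarrow> nat \<Rightarrow> (nat \<Rightarrow> real) set \<Rightarrow> (nat \<Rightarrow> real, superfun) superspace" where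
  "superdomain m n U =
     \<lparr>body = subtopology (Euclidean_space m) U,
      sec = superfun_algebra m n,
      res = (\<lambda>V W f I x. if x \<in> W then f I x else 0)\<rparr>"

section \<open>Supermanifolds\<close>

text \<open>An isomorphism, over the reals, of an open part \<open>Q\<close> of \<open>X\<close> with the superdomain over \<open>U\<close>.\<close>

definition is_chart ::
    "nat \<Rightarrow> nat \<Rightarrow> ('x, 's) superspace \<Rightarrow> 'x set \<Rightarrow> (nat \<Rightarrow> real) set \<Rightarrow>
     ('x, 's, nat \<Rightarrow> real, superfun) supermap \<Rightarrow> bool" where
  "is_chart m n X Q U \<kappa> \<longleftrightarrow>
     openin (body X) Q \<and> openin (Euclidean_space m) U \<and>
     is_morphism (open_subspace X Q) (superdomain m n U) \<kappa> \<and>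
     homeomorphic_map (subtopology (body X) Q) (subtopology (Euclidean_space m) U) (underlying \<kappa>) \<and>
     (\<forall>V. openin (Euclidean_space m) V \<and> V \<subseteq> U \<longrightarrow>
        bij_betw (pull \<kappa> V) (carrier (superfun_algebra m n V))
          (carrier (sec X (preim (open_subspace X Q) \<kappa> V))) \<and>
        real_linear_on (superfun_algebra m n V) (sec X (preim (open_subspace X Q) \<kappa> V)) (pull \<kappa> V))"

definition supermanifold :: "nat \<Rightarrow> nat \<Rightarrow> ('x, 's) superspace \<Rightarrow> bool" where
  "supermanifold m n X \<longleftrightarrow>
     super_ringed_space X \<and> second_countable (body X) \<and> Hausdorff_space (body X) \<and>
     (\<forall>x\<in>topspace (body X). \<exists>Q U \<kappa>. x \<in> Q \<and> is_chart m n X Q U \<kappa>)"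

section \<open>Stalks and tangent spaces\<close>

definition germ :: "('x, 's) superspace \<Rightarrow> 'x \<Rightarrow> 'x set \<Rightarrow> 's \<Rightarrow> ('x set \<times> 's) set" where
  "germ X x U f =
     {(V, g). openin (body X) V \<and> x \<in> V \<and> g \<in> carrier (sec X V) \<and>
        (\<exists>W. openin (body X) W \<and> x \<in> W \<and> W \<subseteq> U \<inter> V \<and> res X U W f = res X V W g)}"

text \<open>
  In the operations below the union is over all representatives; it is a union of equal
  equivalence classes.
\<close>

definition stalk :: "('x, 's) superspace \<Rightarrow> 'x \<Rightarrow> ('x set \<times> 's) set superalgebra" where
  "stalk X x =
     \<lparr>carrier = {germ X x U f |U f. openin (body X) U \<and> x \<in> U \<and> f \<in> carrier (sec X U)},
      mult = (\<lambda>a b. \<Union>(U, f)\<in>a. \<Union>(V, g)\<in>b.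
        germ X x (U \<inter> V) (res X U (U \<inter> V) f \<otimes>\<^bsub>sec X (U \<inter> V)\<^esub> res X V (U \<inter> V) g)),
      one = germ X x (topspace (body X)) \<one>\<^bsub>sec X (topspace (body X))\<^esub>,
      zero = germ X x (topspace (body X)) \<zero>\<^bsub>sec X (topspace (body X))\<^esub>,
      add = (\<lambda>a b. \<Union>(U, f)\<in>a. \<Union>(V, g)\<in>b.
        germ X x (U \<inter> V) (res X U (U \<inter> V) f \<oplus>\<^bsub>sec X (U \<inter> V)\<^esub> res X V (U \<inter> V) g)),
      smult = (\<lambda>c a. \<Union>(U, f)\<in>a. germ X x U (c \<odot>\<^bsub>sec X U\<^esub> f)),
      homog = (\<lambda>j. {germ X x U f |U f. openin (body X) U \<and> x \<in> U \<and> f \<in> homog (sec X U) j})\<rparr>"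

text \<open>The value of a germ at the point: the unique real \<open>c\<close> such that \<open>a - c\<close> is not invertible.\<close>

definition germ_value :: "('x, 's) superspace \<Rightarrow> 'x \<Rightarrow> ('x set \<times> 's) set \<Rightarrow> real" where
  "germ_value X x a =
     (THE c. a \<ominus>\<^bsub>stalk X x\<^esub> (c \<odot>\<^bsub>stalk X x\<^esub> \<one>\<^bsub>stalk X x\<^esub>) \<notin> Units (stalk X x))"

text \<open>
  Real linear derivations of parity \<open>j\<close> from the stalk to its residue field \<open>\<real>\<close> (which is purely
  even), extended by \<open>0\<close> outside the stalk.
\<close>

definition homogeneous_tangent ::
    "('x, 's) superspace \<Rightarrow> 'x \<Rightarrow> bit \<Rightarrow> (('x set \<times> 's) set \<Rightarrow> real) set" where
  "homogeneous_tangent X x j =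
     {\<eta>. (\<forall>a. a \<notin> carrier (stalk X x) \<longrightarrow> \<eta> a = 0) \<and>
        (\<forall>a\<in>carrier (stalk X x). \<forall>b\<in>carrier (stalk X x). \<eta> (a \<oplus>\<^bsub>stalk X x\<^esub> b) = \<eta> a + \<eta> b) \<and>
        (\<forall>c. \<forall>a\<in>carrier (stalk X x). \<eta> (c \<odot>\<^bsub>stalk X x\<^esub> a) = c * \<eta> a) \<and>
        (\<forall>k. k \<noteq> j \<longrightarrow> (\<forall>a\<in>homog (stalk X x) k. \<eta> a = 0)) \<and>
        (\<forall>k. \<forall>a\<in>homog (stalk X x) k. \<forall>b\<in>carrier (stalk X x).
           \<eta> (a \<otimes>\<^bsub>stalk X x\<^esub> b) =
             \<eta> a * germ_value X x b +
             (if j = 1 \<and> k = 1 then - 1 else 1) * germ_value X x a * \<eta> b)}"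

definition tangent_space ::
    "('x, 's) superspace \<Rightarrow> 'x \<Rightarrow> (('x set \<times> 's) set \<Rightarrow> real) set" where
  "tangent_space X x =
     {\<lambda>a. \<eta> a + \<zeta> a |\<eta> \<zeta>. \<eta> \<in> homogeneous_tangent X x 0 \<and> \<zeta> \<in> homogeneous_tangent X x 1}"

definition stalk_pull ::
    "('x, 's) superspace \<Rightarrow> ('x, 's, 'y, 't) supermap \<Rightarrow> 'x \<Rightarrow> ('y set \<times> 't) set \<Rightarrow>
     ('x set \<times> 's) set" where
  "stalk_pull X \<psi> x b = (\<Union>(V, g)\<in>b. germ X x (preim X \<psi> V) (pull \<psi> V g))"

definition differential ::
    "('x, 's) superspace \<Rightarrow> ('y, 't) superspace \<Rightarrow> ('x, 's, 'y, 't) supermap \<Rightarrow> 'x \<Rightarrow>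
     (('x set \<times> 's) set \<Rightarrow> real) \<Rightarrow> ('y set \<times> 't) set \<Rightarrow> real" where
  "differential X Y \<psi> x \<eta> =
     (\<lambda>b. if b \<in> carrier (stalk Y (underlying \<psi> x)) then \<eta> (stalk_pull X \<psi> x b) else 0)"

section \<open>Subsupermanifolds and supertransversality\<close>

definition is_immersion ::
    "('x, 's) superspace \<Rightarrow> ('y, 't) superspace \<Rightarrow> ('x, 's, 'y, 't) supermap \<Rightarrow> bool" where
  "is_immersion X Y \<psi> \<longleftrightarrow>
     is_morphism X Y \<psi> \<and>
     (\<forall>x\<in>topspace (body X). inj_on (differential X Y \<psi> x) (tangent_space X x))"

definition is_embedding ::
    "('x, 's) superspace \<Rightarrow> ('y, 't) superspace \<Rightarrow> ('x, 's, 'y, 't) supermap \<Rightarrow> bool" where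
  "is_embedding X Y \<psi> \<longleftrightarrow>
     is_immersion X Y \<psi> \<and> embedding_map (body X) (body Y) (underlying \<psi>)"

definition subsupermanifold ::
    "nat \<Rightarrow> nat \<Rightarrow> ('y, 'u) superspace \<Rightarrow> ('y, 'u, 'y, 't) supermap \<Rightarrow> ('y, 't) superspace \<Rightarrow> bool"
  where
  "subsupermanifold p q Z \<iota> Y \<longleftrightarrow>
     supermanifold p q Z \<and> topspace (body Z) \<subseteq> topspace (body Y) \<and>
     is_embedding Z Y \<iota> \<and> (\<forall>z\<in>topspace (body Z). underlying \<iota> z = z)"

definition supertransversal ::
    "('x, 's) superspace \<Rightarrow> ('y, 't) superspace \<Rightarrow> ('y, 'u) superspace \<Rightarrow>
     ('y, 'u, 'y, 't) supermap \<Rightarrow> ('x, 's, 'y, 't) supermap \<Rightarrow> bool" where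
  "supertransversal X Y Z \<iota> \<psi> \<longleftrightarrow>
     (\<forall>x\<in>topspace (body X). underlying \<psi> x \<in> topspace (body Z) \<longrightarrow>
        {\<lambda>b. \<eta> b + \<zeta> b |\<eta> \<zeta>.
           \<eta> \<in> differential X Y \<psi> x ` tangent_space X x \<and>
           \<zeta> \<in> differential Z Y \<iota> (underlying \<psi> x) ` tangent_space Z (underlying \<psi> x)}
        = tangent_space Y (underlying \<psi> x))"

section \<open>The product with the real line, and superhomotopies\<close>

text \<open>
  For local coordinates \<open>(x\<^sub>0,\<dots>,x\<^sub>a\<^sub>-\<^sub>1;e\<^sub>0,\<dots>,e\<^sub>b\<^sub>-\<^sub>1)\<close> of \<open>X\<close> the coordinates of the product with
  \<open>\<real>\<^sup>1\<^sup>|\<^sup>0\<close> are \<open>(x\<^sub>0,\<dots>,x\<^sub>a\<^sub>-\<^sub>1,\<tau>;e\<^sub>0,\<dots>,e\<^sub>b\<^sub>-\<^sub>1)\<close>: the coordinate \<open>\<tau>\<close> has index \<open>a\<close>.  So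
  \<open>z(a := 0)\<close> is the projection to \<open>\<real>\<^sup>a\<close> of a point \<open>z\<close> of \<open>\<real>\<^sup>a \<times> \<real>\<close>, and \<open>x(a := t)\<close> is \<open>(x, t)\<close>.
\<close>

definition super_line :: "(nat \<Rightarrow> real, superfun) superspace" where
  "super_line = superdomain 1 0 (topspace (Euclidean_space 1))"

definition line_point :: "real \<Rightarrow> nat \<Rightarrow> real" where
  "line_point t = (\<lambda>i. if i = 0 then t else 0)"

definition cylinder :: "nat \<Rightarrow> (nat \<Rightarrow> real) set \<Rightarrow> (nat \<Rightarrow> real) set" where
  "cylinder a U = {z \<in> topspace (Euclidean_space (Suc a)). z(a := 0) \<in> U}"

definition slice :: "nat \<Rightarrow> real \<Rightarrow> (nat \<Rightarrow> real) set \<Rightarrow> (nat \<Rightarrow> real) set" where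
  "slice a t V = {x \<in> topspace (Euclidean_space a). x(a := t) \<in> V}"

text \<open>
  A chart \<open>\<kappa>\<close> of \<open>X\<close> over \<open>Q\<close> together with the chart \<open>\<mu>\<close> of the product over \<open>Q \<times> \<real>\<close>: in these
  coordinates the two projections are \<open>f(x) e\<^sup>I \<mapsto> f(x) e\<^sup>I\<close> and \<open>g \<mapsto> g(\<tau>)\<close>.
\<close>

definition product_chart ::
    "nat \<Rightarrow> nat \<Rightarrow> ('x, 's) superspace \<Rightarrow> ('x \<times> real, 'w) superspace \<Rightarrow>
     ('x \<times> real, 'w, 'x, 's) supermap \<Rightarrow> ('x \<times> real, 'w, nat \<Rightarrow> real, superfun) supermap \<Rightarrow>
     'x set \<Rightarrow> (nat \<Rightarrow> real) set \<Rightarrow> ('x, 's, nat \<Rightarrow> real, superfun) supermap \<Rightarrow>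
     ('x \<times> real, 'w, nat \<Rightarrow> real, superfun) supermap \<Rightarrow> bool" where
  "product_chart a b X P pr\<^sub>1 pr\<^sub>2 Q U \<kappa> \<mu> \<longleftrightarrow>
     is_chart a b X Q U \<kappa> \<and>
     is_chart (Suc a) b P (Q \<times> UNIV) (cylinder a U) \<mu> \<and>
     (\<forall>x\<in>Q. \<forall>s. underlying \<mu> (x, s) = (underlying \<kappa> x)(a := s)) \<and>
     (\<forall>V. openin (Euclidean_space a) V \<and> V \<subseteq> U \<longrightarrow>
        (\<forall>f\<in>superfun_carrier a b V.
           pull pr\<^sub>1 (preim (open_subspace X Q) \<kappa> V) (pull \<kappa> V f) =
           pull \<mu> (cylinder a V) (\<lambda>I z. if z \<in> cylinder a V then f I (z(a := 0)) else 0))) \<and>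
     (\<forall>V. openin (Euclidean_space 1) V \<longrightarrow>
        (\<forall>g\<in>superfun_carrier 1 0 V.
           res P (preim P pr\<^sub>2 V) (Q \<times> {s. line_point s \<in> V}) (pull pr\<^sub>2 V g) =
           pull \<mu> {z \<in> cylinder a U. line_point (z a) \<in> V}
             (\<lambda>I z. if z \<in> cylinder a U then g I (line_point (z a)) else 0)))"

text \<open>\<open>P\<close>, with projections \<open>pr\<^sub>1\<close> and \<open>pr\<^sub>2\<close>, is the product of \<open>X\<close> and \<open>\<real>\<^sup>1\<^sup>|\<^sup>0\<close>.\<close>

definition product_with_line ::
    "nat \<Rightarrow> nat \<Rightarrow> ('x, 's) superspace \<Rightarrow> ('x \<times> real, 'w) superspace \<Rightarrow>
     ('x \<times> real, 'w, 'x, 's) supermap \<Rightarrow>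
     ('x \<times> real, 'w, nat \<Rightarrow> real, superfun) supermap \<Rightarrow> bool" where
  "product_with_line a b X P pr\<^sub>1 pr\<^sub>2 \<longleftrightarrow>
     supermanifold (Suc a) b P \<and>
     body P = prod_topology (body X) euclideanreal \<and>
     is_morphism P X pr\<^sub>1 \<and> is_morphism P super_line pr\<^sub>2 \<and>
     (\<forall>x\<in>topspace (body X). \<forall>s.
        underlying pr\<^sub>1 (x, s) = x \<and> underlying pr\<^sub>2 (x, s) = line_point s) \<and>
     (\<forall>x\<in>topspace (body X). \<exists>Q U \<kappa> \<mu>. x \<in> Q \<and> product_chart a b X P pr\<^sub>1 pr\<^sub>2 Q U \<kappa> \<mu>)"

text \<open>The morphism \<open>i\<^sub>t\<close>, given in local coordinates by \<open>f\<^sub>I(x, \<tau>) e\<^sup>I \<mapsto> f\<^sub>I(x, t) e\<^sup>I\<close>.\<close>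

definition is_slice_inclusion ::
    "nat \<Rightarrow> nat \<Rightarrow> ('x, 's) superspace \<Rightarrow> ('x \<times> real, 'w) superspace \<Rightarrow>
     ('x \<times> real, 'w, 'x, 's) supermap \<Rightarrow> ('x \<times> real, 'w, nat \<Rightarrow> real, superfun) supermap \<Rightarrow>
     real \<Rightarrow> ('x, 's, 'x \<times> real, 'w) supermap \<Rightarrow> bool" where
  "is_slice_inclusion a b X P pr\<^sub>1 pr\<^sub>2 t i \<longleftrightarrow>
     is_morphism X P i \<and>
     (\<forall>x\<in>topspace (body X). underlying i x = (x, t)) \<and>
     (\<forall>Q U \<kappa> \<mu>. product_chart a b X P pr\<^sub>1 pr\<^sub>2 Q U \<kappa> \<mu> \<longrightarrow>
        (\<forall>V. openin (Euclidean_space (Suc a)) V \<and> V \<subseteq> cylinder a U \<longrightarrow>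
           (\<forall>f\<in>superfun_carrier (Suc a) b V.
              pull i (preim (open_subspace P (Q \<times> UNIV)) \<mu> V) (pull \<mu> V f) =
              pull \<kappa> (slice a t V) (\<lambda>I x. if x \<in> slice a t V then f I (x(a := t)) else 0))))"

definition superhomotopy ::
    "nat \<Rightarrow> nat \<Rightarrow> ('x, 's) superspace \<Rightarrow> ('x \<times> real, 'w) superspace \<Rightarrow>
     ('x \<times> real, 'w, 'x, 's) supermap \<Rightarrow> ('x \<times> real, 'w, nat \<Rightarrow> real, superfun) supermap \<Rightarrow>
     ('y, 't) superspace \<Rightarrow> ('x, 's, 'y, 't) supermap \<Rightarrow>
     (real \<Rightarrow> ('x, 's, 'y, 't) supermap) \<Rightarrow> bool" where
  "superhomotopy a b X P pr\<^sub>1 pr\<^sub>2 Y \<psi>\<^sub>0 \<psi> \<longleftrightarrow>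
     (\<exists>\<Psi> i. is_morphism P Y \<Psi> \<and>
        (\<forall>t. is_slice_inclusion a b X P pr\<^sub>1 pr\<^sub>2 t (i t)) \<and>
        supermap_eq X Y (supermap_comp P \<Psi> (i 0)) \<psi>\<^sub>0 \<and>
        (\<forall>t. supermap_eq X Y (supermap_comp P \<Psi> (i t)) (\<psi> t)))"

end

theory Submission
  imports Defs
begin

text \<open>
  By Hadamard's lemma the tangent vectors at a point are, in a chart, the linear combinations of the
  even and odd partial derivatives.  Hence \<open>\<psi>\<^sub>t\<close> is transversal to \<open>Z\<close> at \<open>x\<close> iff the columns of
  the Jacobian of \<open>\<psi>\<^sub>t\<close> at \<open>x\<close> and those of the Jacobian of \<open>Z \<rightarrow> Y\<close> at \<open>\<psi>\<^sub>t(x)\<close> together span.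
  Along the set of \<open>(x, t)\<close> with \<open>\<psi>\<^sub>t(x) \<in> Z\<close> these columns depend continuously on \<open>(x, t)\<close>, and
  spanning is an open condition; so is \<open>\<psi>\<^sub>t(x) \<notin> Z\<close>, because \<open>Z\<close> is closed.  So transversality
  holds near every \<open>(x, 0)\<close>, and compactness of \<open>X\<close> makes the bound on \<open>t\<close> uniform.
\<close>

section \<open>Smooth functions on open sets of Euclidean space\<close>

text \<open>Morphisms are only ring homomorphisms on sections, so it is not given that a
  differential sends tangent vectors to real linear derivations. Two facts repair this: the only
  unital ring endomorphism of the reals is the identity, so pullback preserves values of germs; and
  a pulled-back constant differs from that constant by an even section with value 0 at every nearby
  point, which every derivation kills. Germs are handled through coordinate expressions, and one
  superfunction expresses the germs of a section at all points of a neighbourhood. Hence the entries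
  of a Jacobian are partial derivatives of a fixed superfunction at a moving point, which gives
  their continuity. For the homotopy this superfunction lives on the product with the line, so
  continuity is joint in x and t, not just in x for each t. The Jacobian of the inclusion of Z
  exists only over Z, so limits are taken along the points of the product that the homotopy sends
  into Z; there the embedding turns convergence in Y into convergence in Z.\<close>

lemma Euclidean_space_eq_top_of_set:
  "Euclidean_space m = top_of_set (topspace (Euclidean_space m))"
  by (simp add: Euclidean_space_def euclidean_product_topology)

lemma openin_Euclidean_preimage:
  assumes "openin (Euclidean_space m) V" "continuous_on V f" "open T"
  shows "openin (Euclidean_space m) {x \<in> V. f x \<in> T}"
proof -
  have "openin (top_of_set V) (V \<inter> f -` T)"
    by (rule continuous_openin_preimage_gen[OF assms(2,3)])
  moreover have "top_of_set V = subtopology (Euclidean_space m) V"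
    by (metis Euclidean_space_eq_top_of_set assms(1) inf.absorb_iff2 openin_subset subtopology_subtopology)
  moreover have "V \<inter> f -` T = {x \<in> V. f x \<in> T}" by auto
  ultimately show ?thesis by (simp add: openin_open_subtopology[OF assms(1)])
qed

lemma upd_in_Euclidean_space:
  assumes "x \<in> topspace (Euclidean_space m)" "i < m"
  shows "x(i := s) \<in> topspace (Euclidean_space m)"
  using assms by (auto simp: topspace_Euclidean_space)

lemma continuous_map_Euclidean_iff:
  assumes "U \<subseteq> topspace (Euclidean_space m)"
  shows "continuous_map (subtopology (Euclidean_space m) U) euclideanreal f \<longleftrightarrow> continuous_on U f"
proof -
  have "subtopology (Euclidean_space m) U = top_of_set U"
    using assms by (metis Euclidean_space_eq_top_of_set inf.absorb_iff2 subtopology_subtopology)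
  then show ?thesis by simp
qed

lemma continuous_on_coordinate: "continuous_on S (\<lambda>x::nat \<Rightarrow> real. x i)"
  by (rule continuous_on_subset[OF continuous_on_product_coordinates]) simp

lemma continuous_upd:
  fixes x :: "nat \<Rightarrow> real"
  shows "continuous_on S (\<lambda>s. x(i := s))"
proof (rule continuous_on_coordinatewise_then_product)
  fix j show "continuous_on S (\<lambda>s. (x(i := s)) j)"
    by (cases "j = i") (auto intro: continuous_intros)
qed

text \<open>The derivatives in \<open>Ck_on\<close> are two-sided along coordinate lines. Openness
  keeps such a line inside \<open>U\<close> for parameters near \<open>x i\<close>, so only the
  values of a function on \<open>U\<close> matter for them.\<close>

lemma eventually_upd_in_open:
  assumes "openin (Euclidean_space m) U" "x \<in> U" "i < m"
  shows "eventually (\<lambda>s. x(i := s) \<in> U) (nhds (x i))"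
proof -
  obtain T where T: "open T" "U = topspace (Euclidean_space m) \<inter> T"
    using assms(1) by (metis Euclidean_space_eq_top_of_set openin_open)
  have "open ((\<lambda>s. x(i := s)) -` T)"
    using T(1) continuous_upd by (rule open_vimage)
  moreover have "x i \<in> (\<lambda>s. x(i := s)) -` T" using assms T by simp
  ultimately have "eventually (\<lambda>s. s \<in> (\<lambda>s. x(i := s)) -` T) (nhds (x i))"
    by (rule eventually_nhds_in_open)
  then show ?thesis
    by eventually_elim (use assms T upd_in_Euclidean_space in auto)
qed

definition partial_deriv :: "nat \<Rightarrow> ((nat \<Rightarrow> real) \<Rightarrow> real) \<Rightarrow> (nat \<Rightarrow> real) \<Rightarrow> real" where
  "partial_deriv i f x = deriv (\<lambda>s. f (x(i := s))) (x i)"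

section \<open>Smooth functions on a fixed open set: closure properties and rules for partial
  derivatives\<close>

context
  fixes m :: nat and U :: "(nat \<Rightarrow> real) set"
  assumes U: "openin (Euclidean_space m) U"
begin

private lemma Usub: "U \<subseteq> topspace (Euclidean_space m)"
  using U openin_subset by blast

lemma Ck_on_simps:
  "Ck_on 0 m U f \<longleftrightarrow> continuous_on U f"
  "Ck_on (Suc k) m U f \<longleftrightarrow> continuous_on U f \<and>
     (\<forall>i<m. \<exists>g. Ck_on k m U g \<and>
        (\<forall>x\<in>U. ((\<lambda>s. f (x(i := s))) has_real_derivative g x) (at (x i))))"
  using continuous_map_Euclidean_iff[OF Usub] by simp_all

lemma Ck_on_imp_continuous: "Ck_on k m U f \<Longrightarrow> continuous_on U f"
  by (cases k) (auto simp: Ck_on_simps simp del: Ck_on.simps)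

lemma has_derivative_coordinate_cong:
  assumes "\<And>x. x \<in> U \<Longrightarrow> f x = g x" "x \<in> U" "i < m"
  shows "((\<lambda>s. f (x(i := s))) has_real_derivative d) (at (x i)) \<longleftrightarrow>
         ((\<lambda>s. g (x(i := s))) has_real_derivative d) (at (x i))"
proof (rule DERIV_cong_ev)
  show "eventually (\<lambda>s. f (x(i := s)) = g (x(i := s))) (nhds (x i))"
    using eventually_upd_in_open[OF U assms(2,3)] by eventually_elim (use assms in auto)
qed auto

lemma Ck_on_cong:
  assumes "Ck_on k m U f" "\<And>x. x \<in> U \<Longrightarrow> f x = g x"
  shows "Ck_on k m U g"
proof (cases k)
  case 0
  then show ?thesis using assms by (simp add: Ck_on_simps cong: continuous_on_cong del: Ck_on.simps)
next
  case (Suc l)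
  have "continuous_on U g"
    using assms Ck_on_imp_continuous continuous_on_eq by blast
  moreover have "\<exists>h. Ck_on l m U h \<and>
        (\<forall>x\<in>U. ((\<lambda>s. g (x(i := s))) has_real_derivative h x) (at (x i)))" if "i < m" for i
  proof -
    obtain h where h: "Ck_on l m U h"
        "\<forall>x\<in>U. ((\<lambda>s. f (x(i := s))) has_real_derivative h x) (at (x i))"
      using assms(1) \<open>i < m\<close> unfolding Suc Ck_on_simps by meson
    have "((\<lambda>s. g (x(i := s))) has_real_derivative h x) (at (x i))" if "x \<in> U" for x
      using h(2) has_derivative_coordinate_cong[of f g, OF assms(2) that \<open>i < m\<close>] that by blast
    with h(1) show ?thesis by blast
  qed
  ultimately show ?thesis unfolding Suc Ck_on_simps by blast
qed

lemma Ck_on_Suc_imp: "Ck_on (Suc k) m U f \<Longrightarrow> Ck_on k m U f"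
proof (induction k arbitrary: f)
  case (Suc k)
  show ?case unfolding Ck_on_simps
  proof (intro conjI allI impI)
    show "continuous_on U f" by (rule Ck_on_imp_continuous[OF Suc.prems])
    fix i assume "i < m"
    with Suc.prems obtain g where "Ck_on (Suc k) m U g"
        "\<forall>x\<in>U. ((\<lambda>s. f (x(i := s))) has_real_derivative g x) (at (x i))"
      unfolding Ck_on_simps(2)[of "Suc k"] by blast
    with Suc.IH show "\<exists>g. Ck_on k m U g \<and>
        (\<forall>x\<in>U. ((\<lambda>s. f (x(i := s))) has_real_derivative g x) (at (x i)))" by blast
  qed
qed (simp add: Ck_on_simps del: Ck_on.simps)

lemma Ck_on_const: "Ck_on k m U (\<lambda>x. c)"
proof (induction k arbitrary: c)
  case (Suc k)
  have "\<forall>x\<in>U. ((\<lambda>s. c) has_real_derivative (\<lambda>x. 0) x) (at (x i))" for i by simp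
  with Suc show ?case unfolding Ck_on_simps using continuous_on_const by blast
qed (simp add: Ck_on_simps del: Ck_on.simps)

lemma Ck_on_coordinate: "Ck_on k m U (\<lambda>x. x i)"
proof (cases k)
  case 0
  then show ?thesis by (simp add: Ck_on_simps continuous_on_coordinate del: Ck_on.simps)
next
  case (Suc l)
  have "\<exists>g. Ck_on l m U g \<and>
     (\<forall>x\<in>U. ((\<lambda>s. (x(j := s)) i) has_real_derivative g x) (at (x j)))" for j
    by (rule exI[of _ "\<lambda>x. if i = j then 1 else 0"]) (use Ck_on_const in auto)
  then show ?thesis unfolding Suc Ck_on_simps by (simp add: continuous_on_coordinate)
qed

lemma Ck_on_add: "Ck_on k m U f \<Longrightarrow> Ck_on k m U g \<Longrightarrow> Ck_on k m U (\<lambda>x. f x + g x)"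
proof (induction k arbitrary: f g)
  case (Suc k)
  show ?case unfolding Ck_on_simps
  proof (intro conjI allI impI)
    show "continuous_on U (\<lambda>x. f x + g x)"
      using Suc.prems by (intro continuous_intros Ck_on_imp_continuous)
    fix i assume i: "i < m"
    obtain f' where f': "Ck_on k m U f'"
        "\<forall>x\<in>U. ((\<lambda>s. f (x(i := s))) has_real_derivative f' x) (at (x i))"
      using Suc.prems(1) i unfolding Ck_on_simps by blast
    obtain g' where g': "Ck_on k m U g'"
        "\<forall>x\<in>U. ((\<lambda>s. g (x(i := s))) has_real_derivative g' x) (at (x i))"
      using Suc.prems(2) i unfolding Ck_on_simps by blast
    show "\<exists>h. Ck_on k m U h \<and>
        (\<forall>x\<in>U. ((\<lambda>s. f (x(i := s)) + g (x(i := s))) has_real_derivative h x) (at (x i)))"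
      by (rule exI[of _ "\<lambda>x. f' x + g' x"])
        (use f' g' Suc.IH[OF f'(1) g'(1)] in \<open>auto intro!: DERIV_add\<close>)
  qed
qed (auto simp: Ck_on_simps simp del: Ck_on.simps intro: continuous_intros)

lemma Ck_on_mult: "Ck_on k m U f \<Longrightarrow> Ck_on k m U g \<Longrightarrow> Ck_on k m U (\<lambda>x. f x * g x)"
proof (induction k arbitrary: f g)
  case (Suc k)
  show ?case unfolding Ck_on_simps
  proof (intro conjI allI impI)
    show "continuous_on U (\<lambda>x. f x * g x)"
      using Suc.prems by (intro continuous_intros Ck_on_imp_continuous)
    fix i assume i: "i < m"
    obtain f' where f': "Ck_on k m U f'"
        "\<forall>x\<in>U. ((\<lambda>s. f (x(i := s))) has_real_derivative f' x) (at (x i))"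
      using Suc.prems(1) i unfolding Ck_on_simps by blast
    obtain g' where g': "Ck_on k m U g'"
        "\<forall>x\<in>U. ((\<lambda>s. g (x(i := s))) has_real_derivative g' x) (at (x i))"
      using Suc.prems(2) i unfolding Ck_on_simps by blast
    have "Ck_on k m U (\<lambda>x. f' x * g x + g' x * f x)"
      by (intro Ck_on_add Suc.IH f'(1) g'(1) Ck_on_Suc_imp[OF Suc.prems(1)]
          Ck_on_Suc_imp[OF Suc.prems(2)])
    moreover have "((\<lambda>s. f (x(i := s)) * g (x(i := s))) has_real_derivative f' x * g x + g' x * f x)
        (at (x i))" if "x \<in> U" for x
      using DERIV_mult[OF f'(2)[rule_format, OF that] g'(2)[rule_format, OF that]] by simp
    ultimately show "\<exists>h. Ck_on k m U h \<and>
        (\<forall>x\<in>U. ((\<lambda>s. f (x(i := s)) * g (x(i := s))) has_real_derivative h x) (at (x i)))"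
      by blast
  qed
qed (auto simp: Ck_on_simps simp del: Ck_on.simps intro: continuous_intros)

lemma Ck_on_inverse:
  "Ck_on k m U f \<Longrightarrow> (\<And>x. x \<in> U \<Longrightarrow> f x \<noteq> 0) \<Longrightarrow> Ck_on k m U (\<lambda>x. inverse (f x))"
proof (induction k)
  case (Suc k)
  show ?case unfolding Ck_on_simps
  proof (intro conjI allI impI)
    show "continuous_on U (\<lambda>x. inverse (f x))"
      using Ck_on_imp_continuous[OF Suc.prems(1)] Suc.prems(2) by (intro continuous_intros) auto
    fix i assume i: "i < m"
    obtain f' where f': "Ck_on k m U f'"
        "\<forall>x\<in>U. ((\<lambda>s. f (x(i := s))) has_real_derivative f' x) (at (x i))"
      using Suc.prems(1) i unfolding Ck_on_simps by blast
    have "Ck_on k m U (\<lambda>x. inverse (f x))"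
      by (rule Suc.IH[OF Ck_on_Suc_imp[OF Suc.prems(1)] Suc.prems(2)])
    \<comment> \<open>The derivative of \<open>1/f\<close> is a product of factors of class k:
      \<open>f'\<close> by assumption, \<open>1/f\<close> by the induction hypothesis.\<close>
    then have "Ck_on k m U (\<lambda>x. (- 1) * (inverse (f x) * f' x * inverse (f x)))"
      using f'(1) by (intro Ck_on_mult Ck_on_const)
    moreover have "((\<lambda>s. inverse (f (x(i := s)))) has_real_derivative
        (- 1) * (inverse (f x) * f' x * inverse (f x))) (at (x i))" if "x \<in> U" for x
      using DERIV_inverse'[OF f'(2)[rule_format, OF that]] Suc.prems(2)[OF that] by simp
    ultimately show "\<exists>h. Ck_on k m U h \<and>
        (\<forall>x\<in>U. ((\<lambda>s. inverse (f (x(i := s)))) has_real_derivative h x) (at (x i)))"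
      by blast
  qed
qed (auto simp: Ck_on_simps simp del: Ck_on.simps intro: continuous_intros)

lemma Ck_on_subset:
  assumes V: "openin (Euclidean_space m) V" "V \<subseteq> U"
  shows "Ck_on k m U f \<Longrightarrow> Ck_on k m V f"
proof (induction k arbitrary: f)
  case 0
  then show ?case
    using V by (metis Ck_on_imp_continuous Ck_on.simps(1) continuous_map_Euclidean_iff continuous_on_subset openin_subset)
next
  case (Suc k)
  \<comment> \<open>In this context \<open>Ck_on_simps\<close> speaks of \<open>U\<close> only, so
    the recursion over \<open>V\<close> is unfolded in its original form.\<close>
  have *: "continuous_map (subtopology (Euclidean_space m) V) euclideanreal f"
    using Ck_on_imp_continuous[OF Suc.prems] V
    by (metis continuous_map_Euclidean_iff continuous_on_subset openin_subset)
  show ?case unfolding Ck_on.simps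
  proof (intro conjI allI impI *)
    fix i assume "i < m"
    with Suc.prems obtain g where "Ck_on k m U g"
        "\<forall>x\<in>U. ((\<lambda>s. f (x(i := s))) has_real_derivative g x) (at (x i))"
      unfolding Ck_on_simps by blast
    with Suc.IH V show "\<exists>g. Ck_on k m V g \<and>
        (\<forall>x\<in>V. ((\<lambda>s. f (x(i := s))) has_real_derivative g x) (at (x i)))" by blast
  qed
qed

lemma smooth_fun_on_cong:
  "smooth_fun_on m U f \<Longrightarrow> (\<And>x. x \<in> U \<Longrightarrow> f x = g x) \<Longrightarrow> smooth_fun_on m U g"
  unfolding smooth_fun_on_def using Ck_on_cong by blast

lemma smooth_fun_on_const: "smooth_fun_on m U (\<lambda>x. c)"
  unfolding smooth_fun_on_def using Ck_on_const by blast

lemma smooth_fun_on_coordinate: "smooth_fun_on m U (\<lambda>x. x i)"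
  unfolding smooth_fun_on_def using Ck_on_coordinate by blast

lemma smooth_fun_on_add:
  "smooth_fun_on m U f \<Longrightarrow> smooth_fun_on m U g \<Longrightarrow> smooth_fun_on m U (\<lambda>x. f x + g x)"
  unfolding smooth_fun_on_def using Ck_on_add by blast

lemma smooth_fun_on_mult:
  "smooth_fun_on m U f \<Longrightarrow> smooth_fun_on m U g \<Longrightarrow> smooth_fun_on m U (\<lambda>x. f x * g x)"
  unfolding smooth_fun_on_def using Ck_on_mult by blast

lemma smooth_fun_on_sum:
  assumes "\<And>i. i \<in> S \<Longrightarrow> smooth_fun_on m U (f i)"
  shows "smooth_fun_on m U (\<lambda>x. \<Sum>i\<in>S. f i x)"
  using assms
  by (induction S rule: infinite_finite_induct) (auto intro: smooth_fun_on_const smooth_fun_on_add)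

lemma smooth_fun_on_inverse:
  "smooth_fun_on m U f \<Longrightarrow> (\<And>x. x \<in> U \<Longrightarrow> f x \<noteq> 0) \<Longrightarrow> smooth_fun_on m U (\<lambda>x. inverse (f x))"
  unfolding smooth_fun_on_def using Ck_on_inverse by blast

lemma smooth_fun_on_subset:
  "openin (Euclidean_space m) V \<Longrightarrow> V \<subseteq> U \<Longrightarrow> smooth_fun_on m U f \<Longrightarrow> smooth_fun_on m V f"
  unfolding smooth_fun_on_def using Ck_on_subset by blast

lemma smooth_fun_on_imp_continuous: "smooth_fun_on m U f \<Longrightarrow> continuous_on U f"
  unfolding smooth_fun_on_def using Ck_on_imp_continuous by blast

lemma smooth_fun_on_has_partial_deriv:
  assumes "smooth_fun_on m U f" "i < m" "x \<in> U"
  shows "((\<lambda>s. f (x(i := s))) has_real_derivative partial_deriv i f x) (at (x i))"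
proof -
  have "Ck_on (Suc 0) m U f" using assms(1) unfolding smooth_fun_on_def by blast
  then obtain d where "((\<lambda>s. f (x(i := s))) has_real_derivative d) (at (x i))"
    using assms(2,3) unfolding Ck_on_simps by blast
  then show ?thesis unfolding partial_deriv_def by (metis DERIV_imp_deriv)
qed

text \<open>The derivative supplied by \<open>Ck_on (Suc k)\<close> might depend on
  \<open>k\<close>; uniqueness of derivatives identifies all of them with
  \<open>partial_deriv i f\<close> on \<open>U\<close>.\<close>

lemma smooth_fun_on_partial_deriv:
  assumes "smooth_fun_on m U f" "i < m"
  shows "smooth_fun_on m U (partial_deriv i f)"
  unfolding smooth_fun_on_def
proof
  fix k
  have "Ck_on (Suc k) m U f" using assms(1) unfolding smooth_fun_on_def by blast
  then obtain g where g: "Ck_on k m U g"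
        "\<forall>x\<in>U. ((\<lambda>s. f (x(i := s))) has_real_derivative g x) (at (x i))"
    using assms(2) unfolding Ck_on_simps by blast
  have "g x = partial_deriv i f x" if "x \<in> U" for x
    using g(2) that unfolding partial_deriv_def by (metis DERIV_imp_deriv)
  with g(1) show "Ck_on k m U (partial_deriv i f)" by (rule Ck_on_cong)
qed

lemma partial_deriv_cong:
  assumes "\<And>x. x \<in> U \<Longrightarrow> f x = g x" "x \<in> U" "i < m"
  shows "partial_deriv i f x = partial_deriv i g x"
  unfolding partial_deriv_def deriv_def using has_derivative_coordinate_cong[of f g, OF assms] by simp

lemma partial_deriv_add:
  assumes "smooth_fun_on m U f" "smooth_fun_on m U g" "i < m" "x \<in> U"
  shows "partial_deriv i (\<lambda>x. f x + g x) x = partial_deriv i f x + partial_deriv i g x"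
  using DERIV_add[OF smooth_fun_on_has_partial_deriv[OF assms(1,3,4)]
      smooth_fun_on_has_partial_deriv[OF assms(2,3,4)]]
  unfolding partial_deriv_def by (rule DERIV_imp_deriv)

lemma partial_deriv_mult:
  assumes "smooth_fun_on m U f" "smooth_fun_on m U g" "i < m" "x \<in> U"
  shows "partial_deriv i (\<lambda>x. f x * g x) x = partial_deriv i f x * g x + f x * partial_deriv i g x"
  using DERIV_mult[OF smooth_fun_on_has_partial_deriv[OF assms(1,3,4)]
      smooth_fun_on_has_partial_deriv[OF assms(2,3,4)]]
  by (subst partial_deriv_def) (auto intro!: DERIV_imp_deriv simp: mult.commute)

end

lemma partial_deriv_const [simp]: "partial_deriv i (\<lambda>x. c) x = 0"
  by (simp add: partial_deriv_def)

lemma partial_deriv_coordinate: "partial_deriv i (\<lambda>x. x j) x = (if i = j then 1 else 0)"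
  by (auto simp: partial_deriv_def)

section \<open>Continuity of coordinate updates, and cubes as neighbourhoods\<close>

lemma continuous_on_upd:
  assumes "continuous_on S f" "continuous_on S g"
  shows "continuous_on S (\<lambda>z. (f z :: nat \<Rightarrow> real)(i := g z))"
proof (rule continuous_on_coordinatewise_then_product)
  fix j
  have "continuous_on S (\<lambda>z. f z j)"
    using continuous_on_compose2[OF continuous_on_coordinate[of UNIV j] assms(1)] by simp
  then show "continuous_on S (\<lambda>z. ((f z)(i := g z)) j)"
    using assms(2) by (cases "j = i") auto
qed

text \<open>Balls of the maximum norm: membership is tested one coordinate at a time, so a single
  coordinate can be moved towards that of the centre without leaving the set, as the proof of
  Hadamard's lemma requires.\<close>

definition cube :: "nat \<Rightarrow> (nat \<Rightarrow> real) \<Rightarrow> real \<Rightarrow> (nat \<Rightarrow> real) set" where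
  "cube m u d = {x \<in> topspace (Euclidean_space m). \<forall>i<m. \<bar>x i - u i\<bar> < d}"

lemma openin_cube: "openin (Euclidean_space m) (cube m u d)"
proof -
  have "open (\<Inter>i<m. {x :: nat \<Rightarrow> real. \<bar>x i - u i\<bar> < d})"
    by (intro open_INT ballI finite_lessThan open_Collect_less continuous_intros
        continuous_on_coordinate)
  moreover have "cube m u d = topspace (Euclidean_space m) \<inter> (\<Inter>i<m. {x. \<bar>x i - u i\<bar> < d})"
    by (auto simp: cube_def)
  ultimately show ?thesis
    by (subst Euclidean_space_eq_top_of_set) (auto simp: openin_open)
qed

lemma center_in_cube: "u \<in> topspace (Euclidean_space m) \<Longrightarrow> 0 < d \<Longrightarrow> u \<in> cube m u d"
  by (simp add: cube_def)

lemma cube_neighbourhood_base: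
  assumes "openin (Euclidean_space m) V" "u \<in> V"
  obtains d where "d > 0" "cube m u d \<subseteq> V"
proof -
  obtain T where T: "open T" "V = topspace (Euclidean_space m) \<inter> T"
    using assms(1) by (metis Euclidean_space_eq_top_of_set openin_open)
  then have "openin (powertop_real UNIV) T"
    by (simp add: euclidean_product_topology)
  then obtain B where B: "finite {i. B i \<noteq> (UNIV :: real set)}" "\<And>i. open (B i)" "u \<in> Pi\<^sub>E UNIV B"
      "Pi\<^sub>E UNIV B \<subseteq> T"
    using assms(2) T(2) unfolding openin_product_topology_alt by auto
  have "\<exists>e>0. \<forall>y. \<bar>y - u i\<bar> < e \<longrightarrow> y \<in> B i" for i
    using B(2,3) unfolding open_dist dist_real_def by (auto simp: PiE_iff)
  then obtain e where e: "\<And>i. e i > 0" "\<And>i y. \<bar>y - u i\<bar> < e i \<Longrightarrow> y \<in> B i" by metis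
  \<comment> \<open>A basic open set of the product topology restricts the coordinates separately,
    and only the first \<open>m\<close> of them vary here. The 1 keeps the minimum defined for
    \<open>m = 0\<close>.\<close>
  define d where "d = Min (insert 1 (e ` {..<m}))"
  have d: "d > 0" "\<And>i. i < m \<Longrightarrow> d \<le> e i" using e(1) by (auto simp: d_def)
  have "cube m u d \<subseteq> V"
  proof
    fix x assume x: "x \<in> cube m u d"
    have "x i \<in> B i" for i
    proof (cases "i < m")
      case True
      then show ?thesis using x d(2)[OF True] e(2)[of "x i" i] by (auto simp: cube_def)
    next
      \<comment> \<open>Points of Euclidean space vanish from index \<open>m\<close> on, so
        \<open>x\<close> and \<open>u\<close> agree there.\<close>
      case False
      then have "x i = u i"
        using x assms T by (auto simp: cube_def topspace_Euclidean_space)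
      then show ?thesis using B(3) by (auto simp: PiE_iff)
    qed
    then show "x \<in> V" using B(4) T(2) x by (auto simp: cube_def PiE_iff)
  qed
  with d(1) show ?thesis by (rule that)
qed

lemma upd_in_cube: "x \<in> cube m u d \<Longrightarrow> i < m \<Longrightarrow> x(i := s) \<in> cube m u d \<longleftrightarrow> \<bar>s - u i\<bar> < d"
  by (auto simp: cube_def upd_in_Euclidean_space)

lemma segment_in_cube:
  assumes "x \<in> cube m u d" "i < m" "0 \<le> t" "t \<le> 1"
  shows "x(i := u i + t * (x i - u i)) \<in> cube m u d"
proof -
  have "\<bar>t * (x i - u i)\<bar> \<le> 1 * \<bar>x i - u i\<bar>"
    unfolding abs_mult using assms by (intro mult_right_mono) auto
  moreover have "\<bar>x i - u i\<bar> < d" using assms by (auto simp: cube_def)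
  ultimately show ?thesis using assms(1,2) by (simp add: upd_in_cube)
qed

section \<open>Hadamard's lemma\<close>

text \<open>The power of \<open>t\<close> makes the family of these integrals closed under partial derivatives.\<close>

lemma Ck_on_segment_integral:
  assumes "i < m" "Ck_on k m (cube m u d) h"
  shows "Ck_on k m (cube m u d)
    (\<lambda>x. integral {0..1} (\<lambda>t. t ^ j * h (x(i := u i + t * (x i - u i)))))"
  using assms(2)
proof (induction k arbitrary: h j)
  note simps = Ck_on_simps[OF openin_cube]
  have cont: "continuous_on (cube m u d \<times> {0..1})
      (\<lambda>(x, t). t ^ j * h (x(i := u i + t * (x i - u i))))"
    if "continuous_on (cube m u d) h" for h :: "(nat \<Rightarrow> real) \<Rightarrow> real" and j
  proof -
    have c: "continuous_on (cube m u d \<times> {0..1::real}) (\<lambda>z. fst z i)"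
      using continuous_on_compose2[OF continuous_on_coordinate[of UNIV i] continuous_on_fst[OF continuous_on_id]] by simp
    have "continuous_on (cube m u d \<times> {0..1})
        (\<lambda>z. h ((fst z)(i := u i + snd z * (fst z i - u i))))"
    proof (rule continuous_on_compose2[OF that])
      show "continuous_on (cube m u d \<times> {0..1})
          (\<lambda>z. (fst z)(i := u i + snd z * (fst z i - u i)))"
        by (intro continuous_on_upd continuous_intros c)
    qed (use segment_in_cube[OF _ assms(1)] in auto)
    then have "continuous_on (cube m u d \<times> {0..1})
        (\<lambda>z. snd z ^ j * h ((fst z)(i := u i + snd z * (fst z i - u i))))"
      by (intro continuous_intros)
    then show ?thesis by (simp add: case_prod_unfold)
  qed
  have cont_integral: "continuous_on (cube m u d)
      (\<lambda>x. integral {0..1} (\<lambda>t. t ^ j * h (x(i := u i + t * (x i - u i)))))"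
    if "continuous_on (cube m u d) h" for h j
    by (rule integral_continuous_on_param[where a = "0::real" and b = 1,
          unfolded box_real, OF cont[OF that]])
  {
    case 0
    then show ?case unfolding simps by (rule cont_integral)
  next
    case (Suc k)
    note h_cont = Ck_on_imp_continuous[OF openin_cube Suc.prems]
    show ?case unfolding simps
    proof (intro conjI allI impI cont_integral[OF h_cont])
      fix l assume l: "l < m"
      obtain g where g: "Ck_on k m (cube m u d) g"
          "\<And>x. x \<in> cube m u d \<Longrightarrow> ((\<lambda>s. h (x(l := s))) has_real_derivative g x) (at (x l))"
        using Suc.prems l unfolding simps by meson
      note g_cont = Ck_on_imp_continuous[OF openin_cube g(1)]
      \<comment> \<open>The chain rule contributes a factor \<open>t\<close> exactly when
        \<open>l\<close> is the coordinate that is scaled by \<open>t\<close>.\<close>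
      define r where "r = (if l = i then Suc j else j)"
      let ?G = "\<lambda>x. integral {0..1} (\<lambda>t. t ^ r * g (x(i := u i + t * (x i - u i))))"
      have "((\<lambda>s. integral {0..1} (\<lambda>t. t ^ j * h ((x(l := s))(i := u i + t * ((x(l := s)) i - u i)))))
          has_real_derivative ?G x) (at (x l))" if x: "x \<in> cube m u d" for x
      proof -
        let ?I = "{u l - d<..<u l + d}"
        let ?f = "\<lambda>s t. t ^ j * h ((x(l := s))(i := u i + t * ((x(l := s)) i - u i)))"
        let ?f' = "\<lambda>s t. t ^ r * g ((x(l := s))(i := u i + t * ((x(l := s)) i - u i)))"
        have in_box: "x(l := s) \<in> cube m u d" if "s \<in> ?I" for s
          unfolding upd_in_cube[OF x l] using that by (simp add: abs_less_iff)
        have seg: "(x(l := s))(i := u i + t * ((x(l := s)) i - u i)) \<in> cube m u d"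
          if "s \<in> ?I" "t \<in> {0..1}" for s t
          using segment_in_cube[OF in_box[OF that(1)] assms(1)] that(2) by simp
        \<comment> \<open>Differentiation under the integral takes place on the open interval of
          values of coordinate \<open>l\<close> allowed by the cube; being open, it yields the
          unrestricted derivative afterwards.\<close>
        have "((\<lambda>s. integral (cbox 0 1) (?f s)) has_real_derivative integral (cbox 0 1) (?f' (x l)))
            (at (x l) within ?I)"
        proof (rule leibniz_rule_field_derivative)
          fix s t assume st: "s \<in> ?I" "t \<in> cbox 0 (1::real)"
          have gd: "((\<lambda>s'. h (((x(l := s))(i := u i + t * ((x(l := s)) i - u i)))(l := s')))
              has_real_derivative g ((x(l := s))(i := u i + t * ((x(l := s)) i - u i))))
              (at (((x(l := s))(i := u i + t * ((x(l := s)) i - u i))) l))"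
            using g(2)[OF seg[OF st(1)]] st(2) by simp
          have "((\<lambda>s. ?f s t) has_real_derivative ?f' s t) (at s)"
          proof (cases "l = i")
            case True
            have "((\<lambda>s. u i + t * (s - u i)) has_real_derivative t) (at s)"
              by (auto intro!: derivative_eq_intros)
            from DERIV_chain2[of "\<lambda>s'. h (x(i := s'))", OF _ this] gd
            have "((\<lambda>s. h (x(i := u i + t * (s - u i)))) has_real_derivative
                g (x(i := u i + t * (s - u i))) * t) (at s)"
              using True by simp
            from DERIV_cmult[OF this, of "t ^ j"] show ?thesis
              using True by (simp add: r_def algebra_simps)
          next
            case False
            then have "((\<lambda>s'. h ((x(l := s'))(i := u i + t * (x i - u i)))) has_real_derivative
                g ((x(l := s))(i := u i + t * (x i - u i)))) (at s)"
              using gd by (simp add: fun_upd_twist)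
            from DERIV_cmult[OF this, of "t ^ j"] show ?thesis
              using False by (simp add: r_def)
          qed
          then show "((\<lambda>s. ?f s t) has_real_derivative ?f' s t) (at s within ?I)"
            by (rule has_field_derivative_at_within)
        next
          fix s assume s: "s \<in> ?I"
          have "continuous_on {0..1} (\<lambda>t. (x(l := s), t))"
            by (intro continuous_intros)
          from continuous_on_compose2[OF cont[OF h_cont, of j] this] in_box[OF s]
          have "continuous_on {0..1} (?f s)"
            unfolding prod.case by blast
          then show "?f s integrable_on cbox 0 1" by (simp add: integrable_continuous_real)
        next
          have "continuous_on (?I \<times> {0..1}) (\<lambda>z. (x(l := fst z), snd z))"
            by (intro continuous_intros continuous_on_upd)
          moreover have "(\<lambda>z. (x(l := fst z), snd z)) ` (?I \<times> {0..1}) \<subseteq> cube m u d \<times> {0..1}"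
            using in_box by force
          ultimately have "continuous_on (?I \<times> {0..1}) (\<lambda>z. (\<lambda>(x, t). t ^ r * g (x(i := u i + t * (x i - u i))))
              (x(l := fst z), snd z))"
            by (rule continuous_on_compose2[OF cont[OF g_cont, of r]])
          then show "continuous_on (?I \<times> cbox 0 1) (\<lambda>(s, t). ?f' s t)"
            unfolding case_prod_unfold box_real fst_conv snd_conv .
        next
          show "x l \<in> ?I" using x l by (auto simp: cube_def abs_less_iff)
        qed simp
        moreover have "at (x l) within ?I = at (x l)"
          by (rule at_within_open) (use x l in \<open>auto simp: cube_def abs_less_iff\<close>)
        ultimately show ?thesis by simp
      qed
      moreover have "Ck_on k m (cube m u d) ?G" by (rule Suc.IH[OF g(1)])
      ultimately show "\<exists>G. Ck_on k m (cube m u d) G \<and> (\<forall>x\<in>cube m u d.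
          ((\<lambda>s. integral {0..1} (\<lambda>t. t ^ j * h ((x(l := s))(i := u i + t * ((x(l := s)) i - u i)))))
            has_real_derivative G x) (at (x l)))"
        by blast
    qed
  }
qed

lemma Ck_on_fix_coordinate:
  assumes "i < m" "d > 0" "Ck_on k m (cube m u d) h"
  shows "Ck_on k m (cube m u d) (\<lambda>x. h (x(i := u i)))"
  using assms(3)
proof (induction k arbitrary: h)
  note simps = Ck_on_simps[OF openin_cube]
  have in_box: "x(i := u i) \<in> cube m u d" if "x \<in> cube m u d" for x
    using upd_in_cube[OF that assms(1)] assms(2) by simp
  have cont: "continuous_on (cube m u d) (\<lambda>x. h (x(i := u i)))"
    if "continuous_on (cube m u d) h" for h :: "(nat \<Rightarrow> real) \<Rightarrow> real"
    by (rule continuous_on_compose2[OF that continuous_on_upd[OF continuous_on_id continuous_on_const]])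
      (use in_box in auto)
  {
    case 0
    then show ?case unfolding simps by (rule cont)
  next
    case (Suc k)
    show ?case unfolding simps
    proof (intro conjI allI impI cont[OF Ck_on_imp_continuous[OF openin_cube Suc.prems]])
      fix l assume l: "l < m"
      obtain g where g: "Ck_on k m (cube m u d) g"
          "\<And>x. x \<in> cube m u d \<Longrightarrow> ((\<lambda>s. h (x(l := s))) has_real_derivative g x) (at (x l))"
        using Suc.prems l unfolding simps by meson
      show "\<exists>G. Ck_on k m (cube m u d) G \<and> (\<forall>x\<in>cube m u d.
          ((\<lambda>s. h ((x(l := s))(i := u i))) has_real_derivative G x) (at (x l)))"
      proof (cases "l = i")
        case True
        then show ?thesis
          by (intro exI[of _ "\<lambda>x. 0"]) (simp add: Ck_on_const[OF openin_cube])
      next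
        case False
        have "((\<lambda>s. h ((x(l := s))(i := u i))) has_real_derivative g (x(i := u i))) (at (x l))"
          if "x \<in> cube m u d" for x
          using g(2)[OF in_box[OF that]] False by (simp add: fun_upd_twist)
        with Suc.IH[OF g(1)] show ?thesis by blast
      qed
    qed
  }
qed

text \<open>The fundamental theorem of calculus along the segment from \<open>x(i := u i)\<close> to
  \<open>x\<close>; the factor \<open>g\<close> is the mean of the partial derivative over that
  segment.\<close>

lemma Hadamard_one_coordinate:
  assumes f: "smooth_fun_on m (cube m u d) f" and i: "i < m" and d: "d > 0"
  obtains g where "smooth_fun_on m (cube m u d) g"
    "\<And>x. x \<in> cube m u d \<Longrightarrow> f x = f (x(i := u i)) + (x i - u i) * g x"
proof
  let ?f' = "partial_deriv i f"
  \<comment> \<open>The factor \<open>t ^ 0\<close> makes this an instance of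
    \<open>Ck_on_segment_integral\<close>.\<close>
  let ?g = "\<lambda>x. integral {0..1} (\<lambda>t. t ^ 0 * ?f' (x(i := u i + t * (x i - u i))))"
  have f': "smooth_fun_on m (cube m u d) ?f'"
    by (rule smooth_fun_on_partial_deriv[OF openin_cube f i])
  then show "smooth_fun_on m (cube m u d) ?g"
    unfolding smooth_fun_on_def using Ck_on_segment_integral[OF i] by blast
  fix x assume x: "x \<in> cube m u d"
  have "((\<lambda>t. (x i - u i) * ?f' (x(i := u i + t * (x i - u i)))) has_integral
      f (x(i := u i + 1 * (x i - u i))) - f (x(i := u i + 0 * (x i - u i)))) {0..1}"
  proof (rule fundamental_theorem_of_calculus)
    fix t :: real assume t: "t \<in> {0..1}"
    have 1: "((\<lambda>t. u i + t * (x i - u i)) has_real_derivative x i - u i) (at t)"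
      by (auto intro!: derivative_eq_intros)
    have 2: "((\<lambda>s. f (x(i := s))) has_real_derivative ?f' (x(i := u i + t * (x i - u i))))
        (at (u i + t * (x i - u i)))"
      using smooth_fun_on_has_partial_deriv[OF openin_cube f i segment_in_cube[OF x i]] t by simp
    have "((\<lambda>t. f (x(i := u i + t * (x i - u i)))) has_real_derivative
        ?f' (x(i := u i + t * (x i - u i))) * (x i - u i)) (at t)"
      by (rule DERIV_chain2[where f = "\<lambda>s. f (x(i := s))", OF 2 1])
    then show "((\<lambda>t. f (x(i := u i + t * (x i - u i)))) has_vector_derivative
        (x i - u i) * ?f' (x(i := u i + t * (x i - u i)))) (at t within {0..1})"
      by (simp add: has_real_derivative_iff_has_vector_derivative mult.commute
          has_vector_derivative_at_within)
  qed simp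
  then have "(x i - u i) * integral {0..1} (\<lambda>t. ?f' (x(i := u i + t * (x i - u i))))
      = f x - f (x(i := u i))"
    by (simp add: integral_unique flip: integral_mult_right)
  then show "f x = f (x(i := u i)) + (x i - u i) * ?g x" by simp
qed

text \<open>A telescoping argument: coordinates are moved to the centre one after the other, and
  each move costs one term \<open>(x i - u i) * g i x\<close>. Here \<open>?rep n x\<close> is the
  point reached after \<open>n\<close> moves.\<close>

lemma Hadamard:
  assumes f: "smooth_fun_on m (cube m u d) f" and u: "u \<in> topspace (Euclidean_space m)" and d: "d > 0"
  obtains g where "\<And>i. i < m \<Longrightarrow> smooth_fun_on m (cube m u d) (g i)"
    "\<And>x. x \<in> cube m u d \<Longrightarrow> f x = f u + (\<Sum>i<m. (x i - u i) * g i x)"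
proof -
  let ?rep = "\<lambda>n (x :: nat \<Rightarrow> real) j. if j < n then u j else x j"
  have "\<exists>g. (\<forall>i<n. smooth_fun_on m (cube m u d) (g i)) \<and>
      smooth_fun_on m (cube m u d) (\<lambda>x. f (?rep n x)) \<and>
      (\<forall>x\<in>cube m u d. f x = f (?rep n x) + (\<Sum>i<n. (x i - u i) * g i x))" if "n \<le> m" for n
    using that
  proof (induction n)
    case 0
    then show ?case using f by simp
  next
    case (Suc n)
    then obtain g where g: "\<forall>i<n. smooth_fun_on m (cube m u d) (g i)"
        "smooth_fun_on m (cube m u d) (\<lambda>x. f (?rep n x))"
        "\<forall>x\<in>cube m u d. f x = f (?rep n x) + (\<Sum>i<n. (x i - u i) * g i x)"
      by auto
    have n: "n < m" using Suc.prems by simp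
    obtain h where h: "smooth_fun_on m (cube m u d) h"
        "\<And>x. x \<in> cube m u d \<Longrightarrow> f (?rep n x) = f (?rep n (x(n := u n))) + (x n - u n) * h x"
      using Hadamard_one_coordinate[OF g(2) n d] by metis
    have eq: "?rep n (x(n := u n)) = ?rep (Suc n) x" for x
      by (auto simp: less_Suc_eq)
    have "smooth_fun_on m (cube m u d) (\<lambda>x. f (?rep n (x(n := u n))))"
      using g(2) Ck_on_fix_coordinate[OF n d] unfolding smooth_fun_on_def by blast
    then have "smooth_fun_on m (cube m u d) (\<lambda>x. f (?rep (Suc n) x))" unfolding eq .
    with g h show ?case unfolding eq
      by (intro exI[of _ "g(n := h)"]) (auto simp: less_Suc_eq)
  qed
  from this[of m] obtain g where g: "\<forall>i<m. smooth_fun_on m (cube m u d) (g i)"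
      "\<forall>x\<in>cube m u d. f x = f (?rep m x) + (\<Sum>i<m. (x i - u i) * g i x)"
    by auto
  \<comment> \<open>Beyond index \<open>m\<close> both points vanish, so after \<open>m\<close>
    moves the centre is reached.\<close>
  have "?rep m x = u" if "x \<in> cube m u d" for x
    using that u by (auto simp: cube_def topspace_Euclidean_space)
  with g show ?thesis using that[of g] by simp
qed

section \<open>Superfunctions\<close>

text \<open>The product of \<open>superfun_algebra\<close>, whose formula involves neither
  dimensions nor domain. For infinite \<open>K\<close> the sum runs over the infinite set
  \<open>Pow K\<close> and is 0 by convention.\<close>

definition superfun_mult :: "superfun \<Rightarrow> superfun \<Rightarrow> superfun" where
  "superfun_mult f g = (\<lambda>K x. \<Sum>I\<in>Pow K. theta_sign I (K - I) * f I x * g (K - I) x)"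

text \<open>The superfunction h theta^I, cut off outside \<open>V\<close> as
  \<open>superfun_carrier\<close> demands.\<close>

definition superfun_monomial ::
    "(nat \<Rightarrow> real) set \<Rightarrow> nat set \<Rightarrow> ((nat \<Rightarrow> real) \<Rightarrow> real) \<Rightarrow> superfun" where
  "superfun_monomial V I h = (\<lambda>K x. if K = I \<and> x \<in> V then h x else 0)"

definition superfun_restrict :: "(nat \<Rightarrow> real) set \<Rightarrow> superfun \<Rightarrow> superfun" where
  "superfun_restrict V f = (\<lambda>I x. if x \<in> V then f I x else 0)"

lemma superfun_algebra_simps [simp]:
  "carrier (superfun_algebra m n V) = superfun_carrier m n V"
  "f \<otimes>\<^bsub>superfun_algebra m n V\<^esub> g = superfun_mult f g"
  "\<one>\<^bsub>superfun_algebra m n V\<^esub> = superfun_monomial V {} (\<lambda>x. 1)"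
  "\<zero>\<^bsub>superfun_algebra m n V\<^esub> = (\<lambda>I x. 0)"
  "f \<oplus>\<^bsub>superfun_algebra m n V\<^esub> g = (\<lambda>I x. f I x + g I x)"
  "c \<odot>\<^bsub>superfun_algebra m n V\<^esub> f = (\<lambda>I x. c * f I x)"
  by (simp_all add: superfun_algebra_def superfun_mult_def superfun_monomial_def)

lemma superfun_algebra_homog:
  "f \<in> homog (superfun_algebra m n V) j \<longleftrightarrow>
     f \<in> superfun_carrier m n V \<and> (\<forall>I x. f I x \<noteq> 0 \<longrightarrow> of_nat (card I) = j)"
  by (simp add: superfun_algebra_def)

lemma theta_sign_empty [simp]: "theta_sign {} I = 1" "theta_sign I {} = 1"
  by (simp_all add: theta_sign_def)

lemma superfun_mult_body: "superfun_mult f g {} x = f {} x * g {} x"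
  by (simp add: superfun_mult_def)

text \<open>Both terms carry the sign +1 because one of the two index sets is empty. For this reason
  the coefficient of a single theta obeys the unsigned Leibniz rule at a point.\<close>

lemma superfun_mult_singleton:
  "superfun_mult f g {j} x = f {} x * g {j} x + f {j} x * g {} x"
proof -
  have "Pow {j} = {{}, {j}}" by auto
  then show ?thesis by (simp add: superfun_mult_def)
qed

lemma superfun_mult_monomials:
  assumes "finite I" "finite J" "I \<inter> J = {}"
  shows "superfun_mult (superfun_monomial V I h) (superfun_monomial V J g) =
    superfun_monomial V (I \<union> J) (\<lambda>x. theta_sign I J * h x * g x)"
proof (intro ext)
  fix K x
  let ?t = "\<lambda>L. theta_sign L (K - L) * superfun_monomial V I h L x * superfun_monomial V J g (K - L) x"
  show "superfun_mult (superfun_monomial V I h) (superfun_monomial V J g) K x =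
    superfun_monomial V (I \<union> J) (\<lambda>x. theta_sign I J * h x * g x) K x"
  proof (cases "K = I \<union> J")
    case True
    \<comment> \<open>Only the splitting of \<open>K\<close> into \<open>I\<close> and
      \<open>J\<close> contributes.\<close>
    have "(\<Sum>L\<in>Pow K. ?t L) = (\<Sum>L\<in>{I}. ?t L)"
      by (rule sum.mono_neutral_right)
        (use True assms in \<open>auto simp: superfun_monomial_def\<close>)
    moreover have "K - I = J" using True assms by auto
    ultimately show ?thesis using True by (simp add: superfun_mult_def superfun_monomial_def)
  next
    case False
    have "?t L = 0" if "L \<in> Pow K" for L
      using that False by (auto simp: superfun_monomial_def)
    then have "(\<Sum>L\<in>Pow K. ?t L) = 0" by (intro sum.neutral ballI)
    then show ?thesis using False by (simp add: superfun_mult_def superfun_monomial_def)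
  qed
qed

lemma superfun_carrier_support:
  "f \<in> superfun_carrier m n V \<Longrightarrow> x \<notin> V \<or> \<not> I \<subseteq> {..<n} \<Longrightarrow> f I x = 0"
  unfolding superfun_carrier_def by blast

lemma superfun_carrier_smooth: "f \<in> superfun_carrier m n V \<Longrightarrow> smooth_fun_on m V (f I)"
  unfolding superfun_carrier_def by blast

lemma superfun_carrierI:
  assumes "\<And>I x. x \<notin> V \<or> \<not> I \<subseteq> {..<n} \<Longrightarrow> f I x = 0" "\<And>I. smooth_fun_on m V (f I)"
  shows "f \<in> superfun_carrier m n V"
  using assms unfolding superfun_carrier_def by blast

section \<open>The space of superfunctions over a fixed open set\<close>

context
  fixes m n :: nat and V :: "(nat \<Rightarrow> real) set"
  assumes V: "openin (Euclidean_space m) V"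
begin

lemma superfun_carrier_add:
  assumes "f \<in> superfun_carrier m n V" "g \<in> superfun_carrier m n V"
  shows "(\<lambda>I x. f I x + g I x) \<in> superfun_carrier m n V"
proof (rule superfun_carrierI)
  show "smooth_fun_on m V (\<lambda>x. f I x + g I x)" for I
    using assms by (intro smooth_fun_on_add[OF V] superfun_carrier_smooth)
qed (use superfun_carrier_support[OF assms(1)] superfun_carrier_support[OF assms(2)] in auto)

lemma superfun_carrier_smult:
  assumes "f \<in> superfun_carrier m n V"
  shows "(\<lambda>I x. c * f I x) \<in> superfun_carrier m n V"
proof (rule superfun_carrierI)
  show "smooth_fun_on m V (\<lambda>x. c * f I x)" for I
    using assms by (intro smooth_fun_on_mult[OF V] smooth_fun_on_const[OF V] superfun_carrier_smooth)
qed (use superfun_carrier_support[OF assms] in auto)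

lemma superfun_carrier_zero: "(\<lambda>I x. 0) \<in> superfun_carrier m n V"
  by (intro superfun_carrierI smooth_fun_on_const[OF V]) auto

lemma superfun_carrier_sum:
  assumes "\<And>J. J \<in> S \<Longrightarrow> F J \<in> superfun_carrier m n V"
  shows "(\<lambda>I x. \<Sum>J\<in>S. F J I x) \<in> superfun_carrier m n V"
  using assms
  by (induction S rule: infinite_finite_induct) (simp_all add: superfun_carrier_zero superfun_carrier_add)

lemma superfun_carrier_mult:
  assumes "f \<in> superfun_carrier m n V" "g \<in> superfun_carrier m n V"
  shows "superfun_mult f g \<in> superfun_carrier m n V"
proof (rule superfun_carrierI)
  fix I x assume *: "x \<notin> V \<or> \<not> I \<subseteq> {..<n}"
  have "theta_sign J (I - J) * f J x * g (I - J) x = 0" if "J \<in> Pow I" for J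
    using * that superfun_carrier_support[OF assms(1), of x J]
      superfun_carrier_support[OF assms(2), of x "I - J"] by auto
  then show "superfun_mult f g I x = 0" unfolding superfun_mult_def by (intro sum.neutral ballI)
next
  fix I
  show "smooth_fun_on m V (superfun_mult f g I)"
    unfolding superfun_mult_def
    by (intro smooth_fun_on_sum[OF V] smooth_fun_on_mult[OF V] smooth_fun_on_const[OF V]
        superfun_carrier_smooth[OF assms(1)] superfun_carrier_smooth[OF assms(2)])
qed

lemma superfun_monomial_carrier:
  assumes "smooth_fun_on m V h" "I \<subseteq> {..<n}"
  shows "superfun_monomial V I h \<in> superfun_carrier m n V"
proof (rule superfun_carrierI)
  fix K
  show "smooth_fun_on m V (superfun_monomial V I h K)"
    by (rule smooth_fun_on_cong[OF V, of "if K = I then h else (\<lambda>x. 0)"])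
      (use assms smooth_fun_on_const[OF V] in \<open>auto simp: superfun_monomial_def\<close>)
qed (use assms in \<open>auto simp: superfun_monomial_def\<close>)

lemma superfun_decompose:
  assumes "f \<in> superfun_carrier m n V"
  shows "f = (\<lambda>K x. \<Sum>J\<in>Pow {..<n}. superfun_monomial V J (f J) K x)"
proof (intro ext)
  fix K x
  have "(\<Sum>J\<in>Pow {..<n}. superfun_monomial V J (f J) K x) =
      (\<Sum>J\<in>Pow {..<n}. if K = J then (if x \<in> V then f J x else 0) else 0)"
    by (intro sum.cong) (auto simp: superfun_monomial_def)
  also have "\<dots> = f K x"
    using superfun_carrier_support[OF assms, of x K] by (auto simp: sum.delta')
  finally show "f K x = (\<Sum>J\<in>Pow {..<n}. superfun_monomial V J (f J) K x)" by simp
qed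

lemma superfun_restrict_carrier:
  assumes "openin (Euclidean_space m) W" "W \<subseteq> V" "f \<in> superfun_carrier m n V"
  shows "superfun_restrict W f \<in> superfun_carrier m n W"
  unfolding superfun_carrier_def
proof (intro CollectI conjI allI impI)
  fix I
  have "smooth_fun_on m W (f I)"
    using smooth_fun_on_subset[OF V assms(1,2)] superfun_carrier_smooth[OF assms(3)] by blast
  then show "smooth_fun_on m W (superfun_restrict W f I)"
    by (rule smooth_fun_on_cong[OF assms(1)]) (simp add: superfun_restrict_def)
qed (use assms(3) in \<open>auto simp: superfun_restrict_def superfun_carrier_def split: if_splits\<close>)

lemma superfun_carrier_bit_part:
  assumes "f \<in> superfun_carrier m n V"
  shows "(\<lambda>I x. if of_nat (card I) = (j::bit) then f I x else 0) \<in> superfun_carrier m n V"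
proof (rule superfun_carrierI)
  fix I show "smooth_fun_on m V (\<lambda>x. if of_nat (card I) = j then f I x else 0)"
    using superfun_carrier_smooth[OF assms] smooth_fun_on_const[OF V]
      by (cases "of_nat (card I) = j") simp_all
qed (use superfun_carrier_support[OF assms] in auto)

end

text \<open>Solves f g = 1 coefficient by coefficient: the theta^K coefficient of the product
  contains \<open>g K\<close> only in the summand of the empty set, with factor
  \<open>f {} x\<close>, while all other summands involve \<open>g\<close> at proper subsets of
  \<open>K\<close>.\<close>

function superfun_inverse :: "superfun \<Rightarrow> superfun" where
  "superfun_inverse f K x = (if finite K then
     (if K = {} then inverse (f {} x) else
      - inverse (f {} x) *
        (\<Sum>I\<in>Pow K - {{}}. theta_sign I (K - I) * f I x * superfun_inverse f (K - I) x))
     else 0)"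
  by pat_completeness auto
termination
proof (relation "Wellfounded.measure (\<lambda>(f, K, x). card K)")
  fix K I :: "nat set"
  assume "finite K" "I \<in> Pow K - {{}}"
  then have "K - I \<subset> K" "finite K" by auto
  then show "((f, K - I, x), (f, K, x)) \<in> Wellfounded.measure (\<lambda>(f, K, x). card K)" for f x
    by (simp add: psubset_card_mono)
qed simp

declare superfun_inverse.simps [simp del]

lemma superfun_inverse_carrier:
  assumes V: "openin (Euclidean_space m) V" and f: "f \<in> superfun_carrier m n V"
    and nz: "\<And>x. x \<in> V \<Longrightarrow> f {} x \<noteq> 0"
  shows "superfun_inverse f \<in> superfun_carrier m n V"
proof (rule superfun_carrierI)
  fix K :: "nat set" and x assume "x \<notin> V \<or> \<not> K \<subseteq> {..<n}"
  then show "superfun_inverse f K x = 0"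
  proof (induction "card K" arbitrary: K rule: less_induct)
    case less
    show ?case
    proof (cases "finite K \<and> K \<noteq> {}")
      case True
      have "theta_sign I (K - I) * f I x * superfun_inverse f (K - I) x = 0"
        if I: "I \<in> Pow K - {{}}" for I
      proof (cases "x \<notin> V \<or> \<not> I \<subseteq> {..<n}")
        \<comment> \<open>Now \<open>x \<in> V\<close> and \<open>I\<close> lies below
          \<open>n\<close>, so \<open>K - I\<close> cannot lie below \<open>n\<close> and the
          induction hypothesis applies to it.\<close>
        case False
        moreover have "card (K - I) < card K" using True I by (intro psubset_card_mono) auto
        ultimately show ?thesis using less I by auto
      qed (simp add: superfun_carrier_support[OF f])
      then have "(\<Sum>I\<in>Pow K - {{}}. theta_sign I (K - I) * f I x * superfun_inverse f (K - I) x) = 0"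
        by (intro sum.neutral ballI)
      then show ?thesis using True by (subst superfun_inverse.simps) simp
    next
      case False
      \<comment> \<open>For \<open>K = {}\<close> the assumption leaves only
        \<open>x \<notin> V\<close>, where \<open>f {} x = 0\<close> and
        \<open>inverse 0 = 0\<close>.\<close>
      then show ?thesis
        using less.prems superfun_carrier_support[OF f, of x "{}"]
        by (subst superfun_inverse.simps) auto
    qed
  qed
next
  fix K :: "nat set"
  show "smooth_fun_on m V (superfun_inverse f K)"
  proof (induction "card K" arbitrary: K rule: less_induct)
    case less
    note [intro] = smooth_fun_on_inverse[OF V superfun_carrier_smooth[OF f] nz]
    show ?case
    proof (cases "finite K \<and> K \<noteq> {}")
      case True
      have "smooth_fun_on m V (\<lambda>x. - 1 * inverse (f {} x) * (\<Sum>I\<in>Pow K - {{}}.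
          theta_sign I (K - I) * f I x * superfun_inverse f (K - I) x))"
      proof (intro smooth_fun_on_sum[OF V] smooth_fun_on_mult[OF V] smooth_fun_on_const[OF V]
          superfun_carrier_smooth[OF f] smooth_fun_on_inverse[OF V] nz less)
        fix I assume "I \<in> Pow K - {{}}"
        then show "card (K - I) < card K" using True by (intro psubset_card_mono) auto
      qed
      then show ?thesis
        by (rule smooth_fun_on_cong[OF V]) (use True in \<open>subst superfun_inverse.simps, auto\<close>)
    next
      case False
      have "smooth_fun_on m V (\<lambda>x. if K = {} then inverse (f {} x) else 0)"
        using smooth_fun_on_const[OF V] by (cases "K = {}") auto
      then show ?thesis
        by (rule smooth_fun_on_cong[OF V]) (use False in \<open>subst superfun_inverse.simps, auto\<close>)
    qed
  qed
qed

text \<open>The recursion was chosen so that the summand of the empty set cancels the rest of each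
  higher coefficient. This is an inverse on one side; \<open>Units_stalk_iff\<close> obtains the
  other side.\<close>

lemma superfun_mult_inverse:
  assumes V: "openin (Euclidean_space m) V" and f: "f \<in> superfun_carrier m n V"
    and nz: "\<And>x. x \<in> V \<Longrightarrow> f {} x \<noteq> 0"
  shows "superfun_mult f (superfun_inverse f) = superfun_monomial V {} (\<lambda>x. 1)"
proof (intro ext)
  fix K x
  let ?g = "superfun_inverse f"
  let ?t = "\<lambda>I. theta_sign I (K - I) * f I x * ?g (K - I) x"
  consider "x \<notin> V" | "K = {}" "x \<in> V" | "infinite K" | "x \<in> V" "finite K" "K \<noteq> {}" by blast
  then show "superfun_mult f ?g K x = superfun_monomial V {} (\<lambda>x. 1) K x"
  proof cases
    case 1
    then show ?thesis
      using superfun_carrier_support[OF f] by (simp add: superfun_mult_def superfun_monomial_def)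
  next
    case 2
    then show ?thesis
      using nz by (simp add: superfun_mult_body superfun_monomial_def superfun_inverse.simps[of f "{}"])
  next
    case 3
    \<comment> \<open>A sum over an infinite set is 0, and an infinite \<open>K\<close> is not the
      empty index set of the unit.\<close>
    then show ?thesis by (auto simp: superfun_mult_def superfun_monomial_def)
  next
    case 4
    have "(\<Sum>I\<in>Pow K. ?t I) = ?t {} + (\<Sum>I\<in>Pow K - {{}}. ?t I)"
      using 4 by (subst sum.remove[of _ "{}"]) auto
    also have "?t {} = - (\<Sum>I\<in>Pow K - {{}}. ?t I)"
      using 4 nz[of x] by (simp add: superfun_inverse.simps[of f K])
    finally show ?thesis using 4 by (simp add: superfun_mult_def superfun_monomial_def)
  qed
qed

section \<open>Derivations of superfunctions at a point\<close>

text \<open>Coordinates \<open>k < a\<close> are the even ones, coordinates \<open>a + j\<close> the odd ones.\<close>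

definition super_partial :: "nat \<Rightarrow> nat \<Rightarrow> superfun \<Rightarrow> (nat \<Rightarrow> real) \<Rightarrow> real" where
  "super_partial a k f u = (if k < a then partial_deriv k (f {}) u else f {k - a} u)"

definition super_coord :: "nat \<Rightarrow> (nat \<Rightarrow> real) set \<Rightarrow> nat \<Rightarrow> superfun" where
  "super_coord a V k =
     (if k < a then superfun_monomial V {} (\<lambda>x. x k) else superfun_monomial V {k - a} (\<lambda>x. 1))"

lemma super_coord_carrier:
  assumes "openin (Euclidean_space a) V" "k < a + b"
  shows "super_coord a V k \<in> superfun_carrier a b V"
  unfolding super_coord_def using assms
  by (auto intro!: superfun_monomial_carrier smooth_fun_on_coordinate smooth_fun_on_const)

lemma super_coord_restrict:
  "W \<subseteq> V \<Longrightarrow> superfun_restrict W (super_coord a V k) = super_coord a W k"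
  by (auto simp: superfun_restrict_def super_coord_def superfun_monomial_def fun_eq_iff)

context
  fixes a b :: nat and V :: "(nat \<Rightarrow> real) set" and u :: "nat \<Rightarrow> real"
  assumes V: "openin (Euclidean_space a) V" and u: "u \<in> V"
begin

lemma super_partial_add:
  assumes "f \<in> superfun_carrier a b V" "g \<in> superfun_carrier a b V"
  shows "super_partial a k (\<lambda>I x. f I x + g I x) u = super_partial a k f u + super_partial a k g u"
  using assms by (auto simp: super_partial_def intro!: partial_deriv_add[OF V] superfun_carrier_smooth u)

lemma super_partial_mult:
  assumes "f \<in> superfun_carrier a b V" "g \<in> superfun_carrier a b V"
  shows "super_partial a k (superfun_mult f g) u =
    super_partial a k f u * g {} u + f {} u * super_partial a k g u"
proof (cases "k < a")
  case True
  have "superfun_mult f g {} = (\<lambda>x. f {} x * g {} x)" by (auto simp: superfun_mult_body)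
  then show ?thesis
    using True partial_deriv_mult[OF V superfun_carrier_smooth[OF assms(1)] superfun_carrier_smooth[OF assms(2)] True u]
    by (simp add: super_partial_def)
qed (simp add: super_partial_def superfun_mult_singleton)

lemma super_partial_smult:
  assumes "f \<in> superfun_carrier a b V"
  shows "super_partial a k (\<lambda>I x. c * f I x) u = c * super_partial a k f u"
  using partial_deriv_mult[OF V smooth_fun_on_const[OF V] superfun_carrier_smooth[OF assms] _ u]
  by (simp add: super_partial_def)

text \<open>Used with arbitrarily small neighbourhoods \<open>V\<close>, this makes
  \<open>super_partial\<close> depend on the germ at \<open>u\<close> alone.\<close>

lemma super_partial_cong:
  assumes "\<And>I x. x \<in> V \<Longrightarrow> f I x = g I x"
  shows "super_partial a k f u = super_partial a k g u"
  using assms partial_deriv_cong[OF V, of "f {}" "g {}" u k] u by (simp add: super_partial_def)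

lemma super_partial_coord:
  "super_partial a k (super_coord a V l) u = (if k = l then 1 else 0)"
proof -
  have "super_partial a k (super_coord a V l) u = super_partial a k (\<lambda>I x.
      if l < a then if I = {} then x l else 0 else if I = {l - a} then 1 else 0) u"
    by (rule super_partial_cong) (auto simp: super_coord_def superfun_monomial_def)
  then show ?thesis by (auto simp: super_partial_def partial_deriv_coordinate)
qed

end

lemma sum_lessThan_add:
  fixes f :: "nat \<Rightarrow> 'a::comm_monoid_add"
  shows "(\<Sum>k<a + b. f k) = (\<Sum>k<a. f k) + (\<Sum>j<b. f (a + j))"
  by (induction b) (simp_all add: add.assoc)

text \<open>The Leibniz rule at \<open>u\<close> annihilates constants and all products of two
  factors that vanish at \<open>u\<close>. Hadamard's lemma for the body and the factorization of
  theta-monomials leave only the values of \<open>E\<close> on coordinates, weighted by first-order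
  coefficients of \<open>f\<close>.\<close>

lemma superfun_derivation_formula:
  fixes E :: "superfun \<Rightarrow> real"
  assumes u: "u \<in> topspace (Euclidean_space a)" and d: "d > 0" and V_def: "V = cube a u d"
    and add: "\<And>f g. f \<in> superfun_carrier a b V \<Longrightarrow> g \<in> superfun_carrier a b V \<Longrightarrow>
      E (\<lambda>I x. f I x + g I x) = E f + E g"
    and smult: "\<And>c f. f \<in> superfun_carrier a b V \<Longrightarrow> E (\<lambda>I x. c * f I x) = c * E f"
    and mult: "\<And>f g. f \<in> superfun_carrier a b V \<Longrightarrow> g \<in> superfun_carrier a b V \<Longrightarrow>
      E (superfun_mult f g) = E f * g {} u + f {} u * E g"
    and f: "f \<in> superfun_carrier a b V"
  shows "E f = (\<Sum>k<a + b. E (super_coord a V k) * super_partial a k f u)"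
proof -
  have V: "openin (Euclidean_space a) V" and uV: "u \<in> V"
    using openin_cube center_in_cube[OF u d] by (simp_all add: V_def)
  note mono = superfun_monomial_carrier[OF V, of _ _ b]
  have zero: "E (\<lambda>I x. 0) = 0"
    using smult[OF superfun_carrier_zero[OF V], of 0] by simp
  have sum: "E (\<lambda>I x. \<Sum>J\<in>S. F J I x) = (\<Sum>J\<in>S. E (F J))"
    if "\<And>J. J \<in> S \<Longrightarrow> F J \<in> superfun_carrier a b V" for F and S :: "'s set"
    using that
    by (induction S rule: infinite_finite_induct)
      (simp_all add: zero add superfun_carrier_sum[OF V])
  \<comment> \<open>From 1 * 1 = 1 the Leibniz rule gives E(1) = 2 E(1).\<close>
  have one: "E (superfun_monomial V {} (\<lambda>x. 1)) = 0"
    using mult[OF mono mono, of "\<lambda>x. 1" "{}" "\<lambda>x. 1" "{}"] uV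
    by (simp add: superfun_mult_monomials smooth_fun_on_const[OF V]) (simp add: superfun_monomial_def)
  have const: "E (superfun_monomial V {} (\<lambda>x. c)) = 0" for c
  proof -
    have "superfun_monomial V {} (\<lambda>x. c) = (\<lambda>I x. c * superfun_monomial V {} (\<lambda>x. 1) I x)"
      by (auto simp: superfun_monomial_def fun_eq_iff)
    then show ?thesis
      using smult[OF mono, of "\<lambda>x. 1" "{}" c] one smooth_fun_on_const[OF V] by simp
  qed
  have higher: "E (superfun_monomial V I h) =
      (if is_singleton I then E (superfun_monomial V I (\<lambda>x. 1)) * h u else 0)"
    if I: "I \<subseteq> {..<b}" "I \<noteq> {}" and h: "smooth_fun_on a V h" for I h
  proof -
    \<comment> \<open>Splitting off the smallest index produces the sign +1. The split factor has
      value 0 at \<open>u\<close>, and the other factor can have a nonzero value only if no index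
      remains in it.\<close>
    let ?i = "Min I"
    have fin: "finite I" using I(1) finite_subset by blast
    then have i: "?i \<in> I" "\<And>j. j \<in> I \<Longrightarrow> ?i \<le> j" using I(2) by auto
    have "{(k, j). k \<in> {?i} \<and> j \<in> I - {?i} \<and> j < k} = {}" using i(2) by fastforce
    then have sign: "theta_sign {?i} (I - {?i}) = 1" unfolding theta_sign_def by (metis card.empty power_0)
    have "superfun_monomial V I h =
        superfun_mult (superfun_monomial V {?i} (\<lambda>x. 1)) (superfun_monomial V (I - {?i}) h)"
      using fin i(1) sign by (subst superfun_mult_monomials) (auto simp: insert_absorb)
    moreover have "superfun_monomial V {?i} (\<lambda>x. 1) \<in> superfun_carrier a b V"
        "superfun_monomial V (I - {?i}) h \<in> superfun_carrier a b V"
      using I i(1) h smooth_fun_on_const[OF V] by (auto intro!: mono)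
    ultimately have "E (superfun_monomial V I h) =
        E (superfun_monomial V {?i} (\<lambda>x. 1)) * superfun_monomial V (I - {?i}) h {} u"
      using mult by (simp add: superfun_monomial_def)
    moreover have "is_singleton I \<longleftrightarrow> I = {?i}" using i(1) by (metis Min_singleton is_singleton_def)
    moreover have "I - {?i} = {} \<longleftrightarrow> I = {?i}" using i(1) by auto
    ultimately show ?thesis using uV by (auto simp: superfun_monomial_def)
  qed
  note smooth = superfun_carrier_smooth[OF f]
  obtain g where g: "\<And>i. i < a \<Longrightarrow> smooth_fun_on a V (g i)"
      "\<And>x. x \<in> V \<Longrightarrow> f {} x = f {} u + (\<Sum>i<a. (x i - u i) * g i x)"
    using Hadamard[OF smooth[of "{}", unfolded V_def] u d] unfolding V_def by metis
  \<comment> \<open>Written as a sum so that the rules for sums of smooth functions apply; further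
    down \<open>add_uminus_conv_diff\<close> is switched off to preserve this form.\<close>
  let ?c = "\<lambda>i x. x i + - u i"
  have c: "smooth_fun_on a V (?c i)" for i
    by (intro smooth_fun_on_add[OF V] smooth_fun_on_coordinate[OF V] smooth_fun_on_const[OF V])
  have Ec: "E (superfun_monomial V {} (?c i)) = E (superfun_monomial V {} (\<lambda>x. x i))" for i
  proof -
    have "superfun_monomial V {} (?c i) = (\<lambda>I x. superfun_monomial V {} (\<lambda>x. x i) I x +
        superfun_monomial V {} (\<lambda>x. - u i) I x)"
      by (auto simp: superfun_monomial_def fun_eq_iff)
    then show ?thesis
      using add[OF mono mono, of "\<lambda>x. x i" "{}" "\<lambda>x. - u i" "{}"] const
        smooth_fun_on_coordinate[OF V] smooth_fun_on_const[OF V] by simp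
  qed
  have body: "E (superfun_monomial V {} (f {})) =
      (\<Sum>i<a. E (superfun_monomial V {} (\<lambda>x. x i)) * g i u)"
  proof -
    let ?F = "\<lambda>i. superfun_mult (superfun_monomial V {} (?c i)) (superfun_monomial V {} (g i))"
    have F: "?F i \<in> superfun_carrier a b V" if "i < a" for i
      using that g(1) c by (intro superfun_carrier_mult[OF V] mono) auto
    have F_eq: "?F i = superfun_monomial V {} (\<lambda>x. ?c i x * g i x)" for i
      by (simp add: superfun_mult_monomials)
    have "superfun_monomial V {} (f {}) = (\<lambda>I x. superfun_monomial V {} (\<lambda>x. f {} u) I x +
        (\<Sum>i\<in>{..<a}. ?F i I x))"
    proof (intro ext)
      fix I x
      show "superfun_monomial V {} (f {}) I x = superfun_monomial V {} (\<lambda>x. f {} u) I x +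
          (\<Sum>i\<in>{..<a}. ?F i I x)"
      proof (cases "I = {} \<and> x \<in> V")
        case False
        then show ?thesis unfolding F_eq unfolding superfun_monomial_def if_not_P[OF False] by simp
      next
        case True
        then show ?thesis unfolding F_eq using g(2)[of x] by (simp add: superfun_monomial_def)
      qed
    qed
    moreover have "E (\<lambda>I x. superfun_monomial V {} (\<lambda>x. f {} u) I x + (\<Sum>i\<in>{..<a}. ?F i I x)) =
        0 + (\<Sum>i<a. E (?F i))"
    proof -
      have "E (\<lambda>I x. \<Sum>i\<in>{..<a}. ?F i I x) = (\<Sum>i<a. E (?F i))"
        by (rule sum) (use F in auto)
      moreover have "(\<lambda>I x. \<Sum>i\<in>{..<a}. ?F i I x) \<in> superfun_carrier a b V"
        by (rule superfun_carrier_sum[OF V]) (use F in auto)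
      ultimately show ?thesis
        using add[OF mono, of "\<lambda>x. f {} u" "{}"] const smooth_fun_on_const[OF V] by simp
    qed
    moreover have "E (?F i) = E (superfun_monomial V {} (\<lambda>x. x i)) * g i u" if "i < a" for i
      using mult[OF mono mono, of "?c i" "{}" "g i" "{}"] that g(1) c uV Ec
      by simp (simp add: superfun_monomial_def)
    ultimately show ?thesis by simp
  qed
  \<comment> \<open>The factor \<open>?c j\<close> vanishes at \<open>u\<close>, so in each product
    only the derivative of the coordinate itself survives.\<close>
  have partial: "partial_deriv i (f {}) u = g i u" if i: "i < a" for i
  proof -
    have "partial_deriv i (f {}) u = partial_deriv i (\<lambda>x. f {} u + (\<Sum>j<a. ?c j x * g j x)) u"
      by (rule partial_deriv_cong[OF V _ uV i]) (simp add: g(2))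
    also have "\<dots> = (\<Sum>j<a. partial_deriv i (\<lambda>x. ?c j x * g j x) u)"
    proof -
      have "partial_deriv i (\<lambda>x. \<Sum>j\<in>S. ?c j x * g j x) u =
          (\<Sum>j\<in>S. partial_deriv i (\<lambda>x. ?c j x * g j x) u)" if "S \<subseteq> {..<a}" for S
        using finite_subset[OF that finite_lessThan] that
      proof (induction S rule: finite_induct)
        case (insert j S)
        have "smooth_fun_on a V (\<lambda>x. \<Sum>j\<in>S. ?c j x * g j x)" "smooth_fun_on a V (\<lambda>x. ?c j x * g j x)"
          using insert.prems g(1) c
          by (auto intro!: smooth_fun_on_sum[OF V] smooth_fun_on_mult[OF V] simp del: add_uminus_conv_diff)
        with insert show ?case by (simp add: partial_deriv_add[OF V _ _ i uV] del: add_uminus_conv_diff)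
      qed simp
      moreover have "smooth_fun_on a V (\<lambda>x. \<Sum>j<a. ?c j x * g j x)"
        using g(1) c by (intro smooth_fun_on_sum[OF V] smooth_fun_on_mult[OF V]) auto
      ultimately show ?thesis
        by (simp add: partial_deriv_add[OF V smooth_fun_on_const[OF V] _ i uV] del: add_uminus_conv_diff)
    qed
    also have "\<dots> = (\<Sum>j<a. if i = j then g j u else 0)"
    proof (rule sum.cong)
      fix j assume "j \<in> {..<a}"
      moreover have "partial_deriv i (?c j) u = (if i = j then 1 else 0)"
        by (subst partial_deriv_add[OF V _ _ i uV])
          (simp_all add: smooth_fun_on_coordinate[OF V] smooth_fun_on_const[OF V] partial_deriv_coordinate)
      ultimately show "partial_deriv i (\<lambda>x. ?c j x * g j x) u = (if i = j then g j u else 0)"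
        using partial_deriv_mult[OF V c g(1) i uV, of j j] by simp
    qed simp
    also have "\<dots> = g i u" using i by (simp add: sum.delta')
    finally show ?thesis .
  qed
  have "E f = (\<Sum>J\<in>Pow {..<b}. E (superfun_monomial V J (f J)))"
    by (subst superfun_decompose[OF V f]) (intro sum mono smooth, auto)
  also have "\<dots> = E (superfun_monomial V {} (f {})) + (\<Sum>J\<in>Pow {..<b} - {{}}.
      E (superfun_monomial V J (f J)))"
    by (subst sum.remove[of _ "{}"]) auto
  also have "(\<Sum>J\<in>Pow {..<b} - {{}}. E (superfun_monomial V J (f J))) =
      (\<Sum>J\<in>(\<lambda>j. {j}) ` {..<b}. E (superfun_monomial V J (\<lambda>x. 1)) * f J u)"
  \<comment> \<open>By \<open>higher\<close>, index sets with two or more elements contribute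
    nothing.\<close>
  proof (rule sum.mono_neutral_cong_right)
    show "\<forall>J\<in>Pow {..<b} - {{}} - (\<lambda>j. {j}) ` {..<b}. E (superfun_monomial V J (f J)) = 0"
      using higher[OF _ _ smooth] by (auto simp: is_singleton_def)
    show "\<And>J. J \<in> (\<lambda>j. {j}) ` {..<b} \<Longrightarrow>
        E (superfun_monomial V J (f J)) = E (superfun_monomial V J (\<lambda>x. 1)) * f J u"
      using higher[OF _ _ smooth] by auto
  qed auto
  also have "\<dots> = (\<Sum>j<b. E (superfun_monomial V {j} (\<lambda>x. 1)) * f {j} u)"
    by (subst sum.reindex) (auto simp: inj_on_def)
  finally have "E f = (\<Sum>i<a. E (superfun_monomial V {} (\<lambda>x. x i)) * partial_deriv i (f {}) u) +
      (\<Sum>j<b. E (superfun_monomial V {j} (\<lambda>x. 1)) * f {j} u)"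
    using body partial by simp
  also have "\<dots> = (\<Sum>k<a + b. E (super_coord a V k) * super_partial a k f u)"
    by (simp add: sum_lessThan_add super_coord_def super_partial_def)
  finally show ?thesis .
qed

section \<open>Stalks\<close>

lemma real_ring_simps [simp]:
  "carrier real_ring = UNIV" "x \<otimes>\<^bsub>real_ring\<^esub> y = x * y" "x \<oplus>\<^bsub>real_ring\<^esub> y = x + y"
  "\<one>\<^bsub>real_ring\<^esub> = 1" "\<zero>\<^bsub>real_ring\<^esub> = 0"
  by (simp_all add: real_ring_def)

lemma superring_homD:
  assumes "h \<in> superring_hom A B"
  shows "f \<in> carrier A \<Longrightarrow> h f \<in> carrier B"
    and "f \<in> carrier A \<Longrightarrow> g \<in> carrier A \<Longrightarrow> h (f \<otimes>\<^bsub>A\<^esub> g) = h f \<otimes>\<^bsub>B\<^esub> h g"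
    and "f \<in> carrier A \<Longrightarrow> g \<in> carrier A \<Longrightarrow> h (f \<oplus>\<^bsub>A\<^esub> g) = h f \<oplus>\<^bsub>B\<^esub> h g"
    and "h \<one>\<^bsub>A\<^esub> = \<one>\<^bsub>B\<^esub>"
    and "f \<in> homog A j \<Longrightarrow> h f \<in> homog B j"
  using assms by (auto simp: superring_hom_def ring_hom_def image_subset_iff)

lemma superring_hom_comp:
  "h \<in> superring_hom A B \<Longrightarrow> k \<in> superring_hom B C \<Longrightarrow> (\<lambda>f. k (h f)) \<in> superring_hom A C"
  unfolding superring_hom_def ring_hom_def by (simp add: Pi_iff image_subset_iff)

lemma superring_hom_zero:
  assumes "h \<in> superring_hom A B" "ring A" "ring B"
  shows "h \<zero>\<^bsub>A\<^esub> = \<zero>\<^bsub>B\<^esub>"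
  using assms ring_hom_zero[of h A B] by (simp add: superring_hom_def)

lemma supercommutative_algebraD:
  assumes "supercommutative_algebra A"
  shows "ring A" "module real_ring A"
    and "homog A j \<subseteq> carrier A" "\<zero>\<^bsub>A\<^esub> \<in> homog A j" "\<one>\<^bsub>A\<^esub> \<in> homog A 0"
    and "f \<in> homog A j \<Longrightarrow> c \<odot>\<^bsub>A\<^esub> f \<in> homog A j"
    and "f \<in> carrier A \<Longrightarrow> g \<in> carrier A \<Longrightarrow> (c \<odot>\<^bsub>A\<^esub> f) \<otimes>\<^bsub>A\<^esub> g = c \<odot>\<^bsub>A\<^esub> (f \<otimes>\<^bsub>A\<^esub> g)"
    and "f \<in> carrier A \<Longrightarrow> \<exists>!(g, h). g \<in> homog A 0 \<and> h \<in> homog A 1 \<and> f = g \<oplus>\<^bsub>A\<^esub> h"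
proof -
  note D = assms[unfolded supercommutative_algebra_def]
  note D2 = D[THEN conjunct2] note D3 = D2[THEN conjunct2] note D4 = D3[THEN conjunct2]
  note D5 = D4[THEN conjunct2] note D6 = D5[THEN conjunct2]
  show "ring A" by (rule D[THEN conjunct1])
  show "module real_ring A" by (rule D2[THEN conjunct1])
  show "homog A j \<subseteq> carrier A" "\<zero>\<^bsub>A\<^esub> \<in> homog A j"
    using D4[THEN conjunct1, rule_format, of j] by simp_all
  show "f \<in> homog A j \<Longrightarrow> c \<odot>\<^bsub>A\<^esub> f \<in> homog A j"
    using D4[THEN conjunct1, rule_format, of j] by simp
  show "\<one>\<^bsub>A\<^esub> \<in> homog A 0" by (rule D6[THEN conjunct1])
  show "f \<in> carrier A \<Longrightarrow> g \<in> carrier A \<Longrightarrow> (c \<odot>\<^bsub>A\<^esub> f) \<otimes>\<^bsub>A\<^esub> g = c \<odot>\<^bsub>A\<^esub> (f \<otimes>\<^bsub>A\<^esub> g)"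
    using D3[THEN conjunct1] by simp
  show "f \<in> carrier A \<Longrightarrow> \<exists>!(g, h). g \<in> homog A 0 \<and> h \<in> homog A 1 \<and> f = g \<oplus>\<^bsub>A\<^esub> h"
    by (rule D5[THEN conjunct1, rule_format])
qed

section \<open>Sheaf axioms in usable form, equality of germs, and the ring of germs\<close>

context
  fixes X :: "('x, 's) superspace"
  assumes X: "super_ringed_space X"
begin

lemma sec_algebra: "openin (body X) U \<Longrightarrow> supercommutative_algebra (sec X U)"
  by (rule X[unfolded super_ringed_space_def, THEN conjunct1, rule_format])

lemmas sec_ring = supercommutative_algebraD(1)[OF sec_algebra]
lemmas sec_module = supercommutative_algebraD(2)[OF sec_algebra]
lemmas sec_homog_subset = supercommutative_algebraD(3)[OF sec_algebra]
lemmas sec_zero_homog = supercommutative_algebraD(4)[OF sec_algebra]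
lemmas sec_one_homog = supercommutative_algebraD(5)[OF sec_algebra]
lemmas sec_smult_homog = supercommutative_algebraD(6)[OF sec_algebra]
lemmas sec_smult_mult = supercommutative_algebraD(7)[OF sec_algebra]
lemmas sec_parity_decomposition = supercommutative_algebraD(8)[OF sec_algebra]

lemma sec_smult_closed:
  "openin (body X) U \<Longrightarrow> f \<in> carrier (sec X U) \<Longrightarrow> c \<odot>\<^bsub>sec X U\<^esub> f \<in> carrier (sec X U)"
  using module.smult_closed[OF sec_module] by simp

lemma res_superring_hom:
  "openin (body X) U \<Longrightarrow> openin (body X) V \<Longrightarrow> V \<subseteq> U \<Longrightarrow>
    res X U V \<in> superring_hom (sec X U) (sec X V)"
  by (rule X[unfolded super_ringed_space_def, THEN conjunct2, THEN conjunct1, rule_format, THEN conjunct1]) auto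

lemmas res_hom = superring_homD[OF res_superring_hom]

lemma res_smult:
  "openin (body X) U \<Longrightarrow> openin (body X) V \<Longrightarrow> V \<subseteq> U \<Longrightarrow> f \<in> carrier (sec X U) \<Longrightarrow>
    res X U V (c \<odot>\<^bsub>sec X U\<^esub> f) = c \<odot>\<^bsub>sec X V\<^esub> res X U V f"
  using X[unfolded super_ringed_space_def, THEN conjunct2, THEN conjunct1, rule_format, THEN conjunct2]
  by (simp add: real_linear_on_def)

lemma res_self: "openin (body X) U \<Longrightarrow> f \<in> carrier (sec X U) \<Longrightarrow> res X U U f = f"
  by (rule X[unfolded super_ringed_space_def, THEN conjunct2, THEN conjunct2, THEN conjunct1, rule_format])

lemma res_res:
  "openin (body X) U \<Longrightarrow> openin (body X) V \<Longrightarrow> openin (body X) W \<Longrightarrow> W \<subseteq> V \<Longrightarrow> V \<subseteq> U \<Longrightarrow>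
    f \<in> carrier (sec X U) \<Longrightarrow> res X V W (res X U V f) = res X U W f"
  by (rule X[unfolded super_ringed_space_def, THEN conjunct2, THEN conjunct2, THEN conjunct2,
        THEN conjunct1, rule_format]) auto

text \<open>A germ is the set of all its representatives. A further representative \<open>h\<close>
  agrees with \<open>f\<close> on one neighbourhood and \<open>f\<close> agrees with
  \<open>g\<close> on another, so \<open>h\<close> and \<open>g\<close> are compared on the
  intersection.\<close>

lemma germ_eqI:
  assumes "openin (body X) U" "openin (body X) V" "openin (body X) W" "x \<in> W" "W \<subseteq> U \<inter> V"
    and "f \<in> carrier (sec X U)" "g \<in> carrier (sec X V)" "res X U W f = res X V W g"
  shows "germ X x U f = germ X x V g"
proof -
  have *: "germ X x U f \<subseteq> germ X x V g"
    if "openin (body X) U" "openin (body X) V" "W \<subseteq> U \<inter> V" "f \<in> carrier (sec X U)"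
      "g \<in> carrier (sec X V)" "res X U W f = res X V W g" for U V f g
  proof (clarsimp simp: germ_def)
    fix V' h W'
    assume h: "openin (body X) V'" "x \<in> V'" "h \<in> carrier (sec X V')" "openin (body X) W'" "x \<in> W'"
      "W' \<subseteq> U" "W' \<subseteq> V'" "res X U W' f = res X V' W' h"
    have o: "openin (body X) (W \<inter> W')" using assms(3) h(4) by blast
    have "res X V (W \<inter> W') g = res X V' (W \<inter> W') h"
    proof -
      have "res X V (W \<inter> W') g = res X W (W \<inter> W') (res X V W g)"
        using that assms(3) o by (subst res_res) auto
      also have "\<dots> = res X U (W \<inter> W') f"
        using that assms(3) o by (subst that(6)[symmetric], subst res_res) auto
      also have "\<dots> = res X W' (W \<inter> W') (res X U W' f)"
        using that h o by (subst res_res) auto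
      also have "\<dots> = res X V' (W \<inter> W') h"
        using that h o by (simp only: h(8), subst res_res) auto
      finally show ?thesis .
    qed
    with o show "\<exists>W. openin (body X) W \<and> x \<in> W \<and> W \<subseteq> V \<and> W \<subseteq> V' \<and> res X V W g = res X V' W h"
      using assms(4) h that by (intro exI[of _ "W \<inter> W'"]) auto
  qed
  show ?thesis using *[of U V f g] *[of V U g f] assms by auto
qed

lemma mem_germ_self:
  "openin (body X) U \<Longrightarrow> x \<in> U \<Longrightarrow> f \<in> carrier (sec X U) \<Longrightarrow> (U, f) \<in> germ X x U f"
  unfolding germ_def by auto

lemma mem_germE:
  assumes "(V, g) \<in> germ X x U f"
  obtains W where "openin (body X) W" "x \<in> W" "W \<subseteq> U \<inter> V" "res X U W f = res X V W g"
  using assms unfolding germ_def mem_Collect_eq prod.case by meson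

lemma mem_germD:
  assumes "(V, g) \<in> germ X x U f" "openin (body X) U" "f \<in> carrier (sec X U)"
  shows "openin (body X) V" "x \<in> V" "g \<in> carrier (sec X V)" "germ X x V g = germ X x U f"
proof -
  obtain W where *: "openin (body X) V" "x \<in> V" "g \<in> carrier (sec X V)"
      "openin (body X) W" "x \<in> W" "W \<subseteq> U \<inter> V" "res X U W f = res X V W g"
    using assms(1) unfolding germ_def by blast
  then show "openin (body X) V" "x \<in> V" "g \<in> carrier (sec X V)" by auto
  show "germ X x V g = germ X x U f"
    by (rule germ_eqI[symmetric, of U V W]) (use * assms in auto)
qed

lemma germ_eqD:
  assumes "germ X x U f = germ X x V g" "openin (body X) U" "openin (body X) V" "x \<in> V"
    "f \<in> carrier (sec X U)" "g \<in> carrier (sec X V)"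
  obtains W where "openin (body X) W" "x \<in> W" "W \<subseteq> U \<inter> V" "res X U W f = res X V W g"
proof -
  have "(V, g) \<in> germ X x U f" using mem_germ_self assms by simp
  then show ?thesis by (rule mem_germE) (rule that)
qed

lemma germ_res:
  assumes "openin (body X) U" "openin (body X) W" "x \<in> W" "W \<subseteq> U" "f \<in> carrier (sec X U)"
  shows "germ X x W (res X U W f) = germ X x U f"
  by (rule germ_eqI[of W U W]) (use assms res_hom(1) res_self in auto)

text \<open>Serves sum and product alike: \<open>stalk\<close> defines both as a union over all
  pairs of representatives. Since \<open>op\<close> commutes with restriction, every member of that
  union is the germ of \<open>op U f g\<close>.\<close>

lemma germ_binary_op:
  assumes closed: "\<And>W f g. openin (body X) W \<Longrightarrow> f \<in> carrier (sec X W) \<Longrightarrow> g \<in> carrier (sec X W) \<Longrightarrow>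
      op W f g \<in> carrier (sec X W)"
    and res: "\<And>W V f g. openin (body X) W \<Longrightarrow> openin (body X) V \<Longrightarrow> V \<subseteq> W \<Longrightarrow>
      f \<in> carrier (sec X W) \<Longrightarrow> g \<in> carrier (sec X W) \<Longrightarrow>
      res X W V (op W f g) = op V (res X W V f) (res X W V g)"
    and U: "openin (body X) U" "x \<in> U" "f \<in> carrier (sec X U)" "g \<in> carrier (sec X U)"
  shows "(\<Union>(V1, f1)\<in>germ X x U f. \<Union>(V2, g1)\<in>germ X x U g.
      germ X x (V1 \<inter> V2) (op (V1 \<inter> V2) (res X V1 (V1 \<inter> V2) f1) (res X V2 (V1 \<inter> V2) g1))) =
    germ X x U (op U f g)"
proof -
  have *: "germ X x (V1 \<inter> V2) (op (V1 \<inter> V2) (res X V1 (V1 \<inter> V2) f1) (res X V2 (V1 \<inter> V2) g1)) =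
      germ X x U (op U f g)"
    if 1: "(V1, f1) \<in> germ X x U f" and 2: "(V2, g1) \<in> germ X x U g" for V1 f1 V2 g1
  proof -
    obtain W1 where W1: "openin (body X) W1" "x \<in> W1" "W1 \<subseteq> U \<inter> V1" "res X U W1 f = res X V1 W1 f1"
      using 1 by (rule mem_germE)
    obtain W2 where W2: "openin (body X) W2" "x \<in> W2" "W2 \<subseteq> U \<inter> V2" "res X U W2 g = res X V2 W2 g1"
      using 2 by (rule mem_germE)
    note V1 = mem_germD[OF 1 U(1,3)] and V2 = mem_germD[OF 2 U(1,4)]
    let ?W = "W1 \<inter> W2" and ?V = "V1 \<inter> V2"
    have o: "openin (body X) ?W" "openin (body X) ?V" using W1 W2 V1 V2 by blast+
    have f: "res X ?V ?W (res X V1 ?V f1) = res X U ?W f"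
    proof -
      have "res X ?V ?W (res X V1 ?V f1) = res X W1 ?W (res X V1 W1 f1)"
        using W1 W2 V1 V2 o by (subst (1 2) res_res) auto
      also have "\<dots> = res X U ?W f"
        using W1 W2 U o by (subst W1(4)[symmetric], subst res_res) auto
      finally show ?thesis .
    qed
    have g: "res X ?V ?W (res X V2 ?V g1) = res X U ?W g"
    proof -
      have "res X ?V ?W (res X V2 ?V g1) = res X W2 ?W (res X V2 W2 g1)"
        using W1 W2 V1 V2 o by (subst (1 2) res_res) auto
      also have "\<dots> = res X U ?W g"
        using W1 W2 U o by (subst W2(4)[symmetric], subst res_res) auto
      finally show ?thesis .
    qed
    have c: "res X V1 ?V f1 \<in> carrier (sec X ?V)" "res X V2 ?V g1 \<in> carrier (sec X ?V)"
      using V1 V2 o by (auto intro!: res_hom(1))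
    show ?thesis
    proof (rule germ_eqI[OF o(2) U(1) o(1)])
      show "res X ?V ?W (op ?V (res X V1 ?V f1) (res X V2 ?V g1)) = res X U ?W (op U f g)"
        using W1 W2 U o c f g by (subst (1 2) res) auto
    qed (use W1 W2 U o c closed in auto)
  qed
  \<comment> \<open>The union is over a nonempty family, so it equals the common value of its
    members.\<close>
  have ex: "(U, f) \<in> germ X x U f" "(U, g) \<in> germ X x U g" using mem_germ_self U by auto
  show ?thesis
  proof (intro subset_antisym subsetI)
    fix z assume "z \<in> germ X x U (op U f g)"
    then show "z \<in> (\<Union>(V1, f1)\<in>germ X x U f. \<Union>(V2, g1)\<in>germ X x U g.
        germ X x (V1 \<inter> V2) (op (V1 \<inter> V2) (res X V1 (V1 \<inter> V2) f1) (res X V2 (V1 \<inter> V2) g1)))"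
      unfolding UN_iff by (intro bexI[OF _ ex(1)], unfold prod.case UN_iff, intro bexI[OF _ ex(2)])
        (simp only: prod.case *[OF ex])
  qed (use * in blast)
qed

lemma germ_mult:
  assumes "openin (body X) U" "x \<in> U" "f \<in> carrier (sec X U)" "g \<in> carrier (sec X U)"
  shows "germ X x U f \<otimes>\<^bsub>stalk X x\<^esub> germ X x U g = germ X x U (f \<otimes>\<^bsub>sec X U\<^esub> g)"
  using germ_binary_op[of "\<lambda>W. mult (sec X W)", OF _ _ assms] res_hom(2)
    monoid.m_closed[OF ring.is_monoid[OF sec_ring]]
  by (simp add: stalk_def)

lemma germ_add:
  assumes "openin (body X) U" "x \<in> U" "f \<in> carrier (sec X U)" "g \<in> carrier (sec X U)"
  shows "germ X x U f \<oplus>\<^bsub>stalk X x\<^esub> germ X x U g = germ X x U (f \<oplus>\<^bsub>sec X U\<^esub> g)"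
  using germ_binary_op[of "\<lambda>W. add (sec X W)", OF _ _ assms] res_hom(3)
    ring.ring_simprules(1)[OF sec_ring]
  by (simp add: stalk_def)

lemma germ_smult:
  assumes "openin (body X) U" "x \<in> U" "f \<in> carrier (sec X U)"
  shows "c \<odot>\<^bsub>stalk X x\<^esub> germ X x U f = germ X x U (c \<odot>\<^bsub>sec X U\<^esub> f)"
proof -
  have *: "germ X x V (c \<odot>\<^bsub>sec X V\<^esub> g) = germ X x U (c \<odot>\<^bsub>sec X U\<^esub> f)"
    if m: "(V, g) \<in> germ X x U f" for V g
  proof -
    obtain W where W: "openin (body X) W" "x \<in> W" "W \<subseteq> U \<inter> V" "res X U W f = res X V W g"
      using m by (rule mem_germE)
    note V = mem_germD[OF m assms(1,3)]
    show ?thesis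
    proof (rule germ_eqI[OF V(1) assms(1) W(1,2)])
      show "W \<subseteq> V \<inter> U" using W(3) by blast
      have "res X V W (c \<odot>\<^bsub>sec X V\<^esub> g) = c \<odot>\<^bsub>sec X W\<^esub> res X V W g"
        using V W by (intro res_smult) auto
      also have "\<dots> = res X U W (c \<odot>\<^bsub>sec X U\<^esub> f)"
        unfolding W(4)[symmetric] using assms W by (intro res_smult[symmetric]) auto
      finally show "res X V W (c \<odot>\<^bsub>sec X V\<^esub> g) = res X U W (c \<odot>\<^bsub>sec X U\<^esub> f)" .
    qed (use V assms sec_smult_closed in blast)+
  qed
  have ex: "(U, f) \<in> germ X x U f" using mem_germ_self assms by auto
  have "c \<odot>\<^bsub>stalk X x\<^esub> germ X x U f = (\<Union>(V, g)\<in>germ X x U f. germ X x V (c \<odot>\<^bsub>sec X V\<^esub> g))"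
    by (simp add: stalk_def)
  also have "\<dots> = germ X x U (c \<odot>\<^bsub>sec X U\<^esub> f)"
  proof (intro subset_antisym subsetI)
    fix z assume "z \<in> germ X x U (c \<odot>\<^bsub>sec X U\<^esub> f)"
    then show "z \<in> (\<Union>(V, g)\<in>germ X x U f. germ X x V (c \<odot>\<^bsub>sec X V\<^esub> g))"
      by (intro UN_I[OF ex]) simp
  qed (use * in blast)
  finally show ?thesis .
qed

lemma germ_one:
  assumes "openin (body X) U" "x \<in> U"
  shows "\<one>\<^bsub>stalk X x\<^esub> = germ X x U \<one>\<^bsub>sec X U\<^esub>"
proof -
  have "U \<subseteq> topspace (body X)" using assms openin_subset by blast
  then show ?thesis
    using germ_res[of "topspace (body X)" U x "\<one>\<^bsub>sec X (topspace (body X))\<^esub>"] assms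
      res_hom(4)[of "topspace (body X)" U] monoid.one_closed[OF ring.is_monoid[OF sec_ring]]
    by (simp add: stalk_def)
qed

lemma germ_zero:
  assumes "openin (body X) U" "x \<in> U"
  shows "\<zero>\<^bsub>stalk X x\<^esub> = germ X x U \<zero>\<^bsub>sec X U\<^esub>"
proof -
  have "U \<subseteq> topspace (body X)" using assms openin_subset by blast
  then show ?thesis
    using germ_res[of "topspace (body X)" U x "\<zero>\<^bsub>sec X (topspace (body X))\<^esub>"] assms
      superring_hom_zero[OF res_superring_hom sec_ring sec_ring, of "topspace (body X)" U]
      ring.ring_simprules(2)[OF sec_ring]
    by (simp add: stalk_def)
qed

lemma germ_in_stalk:
  "openin (body X) U \<Longrightarrow> x \<in> U \<Longrightarrow> f \<in> carrier (sec X U) \<Longrightarrow> germ X x U f \<in> carrier (stalk X x)"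
  by (auto simp: stalk_def)

lemma stalk_cases:
  assumes "\<alpha> \<in> carrier (stalk X x)"
  obtains U f where "openin (body X) U" "x \<in> U" "f \<in> carrier (sec X U)" "\<alpha> = germ X x U f"
  using assms by (auto simp: stalk_def)

lemma stalk_cases2:
  assumes "\<alpha> \<in> carrier (stalk X x)" "\<beta> \<in> carrier (stalk X x)"
  obtains U f g where "openin (body X) U" "x \<in> U" "f \<in> carrier (sec X U)" "g \<in> carrier (sec X U)"
    "\<alpha> = germ X x U f" "\<beta> = germ X x U g"
proof -
  obtain U f where 1: "openin (body X) U" "x \<in> U" "f \<in> carrier (sec X U)" "\<alpha> = germ X x U f"
    using assms(1) by (rule stalk_cases)
  obtain V g where 2: "openin (body X) V" "x \<in> V" "g \<in> carrier (sec X V)" "\<beta> = germ X x V g"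
    using assms(2) by (rule stalk_cases)
  have o: "openin (body X) (U \<inter> V)" using 1 2 by blast
  show ?thesis
    by (rule that[OF o, of "res X U (U \<inter> V) f" "res X V (U \<inter> V) g"])
      (use 1 2 o germ_res[of U "U \<inter> V"] germ_res[of V "U \<inter> V"] res_hom(1) in auto)
qed

lemma stalk_cases3:
  assumes "\<alpha> \<in> carrier (stalk X x)" "\<beta> \<in> carrier (stalk X x)" "\<gamma> \<in> carrier (stalk X x)"
  obtains U f g h where "openin (body X) U" "x \<in> U" "f \<in> carrier (sec X U)" "g \<in> carrier (sec X U)"
    "h \<in> carrier (sec X U)" "\<alpha> = germ X x U f" "\<beta> = germ X x U g" "\<gamma> = germ X x U h"
proof -
  obtain U f g where 1: "openin (body X) U" "x \<in> U" "f \<in> carrier (sec X U)" "g \<in> carrier (sec X U)"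
      "\<alpha> = germ X x U f" "\<beta> = germ X x U g"
    using assms(1,2) by (rule stalk_cases2)
  obtain V h where 2: "openin (body X) V" "x \<in> V" "h \<in> carrier (sec X V)" "\<gamma> = germ X x V h"
    using assms(3) by (rule stalk_cases)
  have o: "openin (body X) (U \<inter> V)" using 1 2 by blast
  show ?thesis
    by (rule that[OF o, of "res X U (U \<inter> V) f" "res X U (U \<inter> V) g" "res X V (U \<inter> V) h"])
      (use 1 2 o germ_res[of U "U \<inter> V"] germ_res[of V "U \<inter> V"] res_hom(1) in auto)
qed

text \<open>Finitely many germs have representatives over one common open set, so each axiom is
  inherited from a ring of sections.\<close>

lemma ring_stalk:
  assumes x: "x \<in> topspace (body X)"
  shows "ring (stalk X x)"
proof (rule ringI)
  show "abelian_group (stalk X x)"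
  proof (rule abelian_groupI)
    fix \<alpha> \<beta> assume a: "\<alpha> \<in> carrier (stalk X x)" "\<beta> \<in> carrier (stalk X x)"
    then obtain U f g where U: "openin (body X) U" "x \<in> U" "f \<in> carrier (sec X U)"
        "g \<in> carrier (sec X U)" "\<alpha> = germ X x U f" "\<beta> = germ X x U g"
      by (rule stalk_cases2)
    note r = ring.ring_simprules[OF sec_ring[OF U(1)]]
    show "\<alpha> \<oplus>\<^bsub>stalk X x\<^esub> \<beta> \<in> carrier (stalk X x)"
      using U r by (simp add: germ_add germ_in_stalk)
    show "\<alpha> \<oplus>\<^bsub>stalk X x\<^esub> \<beta> = \<beta> \<oplus>\<^bsub>stalk X x\<^esub> \<alpha>"
      using U r(10) by (simp add: germ_add)
  next
    fix \<alpha> \<beta> \<gamma> assume "\<alpha> \<in> carrier (stalk X x)" "\<beta> \<in> carrier (stalk X x)" "\<gamma> \<in> carrier (stalk X x)"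
    then show "\<alpha> \<oplus>\<^bsub>stalk X x\<^esub> \<beta> \<oplus>\<^bsub>stalk X x\<^esub> \<gamma> = \<alpha> \<oplus>\<^bsub>stalk X x\<^esub> (\<beta> \<oplus>\<^bsub>stalk X x\<^esub> \<gamma>)"
      by (rule stalk_cases3) (simp add: germ_add ring.ring_simprules(1,7)[OF sec_ring])
  next
    show "\<zero>\<^bsub>stalk X x\<^esub> \<in> carrier (stalk X x)"
      using germ_zero[OF openin_topspace x] x
      by (auto intro!: germ_in_stalk ring.ring_simprules(2)[OF sec_ring])
  next
    fix \<alpha> assume "\<alpha> \<in> carrier (stalk X x)"
    then obtain U f where U: "openin (body X) U" "x \<in> U" "f \<in> carrier (sec X U)" "\<alpha> = germ X x U f"
      by (rule stalk_cases)
    note r = ring.ring_simprules[OF sec_ring[OF U(1)]]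
    show "\<zero>\<^bsub>stalk X x\<^esub> \<oplus>\<^bsub>stalk X x\<^esub> \<alpha> = \<alpha>"
      using U r by (simp add: germ_zero[OF U(1,2)] germ_add)
    show "\<exists>\<beta>\<in>carrier (stalk X x). \<beta> \<oplus>\<^bsub>stalk X x\<^esub> \<alpha> = \<zero>\<^bsub>stalk X x\<^esub>"
      using U r by (intro bexI[of _ "germ X x U (\<ominus>\<^bsub>sec X U\<^esub> f)"])
        (auto simp: germ_zero[OF U(1,2)] germ_add intro!: germ_in_stalk)
  qed
  show "monoid (stalk X x)"
  proof (rule monoidI)
    fix \<alpha> \<beta> assume "\<alpha> \<in> carrier (stalk X x)" "\<beta> \<in> carrier (stalk X x)"
    then show "\<alpha> \<otimes>\<^bsub>stalk X x\<^esub> \<beta> \<in> carrier (stalk X x)"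
      by (rule stalk_cases2) (auto simp: germ_mult intro!: germ_in_stalk ring.ring_simprules(5)[OF sec_ring])
  next
    fix \<alpha> \<beta> \<gamma> assume "\<alpha> \<in> carrier (stalk X x)" "\<beta> \<in> carrier (stalk X x)" "\<gamma> \<in> carrier (stalk X x)"
    then show "\<alpha> \<otimes>\<^bsub>stalk X x\<^esub> \<beta> \<otimes>\<^bsub>stalk X x\<^esub> \<gamma> = \<alpha> \<otimes>\<^bsub>stalk X x\<^esub> (\<beta> \<otimes>\<^bsub>stalk X x\<^esub> \<gamma>)"
      by (rule stalk_cases3) (simp add: germ_mult ring.ring_simprules(5,11)[OF sec_ring])
  next
    show "\<one>\<^bsub>stalk X x\<^esub> \<in> carrier (stalk X x)"
      using germ_one[OF openin_topspace x] x
      by (auto intro!: germ_in_stalk ring.ring_simprules(6)[OF sec_ring])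
  next
    fix \<alpha> assume "\<alpha> \<in> carrier (stalk X x)"
    then obtain U f where U: "openin (body X) U" "x \<in> U" "f \<in> carrier (sec X U)" "\<alpha> = germ X x U f"
      by (rule stalk_cases)
    note m = ring.is_monoid[OF sec_ring[OF U(1)]]
    show "\<one>\<^bsub>stalk X x\<^esub> \<otimes>\<^bsub>stalk X x\<^esub> \<alpha> = \<alpha>" "\<alpha> \<otimes>\<^bsub>stalk X x\<^esub> \<one>\<^bsub>stalk X x\<^esub> = \<alpha>"
      using U monoid.l_one[OF m] monoid.r_one[OF m] monoid.one_closed[OF m]
      by (simp_all add: germ_one[OF U(1,2)] germ_mult)
  qed
  fix \<alpha> \<beta> \<gamma> assume "\<alpha> \<in> carrier (stalk X x)" "\<beta> \<in> carrier (stalk X x)" "\<gamma> \<in> carrier (stalk X x)"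
  then obtain U f g h where U: "openin (body X) U" "x \<in> U" "f \<in> carrier (sec X U)" "g \<in> carrier (sec X U)"
    "h \<in> carrier (sec X U)" "\<alpha> = germ X x U f" "\<beta> = germ X x U g" "\<gamma> = germ X x U h"
    by (rule stalk_cases3)
  note r = ring.ring_simprules[OF sec_ring[OF U(1)]]
  show "(\<alpha> \<oplus>\<^bsub>stalk X x\<^esub> \<beta>) \<otimes>\<^bsub>stalk X x\<^esub> \<gamma> = \<alpha> \<otimes>\<^bsub>stalk X x\<^esub> \<gamma> \<oplus>\<^bsub>stalk X x\<^esub> \<beta> \<otimes>\<^bsub>stalk X x\<^esub> \<gamma>"
    using U r by (simp add: germ_mult germ_add)
  show "\<gamma> \<otimes>\<^bsub>stalk X x\<^esub> (\<alpha> \<oplus>\<^bsub>stalk X x\<^esub> \<beta>) = \<gamma> \<otimes>\<^bsub>stalk X x\<^esub> \<alpha> \<oplus>\<^bsub>stalk X x\<^esub> \<gamma> \<otimes>\<^bsub>stalk X x\<^esub> \<beta>"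
    using U r by (simp add: germ_mult germ_add)
qed

text \<open>\<open>germ_value\<close> subtracts with the negation that the addition of the stalk
  determines abstractly; uniqueness of additive inverses identifies the negated constant with
  scaling by \<open>- c\<close>.\<close>

lemma stalk_minus_const:
  assumes U: "openin (body X) U" "x \<in> U" "f \<in> carrier (sec X U)"
  shows "germ X x U f \<ominus>\<^bsub>stalk X x\<^esub> (c \<odot>\<^bsub>stalk X x\<^esub> \<one>\<^bsub>stalk X x\<^esub>) =
    germ X x U (f \<oplus>\<^bsub>sec X U\<^esub> ((- c) \<odot>\<^bsub>sec X U\<^esub> \<one>\<^bsub>sec X U\<^esub>))"
proof -
  have x: "x \<in> topspace (body X)" using U openin_subset by blast
  interpret S: ring "stalk X x" by (rule ring_stalk[OF x])
  interpret A: ring "sec X U" by (rule sec_ring[OF U(1)])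
  interpret M: module real_ring "sec X U" by (rule sec_module[OF U(1)])
  let ?k = "\<lambda>c. c \<odot>\<^bsub>sec X U\<^esub> \<one>\<^bsub>sec X U\<^esub>"
  have k: "?k c \<in> carrier (sec X U)" for c using sec_smult_closed[OF U(1)] by simp
  have "?k (- c) \<oplus>\<^bsub>sec X U\<^esub> ?k c = \<zero>\<^bsub>sec X U\<^esub>"
    using M.smult_l_distr[of "- c" c "\<one>\<^bsub>sec X U\<^esub>"] M.smult_l_null[of "\<one>\<^bsub>sec X U\<^esub>"] by simp
  then have "germ X x U (?k (- c)) \<oplus>\<^bsub>stalk X x\<^esub> germ X x U (?k c) = \<zero>\<^bsub>stalk X x\<^esub>"
    using germ_add[OF U(1,2) k k] germ_zero[OF U(1,2)] by simp
  then have "\<ominus>\<^bsub>stalk X x\<^esub> germ X x U (?k c) = germ X x U (?k (- c))"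
    by (intro S.minus_equality germ_in_stalk[OF U(1,2) k])
  then show ?thesis
    unfolding a_minus_def germ_one[OF U(1,2)] using germ_smult[OF U(1,2)] germ_add[OF U k] by simp
qed

end

section \<open>Tangent vectors in a chart\<close>

text \<open>The parity-free notion. In \<open>homogeneous_tangent\<close> a sign can occur only in
  front of the value of an odd germ, which is 0 in a chart; so even and odd derivations obey one
  Leibniz rule, and \<open>tangent_space_eq\<close> shows that all its solutions are tangent
  vectors.\<close>

definition point_derivation ::
    "('x, 's) superspace \<Rightarrow> 'x \<Rightarrow> (('x set \<times> 's) set \<Rightarrow> real) \<Rightarrow> bool" where
  "point_derivation X x D \<longleftrightarrow>
     (\<forall>\<alpha>. \<alpha> \<notin> carrier (stalk X x) \<longrightarrow> D \<alpha> = 0) \<and>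
     (\<forall>\<alpha>\<in>carrier (stalk X x). \<forall>\<beta>\<in>carrier (stalk X x). D (\<alpha> \<oplus>\<^bsub>stalk X x\<^esub> \<beta>) = D \<alpha> + D \<beta>) \<and>
     (\<forall>c. \<forall>\<alpha>\<in>carrier (stalk X x). D (c \<odot>\<^bsub>stalk X x\<^esub> \<alpha>) = c * D \<alpha>) \<and>
     (\<forall>\<alpha>\<in>carrier (stalk X x). \<forall>\<beta>\<in>carrier (stalk X x). D (\<alpha> \<otimes>\<^bsub>stalk X x\<^esub> \<beta>) =
        D \<alpha> * germ_value X x \<beta> + germ_value X x \<alpha> * D \<beta>)"

lemma point_derivationD:
  assumes "point_derivation X x D"
  shows "\<alpha> \<notin> carrier (stalk X x) \<Longrightarrow> D \<alpha> = 0"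
    and "\<alpha> \<in> carrier (stalk X x) \<Longrightarrow> \<beta> \<in> carrier (stalk X x) \<Longrightarrow>
      D (\<alpha> \<oplus>\<^bsub>stalk X x\<^esub> \<beta>) = D \<alpha> + D \<beta>"
    and "\<alpha> \<in> carrier (stalk X x) \<Longrightarrow> D (c \<odot>\<^bsub>stalk X x\<^esub> \<alpha>) = c * D \<alpha>"
    and "\<alpha> \<in> carrier (stalk X x) \<Longrightarrow> \<beta> \<in> carrier (stalk X x) \<Longrightarrow>
      D (\<alpha> \<otimes>\<^bsub>stalk X x\<^esub> \<beta>) = D \<alpha> * germ_value X x \<beta> + germ_value X x \<alpha> * D \<beta>"
  using assms unfolding point_derivation_def by simp_all

lemma point_derivation_add:
  assumes "point_derivation X x D" "point_derivation X x D'"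
  shows "point_derivation X x (\<lambda>\<alpha>. D \<alpha> + D' \<alpha>)"
  using assms unfolding point_derivation_def by (simp add: algebra_simps)

lemma homogeneous_tangentD:
  assumes "\<eta> \<in> homogeneous_tangent X x j"
  shows "\<alpha> \<notin> carrier (stalk X x) \<Longrightarrow> \<eta> \<alpha> = 0"
    and "\<alpha> \<in> carrier (stalk X x) \<Longrightarrow> \<beta> \<in> carrier (stalk X x) \<Longrightarrow>
      \<eta> (\<alpha> \<oplus>\<^bsub>stalk X x\<^esub> \<beta>) = \<eta> \<alpha> + \<eta> \<beta>"
    and "\<alpha> \<in> carrier (stalk X x) \<Longrightarrow> \<eta> (c \<odot>\<^bsub>stalk X x\<^esub> \<alpha>) = c * \<eta> \<alpha>"
    and "\<alpha> \<in> homog (stalk X x) k \<Longrightarrow> \<beta> \<in> carrier (stalk X x) \<Longrightarrow>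
      \<eta> (\<alpha> \<otimes>\<^bsub>stalk X x\<^esub> \<beta>) = \<eta> \<alpha> * germ_value X x \<beta> +
        (if j = 1 \<and> k = 1 then - 1 else 1) * germ_value X x \<alpha> * \<eta> \<beta>"
  using assms unfolding homogeneous_tangent_def by simp_all

section \<open>Germs expressed in the coordinates of a chart\<close>

locale super_chart =
  fixes a b :: nat and X :: "('x, 's) superspace" and Q :: "'x set" and U :: "(nat \<Rightarrow> real) set"
    and \<kappa> :: "('x, 's, nat \<Rightarrow> real, superfun) supermap"
  assumes sheaf: "super_ringed_space X" and chart: "is_chart a b X Q U \<kappa>"
begin

lemma open_Q: "openin (body X) Q" and open_U: "openin (Euclidean_space a) U"
  and chart_morphism: "is_morphism (open_subspace X Q) (superdomain a b U) \<kappa>"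
  and chart_homeomorphic:
    "homeomorphic_map (subtopology (body X) Q) (subtopology (Euclidean_space a) U) (underlying \<kappa>)"
  using chart unfolding is_chart_def by simp_all

definition over :: "(nat \<Rightarrow> real) set \<Rightarrow> 'x set" where
  "over V = preim (open_subspace X Q) \<kappa> V"

lemma Q_subset: "Q \<subseteq> topspace (body X)"
  using open_Q openin_subset by blast

lemma over_iff: "x \<in> over V \<longleftrightarrow> x \<in> Q \<and> underlying \<kappa> x \<in> V"
  using Q_subset by (auto simp: over_def preim_def open_subspace_def)

lemma underlying_in_U: "x \<in> Q \<Longrightarrow> underlying \<kappa> x \<in> U"
  using homeomorphic_imp_surjective_map[OF chart_homeomorphic] Q_subset openin_subset[OF open_U]
  by (auto simp: topspace_subtopology)

lemma over_U: "over U = Q"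
  using underlying_in_U by (auto simp: over_iff)

lemma openin_superdomain:
  "openin (body (superdomain a b U)) V \<longleftrightarrow> openin (Euclidean_space a) V \<and> V \<subseteq> U"
  by (simp add: superdomain_def openin_open_subtopology[OF open_U])

lemma openin_over:
  assumes "openin (Euclidean_space a) V" "V \<subseteq> U"
  shows "openin (body X) (over V)"
proof -
  have "continuous_map (subtopology (body X) Q) (subtopology (Euclidean_space a) U) (underlying \<kappa>)"
    by (rule homeomorphic_imp_continuous_map[OF chart_homeomorphic])
  moreover have "openin (subtopology (Euclidean_space a) U) V"
    using assms by (simp add: openin_open_subtopology[OF open_U])
  ultimately have "openin (subtopology (body X) Q)
      {x \<in> topspace (subtopology (body X) Q). underlying \<kappa> x \<in> V}"
    by (rule openin_continuous_map_preimage)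
  moreover have "{x \<in> topspace (subtopology (body X) Q). underlying \<kappa> x \<in> V} = over V"
    using Q_subset by (auto simp: over_iff)
  ultimately show ?thesis by (simp add: openin_open_subtopology[OF open_Q])
qed

lemma open_image:
  assumes "openin (body X) W" "W \<subseteq> Q"
  shows "openin (Euclidean_space a) (underlying \<kappa> ` W)" "underlying \<kappa> ` W \<subseteq> U"
    "over (underlying \<kappa> ` W) = W"
proof -
  have "openin (subtopology (body X) Q) W"
    using assms by (simp add: openin_open_subtopology[OF open_Q])
  then have "openin (subtopology (Euclidean_space a) U) (underlying \<kappa> ` W)"
    using homeomorphic_imp_open_map[OF chart_homeomorphic] unfolding open_map_def by blast
  then show "openin (Euclidean_space a) (underlying \<kappa> ` W)" "underlying \<kappa> ` W \<subseteq> U"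
    by (simp_all add: openin_open_subtopology[OF open_U])
  have "inj_on (underlying \<kappa>) Q"
    using homeomorphic_imp_injective_map[OF chart_homeomorphic] Q_subset
    by (simp add: topspace_subtopology inf_absorb2)
  then show "over (underlying \<kappa> ` W) = W"
    using assms(2) by (auto simp: over_iff) (metis inj_onD subsetD)
qed

lemma pull_hom:
  assumes "openin (Euclidean_space a) V" "V \<subseteq> U"
  shows "pull \<kappa> V \<in> superring_hom (superfun_algebra a b V) (sec X (over V))"
proof -
  have "pull \<kappa> V \<in> superring_hom (sec (superdomain a b U) V)
      (sec (open_subspace X Q) (preim (open_subspace X Q) \<kappa> V))"
    using chart_morphism[unfolded is_morphism_def, THEN conjunct2, THEN conjunct1, rule_format, of V]
      openin_superdomain assms by blast
  then show ?thesis by (simp add: over_def superdomain_def open_subspace_def)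
qed

lemmas pull_simps = superring_homD[OF pull_hom, unfolded superfun_algebra_simps]

lemma pull_bij:
  assumes "openin (Euclidean_space a) V" "V \<subseteq> U"
  shows "bij_betw (pull \<kappa> V) (superfun_carrier a b V) (carrier (sec X (over V)))"
  using chart assms unfolding is_chart_def over_def by simp

lemma pull_inj:
  assumes "openin (Euclidean_space a) V" "V \<subseteq> U" "f \<in> superfun_carrier a b V"
    "g \<in> superfun_carrier a b V" "pull \<kappa> V f = pull \<kappa> V g"
  shows "f = g"
  using pull_bij[OF assms(1,2)] assms(3-5) by (auto simp: bij_betw_def inj_on_def)

lemma pull_smult:
  assumes "openin (Euclidean_space a) V" "V \<subseteq> U" "f \<in> superfun_carrier a b V"
  shows "pull \<kappa> V (\<lambda>I x. c * f I x) = c \<odot>\<^bsub>sec X (over V)\<^esub> pull \<kappa> V f"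
proof -
  have "real_linear_on (superfun_algebra a b V) (sec X (over V)) (pull \<kappa> V)"
    using chart assms unfolding is_chart_def over_def by simp
  then show ?thesis using assms(3) unfolding real_linear_on_def by simp
qed

lemma res_pull:
  assumes "openin (Euclidean_space a) V" "V \<subseteq> U" "openin (Euclidean_space a) W" "W \<subseteq> V"
    "f \<in> superfun_carrier a b V"
  shows "res X (over V) (over W) (pull \<kappa> V f) = pull \<kappa> W (superfun_restrict W f)"
proof -
  have "openin (body (superdomain a b U)) V \<and> openin (body (superdomain a b U)) W \<and> W \<subseteq> V"
    using openin_superdomain assms by auto
  moreover have "f \<in> carrier (sec (superdomain a b U) V)" using assms by (simp add: superdomain_def)
  ultimately have "res (open_subspace X Q) (preim (open_subspace X Q) \<kappa> V)
      (preim (open_subspace X Q) \<kappa> W) (pull \<kappa> V f) = pull \<kappa> W (res (superdomain a b U) V W f)"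
    by (rule chart_morphism[unfolded is_morphism_def, THEN conjunct2, THEN conjunct2, rule_format])
  then show ?thesis by (simp add: over_def superdomain_def open_subspace_def superfun_restrict_def)
qed

text \<open>The coordinate expression of a germ. Neither \<open>V\<close> nor \<open>f\<close> is
  unique; two expressions of one germ are compared by \<open>represents_unique\<close>.\<close>

definition represents :: "'x \<Rightarrow> (nat \<Rightarrow> real) set \<Rightarrow> superfun \<Rightarrow> ('x set \<times> 's) set \<Rightarrow> bool" where
  "represents x V f \<alpha> \<longleftrightarrow> openin (Euclidean_space a) V \<and> V \<subseteq> U \<and> x \<in> over V \<and>
     f \<in> superfun_carrier a b V \<and> \<alpha> = germ X x (over V) (pull \<kappa> V f)"

lemma representsD:
  assumes "represents x V f \<alpha>"
  shows "openin (Euclidean_space a) V" "V \<subseteq> U" "x \<in> over V" "f \<in> superfun_carrier a b V"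
    "\<alpha> = germ X x (over V) (pull \<kappa> V f)" "underlying \<kappa> x \<in> V" "x \<in> Q" "openin (body X) (over V)"
    "pull \<kappa> V f \<in> carrier (sec X (over V))" "\<alpha> \<in> carrier (stalk X x)"
proof -
  show *: "openin (Euclidean_space a) V" "V \<subseteq> U" "x \<in> over V" "f \<in> superfun_carrier a b V"
    "\<alpha> = germ X x (over V) (pull \<kappa> V f)"
    using assms by (simp_all add: represents_def)
  show "underlying \<kappa> x \<in> V" "x \<in> Q" using *(3) by (simp_all add: over_iff)
  show o: "openin (body X) (over V)" using openin_over * by blast
  show c: "pull \<kappa> V f \<in> carrier (sec X (over V))" using pull_simps(1) * by blast
  show "\<alpha> \<in> carrier (stalk X x)" using germ_in_stalk[OF sheaf o *(3) c] *(5) by simp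
qed

lemma represents_restrict:
  assumes "represents x V f \<alpha>" "openin (Euclidean_space a) W" "W \<subseteq> V" "underlying \<kappa> x \<in> W"
  shows "represents x W (superfun_restrict W f) \<alpha>"
proof -
  note R = representsD[OF assms(1)]
  have x: "x \<in> over W" using R assms by (simp add: over_iff)
  have "germ X x (over W) (res X (over V) (over W) (pull \<kappa> V f)) = germ X x (over V) (pull \<kappa> V f)"
    by (rule germ_res[OF sheaf R(8) _ x _ R(9)]) (use R assms openin_over in \<open>auto simp: over_iff\<close>)
  then show ?thesis
    using R assms x superfun_restrict_carrier[OF R(1) assms(2,3) R(4)] res_pull
    by (auto simp: represents_def)
qed

lemma section_pull:
  assumes "openin (body X) W" "W \<subseteq> Q" "f \<in> carrier (sec X W)"
  obtains g where "g \<in> superfun_carrier a b (underlying \<kappa> ` W)" "f = pull \<kappa> (underlying \<kappa> ` W) g"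
  using pull_bij[OF open_image(1,2)[OF assms(1,2)]] assms(3) open_image(3)[OF assms(1,2)]
  unfolding bij_betw_def by (metis imageE)

lemma represents_germ:
  assumes "openin (body X) W" "x \<in> W" "W \<subseteq> Q" "g \<in> superfun_carrier a b (underlying \<kappa> ` W)"
  shows "represents x (underlying \<kappa> ` W) g (germ X x W (pull \<kappa> (underlying \<kappa> ` W) g))"
  using assms open_image[OF assms(1,3)] by (auto simp: represents_def)

lemma represents_ex:
  assumes "x \<in> Q" "\<alpha> \<in> carrier (stalk X x)"
  obtains V f where "represents x V f \<alpha>"
proof -
  obtain W f where W: "openin (body X) W" "x \<in> W" "f \<in> carrier (sec X W)" "\<alpha> = germ X x W f"
    using stalk_cases[OF sheaf assms(2)] by blast
  have o: "openin (body X) (W \<inter> Q)" using W open_Q by blast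
  obtain g where g: "g \<in> superfun_carrier a b (underlying \<kappa> ` (W \<inter> Q))"
      "res X W (W \<inter> Q) f = pull \<kappa> (underlying \<kappa> ` (W \<inter> Q)) g"
    by (rule section_pull[OF o _ res_hom(1)[OF sheaf W(1) o _ W(3)]]) auto
  have "germ X x (W \<inter> Q) (res X W (W \<inter> Q) f) = \<alpha>"
    using germ_res[OF sheaf W(1) o _ _ W(3)] W assms by auto
  moreover have "represents x (underlying \<kappa> ` (W \<inter> Q)) g
      (germ X x (W \<inter> Q) (pull \<kappa> (underlying \<kappa> ` (W \<inter> Q)) g))"
    by (rule represents_germ[OF o _ _ g(1)]) (use W assms in auto)
  ultimately show ?thesis using that g(2) by simp
qed

text \<open>Provides the shape of neighbourhood on which \<open>superfun_derivation_formula\<close>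
  applies.\<close>

lemma represents_cube:
  assumes "x \<in> Q" "\<alpha> \<in> carrier (stalk X x)"
  obtains d f where "d > 0" "represents x (cube a (underlying \<kappa> x) d) f \<alpha>"
proof -
  obtain V f where R: "represents x V f \<alpha>" using represents_ex assms .
  obtain d where d: "d > 0" "cube a (underlying \<kappa> x) d \<subseteq> V"
    using cube_neighbourhood_base[OF representsD(1,6)[OF R]] .
  have "underlying \<kappa> x \<in> topspace (Euclidean_space a)"
    using representsD(1,6)[OF R] openin_subset by blast
  then show ?thesis
    using that d represents_restrict[OF R openin_cube d(2) center_in_cube] by blast
qed

lemma represents_ex2:
  assumes "x \<in> Q" "\<alpha> \<in> carrier (stalk X x)" "\<beta> \<in> carrier (stalk X x)"
  obtains V f g where "represents x V f \<alpha>" "represents x V g \<beta>"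
proof -
  obtain V f where 1: "represents x V f \<alpha>" using represents_ex assms(1,2) .
  obtain W g where 2: "represents x W g \<beta>" using represents_ex assms(1,3) .
  have o: "openin (Euclidean_space a) (V \<inter> W)" using representsD(1) 1 2 by blast
  show ?thesis
    by (rule that[OF represents_restrict[OF 1 o] represents_restrict[OF 2 o]])
      (use representsD(6) 1 2 in auto)
qed

text \<open>Equal germs come from sections that agree near \<open>x\<close>, and a chart is
  injective on sections over each open set.\<close>

lemma represents_unique:
  assumes "represents x V f \<alpha>" "represents x W g \<alpha>"
  obtains N where "openin (Euclidean_space a) N" "underlying \<kappa> x \<in> N" "N \<subseteq> V" "N \<subseteq> W"
    "\<And>I y. y \<in> N \<Longrightarrow> f I y = g I y"
proof -
  note R = representsD[OF assms(1)] and S = representsD[OF assms(2)]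
  obtain N where N: "openin (body X) N" "x \<in> N" "N \<subseteq> over V \<inter> over W"
      "res X (over V) N (pull \<kappa> V f) = res X (over W) N (pull \<kappa> W g)"
    using germ_eqD[OF sheaf _ R(8) S(8) S(3) R(9) S(9)] R(5) S(5) by blast
  let ?N = "underlying \<kappa> ` N"
  have "N \<subseteq> Q" using N(3) by (auto simp: over_iff)
  note I = open_image[OF N(1) this]
  have sub: "?N \<subseteq> V" "?N \<subseteq> W" using N(3) by (auto simp: over_iff)
  have "pull \<kappa> ?N (superfun_restrict ?N f) = pull \<kappa> ?N (superfun_restrict ?N g)"
    using N(4) res_pull[OF R(1,2) I(1) sub(1) R(4)] res_pull[OF S(1,2) I(1) sub(2) S(4)] I(3) by simp
  then have "superfun_restrict ?N f = superfun_restrict ?N g"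
    by (rule pull_inj[OF I(1,2) superfun_restrict_carrier[OF R(1) I(1) sub(1) R(4)]
          superfun_restrict_carrier[OF S(1) I(1) sub(2) S(4)]])
  then have "f I y = g I y" if "y \<in> ?N" for I y
    using that by (metis superfun_restrict_def)
  with I(1) sub N(2) that[of ?N] show ?thesis by blast
qed

lemma represents_add:
  assumes "represents x V f \<alpha>" "represents x V g \<beta>"
  shows "represents x V (\<lambda>I x. f I x + g I x) (\<alpha> \<oplus>\<^bsub>stalk X x\<^esub> \<beta>)"
proof -
  note R = representsD[OF assms(1)] and S = representsD[OF assms(2)]
  show ?thesis
    using R S superfun_carrier_add[OF R(1,4) S(4)] germ_add[OF sheaf R(8,3,9) S(9)]
    by (simp add: represents_def pull_simps(3))
qed

lemma represents_mult:
  assumes "represents x V f \<alpha>" "represents x V g \<beta>"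
  shows "represents x V (superfun_mult f g) (\<alpha> \<otimes>\<^bsub>stalk X x\<^esub> \<beta>)"
proof -
  note R = representsD[OF assms(1)] and S = representsD[OF assms(2)]
  show ?thesis
    using R S superfun_carrier_mult[OF R(1,4) S(4)] germ_mult[OF sheaf R(8,3,9) S(9)]
    by (simp add: represents_def pull_simps(2))
qed

lemma represents_smult:
  assumes "represents x V f \<alpha>"
  shows "represents x V (\<lambda>I x. c * f I x) (c \<odot>\<^bsub>stalk X x\<^esub> \<alpha>)"
proof -
  note R = representsD[OF assms(1)]
  show ?thesis
    using R superfun_carrier_smult[OF R(1,4)] germ_smult[OF sheaf R(8,3,9)]
    by (simp add: represents_def pull_smult)
qed

lemma represents_one:
  assumes "openin (Euclidean_space a) V" "V \<subseteq> U" "x \<in> over V"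
  shows "represents x V (superfun_monomial V {} (\<lambda>x. 1)) \<one>\<^bsub>stalk X x\<^esub>"
  using assms germ_one[OF sheaf openin_over[OF assms(1,2)] assms(3)]
    superfun_monomial_carrier[OF assms(1) smooth_fun_on_const[OF assms(1)]]
  by (simp add: represents_def pull_simps(4))

text \<open>A choice among the numbers given by all coordinate expressions;
  \<open>partial_at_eq\<close> shows that they coincide.\<close>

definition partial_at :: "'x \<Rightarrow> nat \<Rightarrow> ('x set \<times> 's) set \<Rightarrow> real" where
  "partial_at x k \<alpha> = (SOME r. \<exists>V f. represents x V f \<alpha> \<and> r = super_partial a k f (underlying \<kappa> x))"

lemma partial_at_eq:
  assumes "represents x V f \<alpha>"
  shows "partial_at x k \<alpha> = super_partial a k f (underlying \<kappa> x)"
  unfolding partial_at_def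
proof (rule some_equality)
  fix r assume "\<exists>V f. represents x V f \<alpha> \<and> r = super_partial a k f (underlying \<kappa> x)"
  then obtain W g where W: "represents x W g \<alpha>" "r = super_partial a k g (underlying \<kappa> x)" by blast
  obtain N where N: "openin (Euclidean_space a) N" "underlying \<kappa> x \<in> N"
    "\<And>I y. y \<in> N \<Longrightarrow> g I y = f I y"
    using represents_unique[OF W(1) assms] by metis
  show "r = super_partial a k f (underlying \<kappa> x)"
    unfolding W(2) by (rule super_partial_cong[OF N])
qed (use assms in blast)

text \<open>The stalk is a local ring. If a product is 1, so is the product of the bodies;
  conversely \<open>superfun_inverse\<close> provides an inverse on the open set where the body does
  not vanish.\<close>

lemma Units_stalk_iff:
  assumes "represents x V f \<alpha>"
  shows "\<alpha> \<in> Units (stalk X x) \<longleftrightarrow> f {} (underlying \<kappa> x) \<noteq> 0"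
proof
  note R = representsD[OF assms]
  have x: "x \<in> topspace (body X)" using R(7) Q_subset by blast
  interpret S: ring "stalk X x" by (rule ring_stalk[OF sheaf x])
  {
    assume "\<alpha> \<in> Units (stalk X x)"
    then obtain \<beta> where \<beta>: "\<beta> \<in> carrier (stalk X x)" "\<alpha> \<otimes>\<^bsub>stalk X x\<^esub> \<beta> = \<one>\<^bsub>stalk X x\<^esub>"
      by (auto simp: Units_def)
    obtain W f' g where W: "represents x W f' \<alpha>" "represents x W g \<beta>"
      using represents_ex2[OF R(7,10) \<beta>(1)] .
    note RW = representsD[OF W(1)]
    obtain N where N: "underlying \<kappa> x \<in> N"
        "\<And>I y. y \<in> N \<Longrightarrow> superfun_mult f' g I y = superfun_monomial W {} (\<lambda>x. 1) I y"
      using represents_unique[OF represents_mult[OF W] represents_one[OF RW(1-3), folded \<beta>(2)]] by metis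
    have "f' {} (underlying \<kappa> x) * g {} (underlying \<kappa> x) = 1"
      using N(2)[OF N(1), of "{}"] RW(6) by (simp add: superfun_mult_body superfun_monomial_def)
    moreover obtain M where "underlying \<kappa> x \<in> M" "\<And>I y. y \<in> M \<Longrightarrow> f' I y = f I y"
      using represents_unique[OF W(1) assms] by metis
    ultimately show "f {} (underlying \<kappa> x) \<noteq> 0" by force
  }
  have right_inverse: "\<exists>g W. represents x W g \<beta> \<and> g {} (underlying \<kappa> x) \<noteq> 0 \<and> \<alpha> \<otimes>\<^bsub>stalk X x\<^esub> \<beta> = \<one>\<^bsub>stalk X x\<^esub>"
    if "represents x V f \<alpha>" "f {} (underlying \<kappa> x) \<noteq> 0"
      "\<beta> = germ X x (over {y \<in> V. f {} y \<noteq> 0}) (pull \<kappa> {y \<in> V. f {} y \<noteq> 0}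
        (superfun_inverse (superfun_restrict {y \<in> V. f {} y \<noteq> 0} f)))" for V f \<alpha> \<beta>
  proof -
    note R = representsD[OF that(1)]
    let ?W = "{y \<in> V. f {} y \<noteq> 0}"
    have W: "openin (Euclidean_space a) ?W"
      using openin_Euclidean_preimage[OF R(1)
          smooth_fun_on_imp_continuous[OF R(1) superfun_carrier_smooth[OF R(4)]], of "- {0}" "{}"] by auto
    have rW: "represents x ?W (superfun_restrict ?W f) \<alpha>"
      by (rule represents_restrict[OF that(1) W]) (use R that in auto)
    note RW = representsD[OF rW]
    have nz: "superfun_restrict ?W f {} y \<noteq> 0" if "y \<in> ?W" for y
      using that by (simp add: superfun_restrict_def)
    let ?g = "superfun_inverse (superfun_restrict ?W f)"
    have rg: "represents x ?W ?g \<beta>"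
      using RW superfun_inverse_carrier[OF W RW(4) nz] that(3) by (auto simp: represents_def)
    have "represents x ?W (superfun_monomial ?W {} (\<lambda>x. 1)) (\<alpha> \<otimes>\<^bsub>stalk X x\<^esub> \<beta>)"
      using represents_mult[OF rW rg] superfun_mult_inverse[OF W RW(4) nz] by simp
    then have "\<alpha> \<otimes>\<^bsub>stalk X x\<^esub> \<beta> = \<one>\<^bsub>stalk X x\<^esub>"
      using represents_one[OF RW(1-3)] by (simp add: represents_def)
    moreover have "?g {} (underlying \<kappa> x) \<noteq> 0"
      using nz[of "underlying \<kappa> x"] RW(6) by (simp add: superfun_inverse.simps[of _ "{}"])
    ultimately show ?thesis using rg by blast
  qed
  assume nz: "f {} (underlying \<kappa> x) \<noteq> 0"
  obtain \<beta> g W where \<beta>: "represents x W g \<beta>" "g {} (underlying \<kappa> x) \<noteq> 0"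
      "\<alpha> \<otimes>\<^bsub>stalk X x\<^esub> \<beta> = \<one>\<^bsub>stalk X x\<^esub>"
    using right_inverse[OF assms nz refl] by blast
  \<comment> \<open>The right inverse \<open>\<beta>\<close> has a nonzero body and hence a right
    inverse \<open>\<gamma>\<close> of its own. Associativity forces
    \<open>\<gamma> = \<alpha>\<close>, so \<open>\<beta>\<close> is a two-sided inverse.\<close>
  obtain \<gamma> h W' where \<gamma>: "represents x W' h \<gamma>" "\<beta> \<otimes>\<^bsub>stalk X x\<^esub> \<gamma> = \<one>\<^bsub>stalk X x\<^esub>"
    using right_inverse[OF \<beta>(1,2) refl] by blast
  note c = representsD(10)[OF assms] representsD(10)[OF \<beta>(1)] representsD(10)[OF \<gamma>(1)]
  have "\<alpha> = \<alpha> \<otimes>\<^bsub>stalk X x\<^esub> (\<beta> \<otimes>\<^bsub>stalk X x\<^esub> \<gamma>)" using c \<gamma>(2) by simp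
  also have "\<dots> = \<gamma>" using c \<beta>(3) by (simp flip: S.m_assoc)
  finally show "\<alpha> \<in> Units (stalk X x)" using c \<beta>(3) \<gamma>(2) unfolding Units_def by auto
qed

text \<open>Subtracting \<open>c\<close> gives a non-unit exactly when the body has the value
  \<open>c\<close> at the point, so the description in \<open>germ_value\<close> has one
  solution.\<close>

lemma germ_value_eq:
  assumes "represents x V f \<alpha>"
  shows "germ_value X x \<alpha> = f {} (underlying \<kappa> x)"
proof -
  note R = representsD[OF assms]
  have "\<alpha> \<ominus>\<^bsub>stalk X x\<^esub> (c \<odot>\<^bsub>stalk X x\<^esub> \<one>\<^bsub>stalk X x\<^esub>) \<in> Units (stalk X x) \<longleftrightarrow>
      f {} (underlying \<kappa> x) \<noteq> c" for c
  proof -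
    let ?one = "superfun_monomial V {} (\<lambda>x. 1)"
    have "represents x V (\<lambda>I y. f I y + (- c) * ?one I y)
        (\<alpha> \<oplus>\<^bsub>stalk X x\<^esub> ((- c) \<odot>\<^bsub>stalk X x\<^esub> \<one>\<^bsub>stalk X x\<^esub>))"
      by (intro represents_add represents_smult represents_one assms R)
    moreover have "\<alpha> \<oplus>\<^bsub>stalk X x\<^esub> ((- c) \<odot>\<^bsub>stalk X x\<^esub> \<one>\<^bsub>stalk X x\<^esub>) =
        \<alpha> \<ominus>\<^bsub>stalk X x\<^esub> (c \<odot>\<^bsub>stalk X x\<^esub> \<one>\<^bsub>stalk X x\<^esub>)"
    proof -
      let ?A = "sec X (over V)"
      have one: "\<one>\<^bsub>?A\<^esub> \<in> carrier ?A"
        using ring.ring_simprules(6)[OF sec_ring[OF sheaf R(8)]] .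
      have "(- c) \<odot>\<^bsub>stalk X x\<^esub> \<one>\<^bsub>stalk X x\<^esub> = germ X x (over V) ((- c) \<odot>\<^bsub>?A\<^esub> \<one>\<^bsub>?A\<^esub>)"
        unfolding germ_one[OF sheaf R(8,3)] by (rule germ_smult[OF sheaf R(8,3) one])
      then show ?thesis
        unfolding R(5) stalk_minus_const[OF sheaf R(8,3,9)]
        by (simp only: germ_add[OF sheaf R(8,3,9) sec_smult_closed[OF sheaf R(8) one]])
    qed
    ultimately show ?thesis
      using Units_stalk_iff R(6) by (fastforce simp: superfun_monomial_def)
  qed
  then show ?thesis unfolding germ_value_def by auto
qed

text \<open>A chart is known to preserve parity only from coordinates to sections. The converse
  comes from uniqueness of the parity decomposition: the part of the wrong parity in the coordinate
  expression has to be 0.\<close>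

lemma homog_represents:
  assumes "openin (body X) W" "x \<in> W" "x \<in> Q" "h \<in> homog (sec X W) j"
  obtains V f where "represents x V f (germ X x W h)" "\<And>I y. f I y \<noteq> 0 \<Longrightarrow> of_nat (card I) = j"
proof -
  let ?W = "W \<inter> Q"
  let ?V = "underlying \<kappa> ` ?W"
  have o: "openin (body X) ?W" using assms open_Q by blast
  note I = open_image[OF o Int_lower2]
  let ?A = "sec X ?W"
  have h: "h \<in> carrier (sec X W)" using sec_homog_subset[OF sheaf assms(1)] assms(4) by blast
  have rh: "res X W ?W h \<in> homog ?A j" by (rule res_hom(5)[OF sheaf assms(1) o _ assms(4)]) simp
  then have rhc: "res X W ?W h \<in> carrier ?A" using sec_homog_subset[OF sheaf o] by blast
  obtain g where g: "g \<in> superfun_carrier a b ?V" "res X W ?W h = pull \<kappa> ?V g"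
    using section_pull[OF o Int_lower2 rhc] .
  have "germ X x ?W (res X W ?W h) = germ X x W h"
    by (rule germ_res[OF sheaf assms(1) o _ _ h]) (use assms in auto)
  then have R: "represents x ?V g (germ X x W h)"
    using represents_germ[OF o _ Int_lower2 g(1), of x] g(2) assms by simp
  define part where "part k = (\<lambda>I x. if of_nat (card I) = (k::bit) then g I x else 0)" for k
  have part: "part k \<in> superfun_carrier a b ?V" for k
    unfolding part_def by (rule superfun_carrier_bit_part[OF I(1) g(1)])
  have part_homog: "pull \<kappa> ?V (part k) \<in> homog ?A k" for k
  proof -
    have "\<forall>I x. part k I x \<noteq> 0 \<longrightarrow> of_nat (card I) = k" by (simp add: part_def)
    with part have "part k \<in> homog (superfun_algebra a b ?V) k"
      unfolding superfun_algebra_homog by blast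
    from pull_simps(5)[OF I(1,2) this] show ?thesis unfolding I(3) .
  qed
  have g_sum: "g = (\<lambda>I x. part 0 I x + part 1 I x)"
  proof (intro ext)
    fix I x show "g I x = part 0 I x + part 1 I x"
      by (cases "of_nat (card I) :: bit") (auto simp: part_def)
  qed
  have sum: "res X W ?W h = pull \<kappa> ?V (part 0) \<oplus>\<^bsub>?A\<^esub> pull \<kappa> ?V (part 1)"
    using pull_simps(3)[OF I(1,2) part part, of 0 1] g(2) g_sum I(3) by simp
  have zero: "\<zero>\<^bsub>?A\<^esub> \<in> homog ?A k" for k by (rule sec_zero_homog[OF sheaf o])
  have pull_zero: "pull \<kappa> ?V (\<lambda>I x. 0) = \<zero>\<^bsub>?A\<^esub>"
  proof -
    interpret A: ring ?A by (rule sec_ring[OF sheaf o])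
    \<comment> \<open>Additivity suffices: an element equal to its own double is zero.\<close>
    have "pull \<kappa> ?V (\<lambda>I x. 0) = pull \<kappa> ?V (\<lambda>I x. 0) \<oplus>\<^bsub>?A\<^esub> pull \<kappa> ?V (\<lambda>I x. 0)"
      using pull_simps(3)[OF I(1,2) superfun_carrier_zero[OF I(1)] superfun_carrier_zero[OF I(1)]] I(3)
      by simp
    moreover have "pull \<kappa> ?V (\<lambda>I x. 0) \<in> carrier ?A"
      using pull_simps(1)[OF I(1,2) superfun_carrier_zero[OF I(1)]] I(3) by simp
    ultimately show ?thesis using A.r_zero A.add.l_cancel_one' by metis
  qed
  \<comment> \<open>In \<open>bit\<close> the element \<open>j + 1\<close> is the opposite parity.
    The restricted section decomposes as itself plus zero and also as the two pulled-back parts, so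
    these decompositions agree.\<close>
  have "part (j + 1) = (\<lambda>I x. 0)"
  proof (rule pull_inj[OF I(1,2) part superfun_carrier_zero[OF I(1)]])
    interpret A: ring ?A by (rule sec_ring[OF sheaf o])
    note ex1 = sec_parity_decomposition[OF sheaf o rhc]
    have uniq: "p = p'" if "(case p of (g, h) \<Rightarrow> g \<in> homog ?A 0 \<and> h \<in> homog ?A 1 \<and> res X W ?W h' = g \<oplus>\<^bsub>?A\<^esub> h)"
      "(case p' of (g, h) \<Rightarrow> g \<in> homog ?A 0 \<and> h \<in> homog ?A 1 \<and> res X W ?W h' = g \<oplus>\<^bsub>?A\<^esub> h)"
      "h' = h" for p p' h'
      using that ex1 by blast
    show "pull \<kappa> ?V (part (j + 1)) = pull \<kappa> ?V (\<lambda>I x. 0)"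
    proof -
      consider (zero_case) "j = 0" | (one_case) "j = 1" by (cases j) auto
      then show ?thesis
      proof cases
        case zero_case
        have "(res X W ?W h, \<zero>\<^bsub>?A\<^esub>) = (pull \<kappa> ?V (part 0), pull \<kappa> ?V (part 1))"
          by (rule uniq[OF _ _ refl]) (use rh rhc zero part_homog sum zero_case in auto)
        then show ?thesis using pull_zero zero_case by simp
      next
        case one_case
        have "(\<zero>\<^bsub>?A\<^esub>, res X W ?W h) = (pull \<kappa> ?V (part 0), pull \<kappa> ?V (part 1))"
          by (rule uniq[OF _ _ refl]) (use rh rhc zero part_homog sum one_case in auto)
        then show ?thesis using pull_zero one_case by simp
      qed
    qed
  qed
  then have zero_part: "part (j + 1) I y = 0" for I y by simp
  have "of_nat (card I) = j" if "g I y \<noteq> 0" for I y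
    using that zero_part[of I y] by (cases j; cases "of_nat (card I) :: bit") (auto simp: part_def split: if_splits)
  with R show ?thesis by (rule that)
qed

lemma parity_parts:
  assumes "\<alpha> \<in> carrier (stalk X x)"
  obtains \<alpha>\<^sub>0 \<alpha>\<^sub>1 where "\<alpha>\<^sub>0 \<in> homog (stalk X x) 0" "\<alpha>\<^sub>1 \<in> homog (stalk X x) 1"
    "\<alpha> = \<alpha>\<^sub>0 \<oplus>\<^bsub>stalk X x\<^esub> \<alpha>\<^sub>1"
proof -
  obtain W f where W: "openin (body X) W" "x \<in> W" "f \<in> carrier (sec X W)" "\<alpha> = germ X x W f"
    using stalk_cases[OF sheaf assms] by blast
  obtain g h where gh: "g \<in> homog (sec X W) 0" "h \<in> homog (sec X W) 1" "f = g \<oplus>\<^bsub>sec X W\<^esub> h"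
    using sec_parity_decomposition[OF sheaf W(1,3)] by blast
  then have "g \<in> carrier (sec X W)" "h \<in> carrier (sec X W)"
    using sec_homog_subset[OF sheaf W(1)] by blast+
  then have "\<alpha> = germ X x W g \<oplus>\<^bsub>stalk X x\<^esub> germ X x W h"
    using germ_add[OF sheaf W(1,2)] W(4) gh(3) by simp
  moreover have "germ X x W g \<in> homog (stalk X x) 0" "germ X x W h \<in> homog (stalk X x) 1"
    using W gh by (auto simp: stalk_def)
  ultimately show ?thesis using that by blast
qed

lemma homog_germ_represents:
  assumes "x \<in> Q" "\<alpha> \<in> homog (stalk X x) j"
  obtains V f where "represents x V f \<alpha>" "\<And>I y. f I y \<noteq> 0 \<Longrightarrow> of_nat (card I) = j"
proof -
  obtain W h where W: "openin (body X) W" "x \<in> W" "h \<in> homog (sec X W) j" "\<alpha> = germ X x W h"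
    using assms(2) by (auto simp: stalk_def)
  from homog_represents[OF W(1,2) assms(1) W(3)] that W(4) show ?thesis by metis
qed

lemma homog_germ_in_stalk: "x \<in> Q \<Longrightarrow> \<alpha> \<in> homog (stalk X x) j \<Longrightarrow> \<alpha> \<in> carrier (stalk X x)"
  using homog_germ_represents representsD(10) by metis

text \<open>The empty index set is even, so an odd coordinate expression has no body.\<close>

lemma odd_germ_value:
  assumes "x \<in> Q" "\<alpha> \<in> homog (stalk X x) 1"
  shows "germ_value X x \<alpha> = 0"
proof -
  obtain V f where R: "represents x V f \<alpha>" "\<And>I y. f I y \<noteq> 0 \<Longrightarrow> of_nat (card I) = (1::bit)"
    using homog_germ_represents[OF assms] by metis
  then show ?thesis using germ_value_eq[OF R(1)] R(2)[of "{}"] by fastforce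
qed

section \<open>The value as a unital homomorphism from the stalk to the reals\<close>

lemma germ_value_add:
  assumes "x \<in> Q" "\<alpha> \<in> carrier (stalk X x)" "\<beta> \<in> carrier (stalk X x)"
  shows "germ_value X x (\<alpha> \<oplus>\<^bsub>stalk X x\<^esub> \<beta>) = germ_value X x \<alpha> + germ_value X x \<beta>"
proof -
  obtain V f g where R: "represents x V f \<alpha>" "represents x V g \<beta>"
    using represents_ex2[OF assms] .
  show ?thesis using germ_value_eq R represents_add[OF R] by simp
qed

lemma germ_value_mult:
  assumes "x \<in> Q" "\<alpha> \<in> carrier (stalk X x)" "\<beta> \<in> carrier (stalk X x)"
  shows "germ_value X x (\<alpha> \<otimes>\<^bsub>stalk X x\<^esub> \<beta>) = germ_value X x \<alpha> * germ_value X x \<beta>"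
proof -
  obtain V f g where R: "represents x V f \<alpha>" "represents x V g \<beta>"
    using represents_ex2[OF assms] .
  show ?thesis using germ_value_eq[OF R(1)] germ_value_eq[OF R(2)] germ_value_eq[OF represents_mult[OF R]]
    by (simp add: superfun_mult_body)
qed

lemma germ_value_smult:
  assumes "x \<in> Q" "\<alpha> \<in> carrier (stalk X x)"
  shows "germ_value X x (c \<odot>\<^bsub>stalk X x\<^esub> \<alpha>) = c * germ_value X x \<alpha>"
proof -
  obtain V f where R: "represents x V f \<alpha>" using represents_ex[OF assms] .
  show ?thesis using germ_value_eq[OF R] germ_value_eq[OF represents_smult[OF R]] by simp
qed

lemma germ_value_one:
  assumes "x \<in> Q"
  shows "germ_value X x \<one>\<^bsub>stalk X x\<^esub> = 1"
  using germ_value_eq[OF represents_one[OF open_U order.refl]] assms over_U underlying_in_U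
  by (simp add: superfun_monomial_def)

lemma germ_value_nonzero_iff:
  assumes "x \<in> Q" "\<alpha> \<in> carrier (stalk X x)"
  shows "\<alpha> \<in> Units (stalk X x) \<longleftrightarrow> germ_value X x \<alpha> \<noteq> 0"
proof -
  obtain V f where R: "represents x V f \<alpha>" using represents_ex[OF assms] .
  show ?thesis using germ_value_eq[OF R] Units_stalk_iff[OF R] by simp
qed

text \<open>Only the first factor of a product is split by parity; for its odd part the term that
  carries the sign has the factor 0.\<close>

lemma homogeneous_tangent_derivation:
  assumes x: "x \<in> Q" and \<eta>: "\<eta> \<in> homogeneous_tangent X x j"
  shows "point_derivation X x \<eta>"
  unfolding point_derivation_def
proof (intro conjI allI ballI impI)
  note D = homogeneous_tangentD[OF \<eta>]
  fix \<alpha> \<beta> assume c: "\<alpha> \<in> carrier (stalk X x)" "\<beta> \<in> carrier (stalk X x)"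
  interpret S: ring "stalk X x" by (rule ring_stalk[OF sheaf]) (use x Q_subset in blast)
  obtain \<alpha>\<^sub>0 \<alpha>\<^sub>1 where h: "\<alpha>\<^sub>0 \<in> homog (stalk X x) 0" "\<alpha>\<^sub>1 \<in> homog (stalk X x) 1"
    "\<alpha> = \<alpha>\<^sub>0 \<oplus>\<^bsub>stalk X x\<^esub> \<alpha>\<^sub>1"
    using parity_parts[OF c(1)] .
  note h' = homog_germ_in_stalk[OF x h(1)] homog_germ_in_stalk[OF x h(2)]
  have "\<eta> (\<alpha> \<otimes>\<^bsub>stalk X x\<^esub> \<beta>) = \<eta> (\<alpha>\<^sub>0 \<otimes>\<^bsub>stalk X x\<^esub> \<beta>) + \<eta> (\<alpha>\<^sub>1 \<otimes>\<^bsub>stalk X x\<^esub> \<beta>)"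
    unfolding h(3) using c h' by (simp add: S.l_distr D(2))
  also have "\<dots> = (\<eta> \<alpha>\<^sub>0 + \<eta> \<alpha>\<^sub>1) * germ_value X x \<beta> + germ_value X x \<alpha>\<^sub>0 * \<eta> \<beta>"
    using D(4)[OF h(1) c(2)] D(4)[OF h(2) c(2)] odd_germ_value[OF x h(2)] by (simp add: algebra_simps)
  also have "\<dots> = \<eta> \<alpha> * germ_value X x \<beta> + germ_value X x \<alpha> * \<eta> \<beta>"
    unfolding h(3) using h' D(2) germ_value_add[OF x h'] odd_germ_value[OF x h(2)] by simp
  finally show "\<eta> (\<alpha> \<otimes>\<^bsub>stalk X x\<^esub> \<beta>) = \<eta> \<alpha> * germ_value X x \<beta> + germ_value X x \<alpha> * \<eta> \<beta>" .
qed (use homogeneous_tangentD[OF \<eta>] in auto)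

section \<open>Coordinate description of the tangent space\<close>

definition tangent_vec :: "'x \<Rightarrow> (nat \<Rightarrow> real) \<Rightarrow> ('x set \<times> 's) set \<Rightarrow> real" where
  "tangent_vec x v = (\<lambda>\<alpha>. if \<alpha> \<in> carrier (stalk X x) then \<Sum>k<a + b. v k * partial_at x k \<alpha> else 0)"

definition coord_germ :: "'x \<Rightarrow> nat \<Rightarrow> ('x set \<times> 's) set" where
  "coord_germ x k = germ X x Q (pull \<kappa> U (super_coord a U k))"

lemma represents_coord_germ:
  assumes "x \<in> Q" "k < a + b"
  shows "represents x U (super_coord a U k) (coord_germ x k)"
  using assms super_coord_carrier[OF open_U assms(2)] open_U
  by (simp add: represents_def coord_germ_def over_U)

lemma partial_at_coord_germ:
  assumes "x \<in> Q" "l < a + b"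
  shows "partial_at x k (coord_germ x l) = (if k = l then 1 else 0)"
  using partial_at_eq[OF represents_coord_germ[OF assms]]
    super_partial_coord[OF open_U underlying_in_U[OF assms(1)]] by simp

lemma tangent_vec_represents:
  assumes "represents x V f \<alpha>"
  shows "tangent_vec x v \<alpha> = (\<Sum>k<a + b. v k * super_partial a k f (underlying \<kappa> x))"
  using partial_at_eq[OF assms] representsD(10)[OF assms] by (simp add: tangent_vec_def)

lemma tangent_vec_derivation:
  assumes x: "x \<in> Q"
  shows "point_derivation X x (tangent_vec x v)"
  unfolding point_derivation_def
proof (intro conjI allI ballI impI)
  show "\<And>\<alpha>. \<alpha> \<notin> carrier (stalk X x) \<Longrightarrow> tangent_vec x v \<alpha> = 0" by (simp add: tangent_vec_def)
next
  fix \<alpha> \<beta> assume "\<alpha> \<in> carrier (stalk X x)" "\<beta> \<in> carrier (stalk X x)"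
  then obtain V f g where R: "represents x V f \<alpha>" "represents x V g \<beta>"
    using represents_ex2[OF x] by metis
  note Rf = representsD[OF R(1)] and Rg = representsD[OF R(2)]
  show "tangent_vec x v (\<alpha> \<oplus>\<^bsub>stalk X x\<^esub> \<beta>) = tangent_vec x v \<alpha> + tangent_vec x v \<beta>"
    unfolding tangent_vec_represents[OF R(1)] tangent_vec_represents[OF R(2)]
      tangent_vec_represents[OF represents_add[OF R]] super_partial_add[OF Rf(1,6,4) Rg(4)]
    by (simp add: algebra_simps sum.distrib)
  show "tangent_vec x v (\<alpha> \<otimes>\<^bsub>stalk X x\<^esub> \<beta>) =
      tangent_vec x v \<alpha> * germ_value X x \<beta> + germ_value X x \<alpha> * tangent_vec x v \<beta>"
    unfolding tangent_vec_represents[OF R(1)] tangent_vec_represents[OF R(2)]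
      tangent_vec_represents[OF represents_mult[OF R]] super_partial_mult[OF Rf(1,6,4) Rg(4)]
      germ_value_eq[OF R(1)] germ_value_eq[OF R(2)]
    by (simp add: algebra_simps sum.distrib sum_distrib_left)
next
  fix c \<alpha> assume "\<alpha> \<in> carrier (stalk X x)"
  then obtain V f where R: "represents x V f \<alpha>" using represents_ex[OF x] by metis
  note Rf = representsD[OF R]
  show "tangent_vec x v (c \<odot>\<^bsub>stalk X x\<^esub> \<alpha>) = c * tangent_vec x v \<alpha>"
    unfolding tangent_vec_represents[OF R]
      tangent_vec_represents[OF represents_smult[OF R]] super_partial_smult[OF Rf(1,6,4)]
    by (simp add: algebra_simps sum_distrib_left)
qed

text \<open>Even coordinates see only the body, which an odd germ lacks; odd coordinates see only
  coefficients of single thetas, which an even germ lacks.\<close>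

lemma tangent_vec_homogeneous:
  assumes x: "x \<in> Q" and v: "\<And>k. v k \<noteq> 0 \<Longrightarrow> (k < a) = (j = (0::bit))"
  shows "tangent_vec x v \<in> homogeneous_tangent X x j"
  unfolding homogeneous_tangent_def
proof (intro CollectI conjI allI ballI impI)
  note D = point_derivationD[OF tangent_vec_derivation[OF x, of v]]
  fix k \<alpha> \<beta> assume h: "\<alpha> \<in> homog (stalk X x) k" "\<beta> \<in> carrier (stalk X x)"
  have "k = 1 \<Longrightarrow> germ_value X x \<alpha> = 0" using odd_germ_value[OF x] h(1) by blast
  then show "tangent_vec x v (\<alpha> \<otimes>\<^bsub>stalk X x\<^esub> \<beta>) = tangent_vec x v \<alpha> * germ_value X x \<beta> +
      (if j = 1 \<and> k = 1 then - 1 else 1) * germ_value X x \<alpha> * tangent_vec x v \<beta>"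
    using D(4)[OF homog_germ_in_stalk[OF x h(1)] h(2)] by auto
next
  fix k \<alpha> assume k: "k \<noteq> j" and h: "\<alpha> \<in> homog (stalk X x) k"
  obtain V f where R: "represents x V f \<alpha>" "\<And>I y. f I y \<noteq> 0 \<Longrightarrow> of_nat (card I) = k"
    using homog_germ_represents[OF x h] by metis
  have "v l * super_partial a l f (underlying \<kappa> x) = 0" for l
  proof (cases "v l = 0")
    case False
    note vl = v[OF False]
    show ?thesis
    proof (cases "l < a")
      case True
      then have "k \<noteq> 0" using vl k by simp
      then have "f {} = (\<lambda>y. 0)" using R(2)[of "{}"] by fastforce
      then show ?thesis using True by (simp add: super_partial_def)
    next
      case False
      then have "k \<noteq> 1" using vl k by (metis (full_types) bit.exhaust)
      then have "f {l - a} y = 0" for y using R(2)[of "{l - a}"] by fastforce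
      then show ?thesis using False by (simp add: super_partial_def)
    qed
  qed simp
  then show "tangent_vec x v \<alpha> = 0"
    unfolding tangent_vec_represents[OF R(1)] by (intro sum.neutral ballI)
qed (use point_derivationD[OF tangent_vec_derivation[OF x, of v]] in auto)

lemma tangent_vec_tangent:
  assumes x: "x \<in> Q"
  shows "tangent_vec x v \<in> tangent_space X x"
proof -
  let ?e = "\<lambda>k. if k < a then v k else 0" and ?o = "\<lambda>k. if k < a then 0 else v k"
  have "tangent_vec x v = (\<lambda>\<alpha>. tangent_vec x ?e \<alpha> + tangent_vec x ?o \<alpha>)"
  proof
    fix \<alpha>
    have "(\<Sum>k<a + b. v k * partial_at x k \<alpha>) =
        (\<Sum>k<a + b. ?e k * partial_at x k \<alpha> + ?o k * partial_at x k \<alpha>)"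
      by (intro sum.cong) auto
    then show "tangent_vec x v \<alpha> = tangent_vec x ?e \<alpha> + tangent_vec x ?o \<alpha>"
      by (simp add: tangent_vec_def sum.distrib)
  qed
  moreover have "tangent_vec x ?e \<in> homogeneous_tangent X x 0"
    "tangent_vec x ?o \<in> homogeneous_tangent X x 1"
    by (rule tangent_vec_homogeneous[OF x], simp split: if_splits)+
  ultimately show ?thesis unfolding tangent_space_def by blast
qed

text \<open>The derivation is transported to superfunctions on a cube that expresses the given germ.
  The coordinates of the cube are restrictions of those of the chart, so the coefficients do not
  depend on the germ.\<close>

lemma point_derivation_eq_tangent_vec:
  assumes x: "x \<in> Q" and D: "point_derivation X x D"
  shows "D = tangent_vec x (\<lambda>k. D (coord_germ x k))"
proof
  note d = point_derivationD[OF D]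
  fix \<alpha> show "D \<alpha> = tangent_vec x (\<lambda>k. D (coord_germ x k)) \<alpha>"
  proof (cases "\<alpha> \<in> carrier (stalk X x)")
    case True
    let ?u = "underlying \<kappa> x"
    obtain r f where r: "r > 0" "represents x (cube a ?u r) f \<alpha>" using represents_cube[OF x True] .
    let ?V = "cube a ?u r"
    let ?g = "\<lambda>f. germ X x (over ?V) (pull \<kappa> ?V f)"
    note R = representsD[OF r(2)]
    have rep: "represents x ?V f (?g f)" if "f \<in> superfun_carrier a b ?V" for f
      using that R by (simp add: represents_def)
    note eq = representsD(5) and c = representsD(10)[OF rep]
    have u: "?u \<in> topspace (Euclidean_space a)"
      using underlying_in_U[OF x] openin_subset[OF open_U] by blast
    have "D (?g f) = (\<Sum>k<a + b. D (?g (super_coord a ?V k)) * super_partial a k f ?u)"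
    proof (rule superfun_derivation_formula[OF u r(1) refl])
      fix f g assume fg: "f \<in> superfun_carrier a b ?V" "g \<in> superfun_carrier a b ?V"
      note R2 = rep[OF fg(1)] rep[OF fg(2)]
      show "D (?g (\<lambda>I x. f I x + g I x)) = D (?g f) + D (?g g)"
        using d(2)[OF c[OF fg(1)] c[OF fg(2)]] eq[OF represents_add[OF R2]] by simp
      show "D (?g (superfun_mult f g)) = D (?g f) * g {} ?u + f {} ?u * D (?g g)"
        using d(4)[OF c[OF fg(1)] c[OF fg(2)]] eq[OF represents_mult[OF R2]]
          germ_value_eq[OF R2(1)] germ_value_eq[OF R2(2)] by simp
    next
      fix k f assume f: "f \<in> superfun_carrier a b ?V"
      show "D (?g (\<lambda>I x. k * f I x)) = k * D (?g f)"
        using d(3)[OF c[OF f]] eq[OF represents_smult[OF rep[OF f]]] by simp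
    qed (rule R(4))
    moreover have "?g (super_coord a ?V k) = coord_germ x k" if "k < a + b" for k
      using representsD(5)[OF represents_restrict[OF represents_coord_germ[OF x that] R(1,2,6)]]
        super_coord_restrict[OF R(2)] by simp
    ultimately show ?thesis
      unfolding tangent_vec_represents[OF r(2)] using R(5) by simp
  qed (simp add: d(1) tangent_vec_def)
qed

lemma tangent_space_eq:
  assumes x: "x \<in> Q"
  shows "tangent_space X x = {D. point_derivation X x D}"
proof (intro subset_antisym subsetI CollectI)
  fix D assume "D \<in> tangent_space X x"
  then obtain \<eta> \<zeta> where "\<eta> \<in> homogeneous_tangent X x 0" "\<zeta> \<in> homogeneous_tangent X x 1"
      "D = (\<lambda>\<alpha>. \<eta> \<alpha> + \<zeta> \<alpha>)"
    unfolding tangent_space_def by blast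
  then show "point_derivation X x D"
    by (simp add: point_derivation_add homogeneous_tangent_derivation[OF x])
next
  fix D assume "D \<in> {D. point_derivation X x D}"
  then show "D \<in> tangent_space X x"
    using point_derivation_eq_tangent_vec[OF x] tangent_vec_tangent[OF x] by (metis mem_Collect_eq)
qed

end

text \<open>One superfunction expresses the germs of a section at all nearby points. This lets the
  base point move, both for continuity of Jacobians and for the local constancy in
  \<open>derivation_stalk_pull_const\<close>.\<close>

lemma (in super_chart) represents_nearby:
  assumes "represents x V f (germ X x W s)" "openin (body X) W" "x \<in> W" "s \<in> carrier (sec X W)"
  obtains N where "openin (body X) N" "x \<in> N" "N \<subseteq> over V \<inter> W"
    "\<And>x'. x' \<in> N \<Longrightarrow> represents x' V f (germ X x' W s)"
proof -
  note R = representsD[OF assms(1)]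
  obtain N where N: "openin (body X) N" "x \<in> N" "N \<subseteq> over V \<inter> W"
      "res X (over V) N (pull \<kappa> V f) = res X W N s"
    using germ_eqD[OF sheaf R(5)[symmetric] R(8) assms(2,3) R(9) assms(4)] .
  have "represents x' V f (germ X x' W s)" if "x' \<in> N" for x'
    using R N that germ_eqI[OF sheaf assms(2) R(8) N(1) that _ assms(4) R(9)]
    by (auto simp: represents_def)
  with N that show ?thesis by blast
qed

section \<open>Morphisms on stalks\<close>

text \<open>Nonnegative reals are squares, so the map is monotone; it fixes the rationals, which are
  dense. This replaces real linearity of morphisms.\<close>

lemma real_ring_endomorphism_id:
  fixes h :: "real \<Rightarrow> real"
  assumes add: "\<And>x y. h (x + y) = h x + h y" and mult: "\<And>x y. h (x * y) = h x * h y"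
    and one: "h 1 = 1"
  shows "h x = x"
proof -
  have nonneg: "h x \<ge> 0" if "x \<ge> 0" for x
    using mult[of "sqrt x" "sqrt x"] that by simp
  have zero: "h 0 = 0" using add[of 0 0] by simp
  have minus: "h (- x) = - h x" for x using add[of x "- x"] zero by simp
  have mono: "h x \<le> h y" if "x \<le> y" for x y
    using nonneg[of "y - x"] add[of x "y - x"] that by simp
  have nat: "h (of_nat n) = of_nat n" for n by (induction n) (simp_all add: zero one add)
  have int: "h (of_int k) = of_int k" for k
    by (cases k rule: int_diff_cases) (simp add: nat add[of _ "- _", simplified] minus)
  have rat: "h q = q" if "q \<in> \<rat>" for q
  proof -
    obtain k l where kl: "q = of_int k / of_int l" "l \<noteq> 0"
      using \<open>q \<in> \<rat>\<close> by (metis Rats_cases' less_irrefl)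
    then have "h (q * of_int l) = q * of_int l" using int by simp
    with kl(2) show ?thesis by (simp add: mult int)
  qed
  show ?thesis
  proof (rule antisym; rule ccontr)
    assume "\<not> h x \<le> x"
    then obtain q where q: "x < q" "q < h x" "q \<in> \<rat>" using Rats_dense_in_real[of x "h x"] by auto
    then show False using mono[of x q] rat[of q] by simp
  next
    assume "\<not> x \<le> h x"
    then obtain q where q: "h x < q" "q < x" "q \<in> \<rat>" using Rats_dense_in_real[of "h x" x] by auto
    then show False using mono[of q x] rat[of q] by simp
  qed
qed

section \<open>The map of stalks induced by a morphism\<close>

context
  fixes X :: "('x, 's) superspace" and Y :: "('y, 't) superspace"
    and \<phi> :: "('x, 's, 'y, 't) supermap"
  assumes X: "super_ringed_space X" and Y: "super_ringed_space Y" and \<phi>: "is_morphism X Y \<phi>"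
begin

lemma openin_preim: "openin (body Y) V \<Longrightarrow> openin (body X) (preim X \<phi> V)"
  using openin_continuous_map_preimage[OF \<phi>[unfolded is_morphism_def, THEN conjunct1]]
  by (simp add: preim_def)

lemma morphism_hom:
  "openin (body Y) V \<Longrightarrow> pull \<phi> V \<in> superring_hom (sec Y V) (sec X (preim X \<phi> V))"
  by (rule \<phi>[unfolded is_morphism_def, THEN conjunct2, THEN conjunct1, rule_format])

lemmas morphism_simps = superring_homD[OF morphism_hom]

lemma res_morphism:
  "openin (body Y) V \<Longrightarrow> openin (body Y) W \<Longrightarrow> W \<subseteq> V \<Longrightarrow> g \<in> carrier (sec Y V) \<Longrightarrow>
    res X (preim X \<phi> V) (preim X \<phi> W) (pull \<phi> V g) = pull \<phi> W (res Y V W g)"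
  by (rule \<phi>[unfolded is_morphism_def, THEN conjunct2, THEN conjunct2, rule_format]) auto

text \<open>Pullback commutes with restriction, so all representatives of a germ have the same
  pulled-back germ and the union in \<open>stalk_pull\<close> collapses to it.\<close>

lemma stalk_pull_germ:
  assumes x: "x \<in> topspace (body X)" and V: "openin (body Y) V" "underlying \<phi> x \<in> V"
    and g: "g \<in> carrier (sec Y V)"
  shows "stalk_pull X \<phi> x (germ Y (underlying \<phi> x) V g) = germ X x (preim X \<phi> V) (pull \<phi> V g)"
proof -
  let ?y = "underlying \<phi> x"
  have *: "germ X x (preim X \<phi> V') (pull \<phi> V' g') = germ X x (preim X \<phi> V) (pull \<phi> V g)"
    if m: "(V', g') \<in> germ Y ?y V g" for V' g'
  proof -
    obtain W where W: "openin (body Y) W" "?y \<in> W" "W \<subseteq> V \<inter> V'" "res Y V W g = res Y V' W g'"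
      using m by (rule mem_germE[OF Y])
    note V' = mem_germD[OF Y m V(1) g]
    show ?thesis
    proof (rule germ_eqI[OF X openin_preim[OF V'(1)] openin_preim[OF V(1)] openin_preim[OF W(1)]])
      show "x \<in> preim X \<phi> W" "preim X \<phi> W \<subseteq> preim X \<phi> V' \<inter> preim X \<phi> V"
        using x W by (auto simp: preim_def)
      show "res X (preim X \<phi> V') (preim X \<phi> W) (pull \<phi> V' g') =
          res X (preim X \<phi> V) (preim X \<phi> W) (pull \<phi> V g)"
        using res_morphism[OF V'(1) W(1) _ V'(3)] res_morphism[OF V(1) W(1) _ g] W by auto
    qed (use morphism_simps(1) V V' g in auto)
  qed
  have ex: "(V, g) \<in> germ Y ?y V g" by (rule mem_germ_self[OF Y V g])
  show ?thesis
    unfolding stalk_pull_def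
  proof (intro subset_antisym subsetI)
    fix z assume "z \<in> germ X x (preim X \<phi> V) (pull \<phi> V g)"
    then show "z \<in> (\<Union>(V, g)\<in>germ Y ?y V g. germ X x (preim X \<phi> V) (pull \<phi> V g))"
      by (intro UN_I[OF ex]) simp
  qed (use * in blast)
qed

lemma in_preim: "x \<in> topspace (body X) \<Longrightarrow> underlying \<phi> x \<in> V \<Longrightarrow> x \<in> preim X \<phi> V"
  by (simp add: preim_def)

context
  fixes x assumes x: "x \<in> topspace (body X)"
begin

lemma stalk_pull_carrier:
  assumes "\<beta> \<in> carrier (stalk Y (underlying \<phi> x))"
  shows "stalk_pull X \<phi> x \<beta> \<in> carrier (stalk X x)"
proof -
  obtain V g where V: "openin (body Y) V" "underlying \<phi> x \<in> V" "g \<in> carrier (sec Y V)"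
      "\<beta> = germ Y (underlying \<phi> x) V g"
    using stalk_cases[OF Y assms] .
  show ?thesis
    unfolding V(4) stalk_pull_germ[OF x V(1-3)]
    by (rule germ_in_stalk[OF X openin_preim[OF V(1)] in_preim[OF x V(2)] morphism_simps(1)[OF V(1,3)]])
qed

lemma stalk_pull_add:
  assumes "\<beta> \<in> carrier (stalk Y (underlying \<phi> x))" "\<gamma> \<in> carrier (stalk Y (underlying \<phi> x))"
  shows "stalk_pull X \<phi> x (\<beta> \<oplus>\<^bsub>stalk Y (underlying \<phi> x)\<^esub> \<gamma>) =
    stalk_pull X \<phi> x \<beta> \<oplus>\<^bsub>stalk X x\<^esub> stalk_pull X \<phi> x \<gamma>"
proof -
  obtain V g h where V: "openin (body Y) V" "underlying \<phi> x \<in> V" "g \<in> carrier (sec Y V)"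
      "h \<in> carrier (sec Y V)" "\<beta> = germ Y (underlying \<phi> x) V g" "\<gamma> = germ Y (underlying \<phi> x) V h"
    using stalk_cases2[OF Y assms] .
  show ?thesis
    unfolding V(5,6) germ_add[OF Y V(1-4)] stalk_pull_germ[OF x V(1-3)] stalk_pull_germ[OF x V(1,2,4)]
      stalk_pull_germ[OF x V(1,2) ring.ring_simprules(1)[OF sec_ring[OF Y V(1)] V(3,4)]]
      morphism_simps(3)[OF V(1,3,4)]
    by (rule germ_add[symmetric, OF X openin_preim[OF V(1)] in_preim[OF x V(2)]
          morphism_simps(1)[OF V(1,3)] morphism_simps(1)[OF V(1,4)]])
qed

lemma stalk_pull_mult:
  assumes "\<beta> \<in> carrier (stalk Y (underlying \<phi> x))" "\<gamma> \<in> carrier (stalk Y (underlying \<phi> x))"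
  shows "stalk_pull X \<phi> x (\<beta> \<otimes>\<^bsub>stalk Y (underlying \<phi> x)\<^esub> \<gamma>) =
    stalk_pull X \<phi> x \<beta> \<otimes>\<^bsub>stalk X x\<^esub> stalk_pull X \<phi> x \<gamma>"
proof -
  obtain V g h where V: "openin (body Y) V" "underlying \<phi> x \<in> V" "g \<in> carrier (sec Y V)"
      "h \<in> carrier (sec Y V)" "\<beta> = germ Y (underlying \<phi> x) V g" "\<gamma> = germ Y (underlying \<phi> x) V h"
    using stalk_cases2[OF Y assms] .
  show ?thesis
    unfolding V(5,6) germ_mult[OF Y V(1-4)] stalk_pull_germ[OF x V(1-3)] stalk_pull_germ[OF x V(1,2,4)]
      stalk_pull_germ[OF x V(1,2) ring.ring_simprules(5)[OF sec_ring[OF Y V(1)] V(3,4)]]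
      morphism_simps(2)[OF V(1,3,4)]
    by (rule germ_mult[symmetric, OF X openin_preim[OF V(1)] in_preim[OF x V(2)]
          morphism_simps(1)[OF V(1,3)] morphism_simps(1)[OF V(1,4)]])
qed

lemma underlying_in_topspace: "underlying \<phi> x \<in> topspace (body Y)"
  using \<phi>[unfolded is_morphism_def, THEN conjunct1] x by (auto simp: continuous_map_def)

lemma stalk_pull_one:
  "stalk_pull X \<phi> x \<one>\<^bsub>stalk Y (underlying \<phi> x)\<^esub> = \<one>\<^bsub>stalk X x\<^esub>"
proof -
  note V = openin_topspace[of "body Y"] underlying_in_topspace
  show ?thesis
    unfolding germ_one[OF Y V]
      stalk_pull_germ[OF x V ring.ring_simprules(6)[OF sec_ring[OF Y V(1)]]] morphism_simps(4)[OF V(1)]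
    by (rule germ_one[symmetric, OF X openin_preim[OF V(1)] in_preim[OF x V(2)]])
qed

end

end

text \<open>The morphism need not map \<open>Q\<close> into \<open>Q'\<close>. The results instead
  require \<open>underlying \<phi> x \<in> Q'\<close> at the points concerned, so charts never have
  to be shrunk.\<close>

locale chart_morphism =
  src: super_chart a b X Q U \<kappa> + tgt: super_chart c d Y Q' U' \<kappa>'
  for a b and X :: "('x, 's) superspace" and Q U \<kappa>
    and c d and Y :: "('y, 't) superspace" and Q' U' \<kappa>' +
  fixes \<phi> :: "('x, 's, 'y, 't) supermap"
  assumes morphism: "is_morphism X Y \<phi>"
begin

lemma in_topspace: "x \<in> Q \<Longrightarrow> x \<in> topspace (body X)"
  using src.Q_subset by blast

lemma const_in_stalk:
  assumes "y \<in> Q'"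
  shows "r \<odot>\<^bsub>stalk Y y\<^esub> \<one>\<^bsub>stalk Y y\<^esub> \<in> carrier (stalk Y y)"
  by (rule tgt.representsD(10)[OF tgt.represents_smult[OF tgt.represents_one[OF tgt.open_U order.refl]]])
    (use assms tgt.over_U in auto)

text \<open>As a function of \<open>r\<close> the left-hand side is a unital ring endomorphism of
  the reals, hence the identity.\<close>

lemma germ_value_stalk_pull_const:
  assumes "x \<in> Q" "underlying \<phi> x \<in> Q'"
  shows "germ_value X x (stalk_pull X \<phi> x
    (r \<odot>\<^bsub>stalk Y (underlying \<phi> x)\<^esub> \<one>\<^bsub>stalk Y (underlying \<phi> x)\<^esub>)) = r"
proof (rule real_ring_endomorphism_id)
  let ?y = "underlying \<phi> x"
  let ?S = "stalk Y ?y"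
  let ?k = "\<lambda>r. r \<odot>\<^bsub>?S\<^esub> \<one>\<^bsub>?S\<^esub>"
  let ?h = "\<lambda>r. germ_value X x (stalk_pull X \<phi> x (?k r))"
  note M = src.sheaf tgt.sheaf morphism in_topspace[OF assms(1)]
  note pull = stalk_pull_carrier[OF M const_in_stalk[OF assms(2)]]
  have one: "tgt.represents ?y U' (superfun_monomial U' {} (\<lambda>x. 1)) \<one>\<^bsub>?S\<^esub>"
    by (rule tgt.represents_one[OF tgt.open_U order.refl]) (use assms tgt.over_U in auto)
  have k: "tgt.represents ?y U' (\<lambda>I y. r * superfun_monomial U' {} (\<lambda>x. 1) I y) (?k r)" for r
    by (rule tgt.represents_smult[OF one])
  note rep_eq = tgt.representsD(5)
  fix r s :: real
  have "?k (r + s) = ?k r \<oplus>\<^bsub>?S\<^esub> ?k s"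
    using rep_eq[OF k[of "r + s"]] rep_eq[OF tgt.represents_add[OF k k], of r s]
    by (simp add: distrib_right)
  then show "?h (r + s) = ?h r + ?h s"
    using stalk_pull_add[OF M const_in_stalk const_in_stalk, OF assms(2) assms(2)]
      src.germ_value_add[OF assms(1) pull pull] by simp
  have "superfun_mult (\<lambda>I y. r * superfun_monomial U' {} (\<lambda>x. 1) I y)
      (\<lambda>I y. s * superfun_monomial U' {} (\<lambda>x. 1) I y) =
      (\<lambda>I y. (r * s) * superfun_monomial U' {} (\<lambda>x. 1) I y)"
  proof -
    have *: "(\<lambda>I y. r * superfun_monomial U' {} (\<lambda>x. 1) I y) = superfun_monomial U' {} (\<lambda>x. r)" for r
      by (simp add: superfun_monomial_def fun_eq_iff)
    show ?thesis unfolding * by (simp add: superfun_mult_monomials)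
  qed
  then have "?k (r * s) = ?k r \<otimes>\<^bsub>?S\<^esub> ?k s"
    using rep_eq[OF k[of "r * s"]] rep_eq[OF tgt.represents_mult[OF k k], of r s] by simp
  then show "?h (r * s) = ?h r * ?h s"
    using stalk_pull_mult[OF M const_in_stalk const_in_stalk, OF assms(2) assms(2)]
      src.germ_value_mult[OF assms(1) pull pull] by simp
  have "?k 1 = \<one>\<^bsub>?S\<^esub>" using rep_eq[OF k[of 1]] rep_eq[OF one] by simp
  then show "?h 1 = 1" using stalk_pull_one[OF M] src.germ_value_one[OF assms(1)] by simp
qed

text \<open>
  If the value of \<open>\<beta>\<close> differed from the value \<open>v\<close> of its pullback, then \<open>\<beta> - v\<close> would be a unit
  whose pullback has value \<open>0\<close>.
\<close>

lemma germ_value_stalk_pull: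
  assumes "x \<in> Q" "underlying \<phi> x \<in> Q'" and \<beta>: "\<beta> \<in> carrier (stalk Y (underlying \<phi> x))"
  shows "germ_value X x (stalk_pull X \<phi> x \<beta>) = germ_value Y (underlying \<phi> x) \<beta>"
proof (rule ccontr)
  let ?y = "underlying \<phi> x"
  let ?S = "stalk Y ?y"
  let ?v = "germ_value X x (stalk_pull X \<phi> x \<beta>)"
  let ?k = "(- ?v) \<odot>\<^bsub>?S\<^esub> \<one>\<^bsub>?S\<^esub>"
  let ?\<gamma> = "\<beta> \<oplus>\<^bsub>?S\<^esub> ?k"
  note M = src.sheaf tgt.sheaf morphism in_topspace[OF assms(1)]
  interpret S: ring ?S by (rule ring_stalk[OF tgt.sheaf]) (use assms tgt.Q_subset in blast)
  have k: "?k \<in> carrier ?S" by (rule const_in_stalk[OF assms(2)])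
  have \<gamma>: "?\<gamma> \<in> carrier ?S" using \<beta> k by simp
  assume "?v \<noteq> germ_value Y ?y \<beta>"
  then have "germ_value Y ?y ?\<gamma> \<noteq> 0"
    using tgt.germ_value_add[OF assms(2) \<beta> k] tgt.germ_value_smult[OF assms(2) S.one_closed]
      tgt.germ_value_one[OF assms(2)] by simp
  then have "?\<gamma> \<in> Units ?S" using tgt.germ_value_nonzero_iff[OF assms(2) \<gamma>] by simp
  then obtain \<delta> where \<delta>: "\<delta> \<in> carrier ?S" "?\<gamma> \<otimes>\<^bsub>?S\<^esub> \<delta> = \<one>\<^bsub>?S\<^esub>"
    by (auto simp: Units_def)
  have "stalk_pull X \<phi> x ?\<gamma> \<otimes>\<^bsub>stalk X x\<^esub> stalk_pull X \<phi> x \<delta> = \<one>\<^bsub>stalk X x\<^esub>"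
    using stalk_pull_mult[OF M \<gamma> \<delta>(1)] \<delta>(2) stalk_pull_one[OF M] by simp
  then have "germ_value X x (stalk_pull X \<phi> x ?\<gamma>) * germ_value X x (stalk_pull X \<phi> x \<delta>) = 1"
    using src.germ_value_mult[OF assms(1) stalk_pull_carrier[OF M \<gamma>] stalk_pull_carrier[OF M \<delta>(1)]]
      src.germ_value_one[OF assms(1)] by simp
  moreover have "germ_value X x (stalk_pull X \<phi> x ?\<gamma>) = ?v + (- ?v)"
    unfolding stalk_pull_add[OF M \<beta> k]
      src.germ_value_add[OF assms(1) stalk_pull_carrier[OF M \<beta>] stalk_pull_carrier[OF M k]]
      germ_value_stalk_pull_const[OF assms(1,2)] ..
  ultimately show False by simp
qed

text \<open>
  A pulled-back constant is the same constant plus a nilpotent even section, which lies in the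
  square of the maximal ideal; hence derivations kill it although \<open>\<phi>\<close> need not be real linear.
\<close>

lemma derivation_stalk_pull_const:
  assumes x: "x \<in> Q" and y: "underlying \<phi> x \<in> Q'" and D: "point_derivation X x D"
  shows "D (stalk_pull X \<phi> x
    (r \<odot>\<^bsub>stalk Y (underlying \<phi> x)\<^esub> \<one>\<^bsub>stalk Y (underlying \<phi> x)\<^esub>)) = 0"
proof -
  note M = src.sheaf tgt.sheaf morphism
  let ?A = "sec Y Q'"
  let ?k = "r \<odot>\<^bsub>?A\<^esub> \<one>\<^bsub>?A\<^esub>"
  let ?W = "preim X \<phi> Q'"
  let ?s = "pull \<phi> Q' ?k"
  note oQ = tgt.open_Q
  have oW: "openin (body X) ?W" by (rule openin_preim[OF M oQ])
  have one: "\<one>\<^bsub>?A\<^esub> \<in> carrier ?A" by (rule ring.ring_simprules(6)[OF sec_ring[OF tgt.sheaf oQ]])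
  have k: "?k \<in> carrier ?A" by (rule sec_smult_closed[OF tgt.sheaf oQ one])
  have s: "?s \<in> carrier (sec X ?W)" by (rule morphism_simps(1)[OF M oQ k])
  have s_even: "?s \<in> homog (sec X ?W) 0"
    by (intro morphism_simps(5)[OF M oQ] sec_smult_homog[OF tgt.sheaf oQ] sec_one_homog[OF tgt.sheaf oQ])
  have germ_s: "stalk_pull X \<phi> x' (r \<odot>\<^bsub>stalk Y (underlying \<phi> x')\<^esub> \<one>\<^bsub>stalk Y (underlying \<phi> x')\<^esub>) =
      germ X x' ?W ?s" if "x' \<in> Q" "underlying \<phi> x' \<in> Q'" for x'
    unfolding germ_one[OF tgt.sheaf oQ that(2)] germ_smult[OF tgt.sheaf oQ that(2) one]
    by (rule stalk_pull_germ[OF M in_topspace[OF that(1)] oQ that(2) k])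
  have xW: "x \<in> ?W" by (rule in_preim[OF M in_topspace[OF x] y])
  obtain V f where f: "src.represents x V f (germ X x ?W ?s)" "\<And>I y. f I y \<noteq> 0 \<Longrightarrow> of_nat (card I) = (0::bit)"
    using src.homog_represents[OF oW xW x s_even] by metis
  obtain N where N: "openin (body X) N" "x \<in> N" "N \<subseteq> src.over V \<inter> ?W"
      "\<And>x'. x' \<in> N \<Longrightarrow> src.represents x' V f (germ X x' ?W ?s)"
    by (rule src.represents_nearby[OF f(1) oW xW s]) blast
  have NQ: "N \<subseteq> Q" using N(3) by (auto simp: src.over_iff)
  note I = src.open_image[OF N(1) NQ]
  \<comment> \<open>The value is \<open>r\<close> at every point of \<open>N\<close>, not only at
    \<open>x\<close>; so the body of \<open>f\<close> is locally constant and its partial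
    derivatives vanish.\<close>
  have const: "f {} z = r" if "z \<in> underlying \<kappa> ` N" for z
  proof -
    obtain x' where x': "x' \<in> N" "z = underlying \<kappa> x'" using \<open>z \<in> underlying \<kappa> ` N\<close> by blast
    have *: "x' \<in> Q" "underlying \<phi> x' \<in> Q'" using NQ N(3) x'(1) by (auto simp: preim_def)
    show ?thesis
      using src.germ_value_eq[OF N(4)[OF x'(1)]] germ_value_stalk_pull_const[OF *, of r]
      unfolding germ_s[OF *] x'(2) by simp
  qed
  have "super_partial a k f (underlying \<kappa> x) = 0" for k
  proof (cases "k < a")
    case True
    have "partial_deriv k (f {}) (underlying \<kappa> x) = partial_deriv k (\<lambda>z. r) (underlying \<kappa> x)"
      by (rule partial_deriv_cong[OF I(1) _ _ True]) (use const N(2) in auto)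
    then show ?thesis using True by (simp add: super_partial_def)
  next
    case False
    \<comment> \<open>A singleton has odd cardinality, whereas \<open>f\<close> has only even index
      sets.\<close>
    then show ?thesis using f(2)[of "{k - a}"] by (fastforce simp: super_partial_def)
  qed
  then have "src.tangent_vec x v (germ X x ?W ?s) = 0" for v
    unfolding src.tangent_vec_represents[OF f(1)] by simp
  then show ?thesis
    unfolding germ_s[OF x y] using src.point_derivation_eq_tangent_vec[OF x D] by metis
qed

text \<open>The Leibniz rule survives because pullback preserves values. Homogeneity is then a
  consequence: scaling by \<open>r\<close> is multiplication by a constant germ of value
  \<open>r\<close>, whose pullback \<open>D\<close> kills.\<close>

lemma differential_derivation:
  assumes x: "x \<in> Q" and y: "underlying \<phi> x \<in> Q'" and D: "point_derivation X x D"
  shows "point_derivation Y (underlying \<phi> x) (differential X Y \<phi> x D)"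
  unfolding point_derivation_def
proof (intro conjI allI ballI impI)
  let ?y = "underlying \<phi> x"
  let ?S = "stalk Y ?y"
  note M = src.sheaf tgt.sheaf morphism in_topspace[OF x]
  note d = point_derivationD[OF D]
  interpret S: ring ?S by (rule ring_stalk[OF tgt.sheaf]) (use y tgt.Q_subset in blast)
  show "\<And>\<beta>. \<beta> \<notin> carrier ?S \<Longrightarrow> differential X Y \<phi> x D \<beta> = 0" by (simp add: differential_def)
  have mult: "differential X Y \<phi> x D (\<beta> \<otimes>\<^bsub>?S\<^esub> \<gamma>) = differential X Y \<phi> x D \<beta> * germ_value Y ?y \<gamma> +
      germ_value Y ?y \<beta> * differential X Y \<phi> x D \<gamma>"
    if c: "\<beta> \<in> carrier ?S" "\<gamma> \<in> carrier ?S" for \<beta> \<gamma>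
    using c d(4)[OF stalk_pull_carrier[OF M c(1)] stalk_pull_carrier[OF M c(2)]]
      stalk_pull_mult[OF M c] germ_value_stalk_pull[OF x y] by (simp add: differential_def)
  fix \<beta> assume \<beta>: "\<beta> \<in> carrier ?S"
  {
    fix \<gamma> assume \<gamma>: "\<gamma> \<in> carrier ?S"
    show "differential X Y \<phi> x D (\<beta> \<oplus>\<^bsub>?S\<^esub> \<gamma>) = differential X Y \<phi> x D \<beta> + differential X Y \<phi> x D \<gamma>"
      using \<beta> \<gamma> d(2)[OF stalk_pull_carrier[OF M \<beta>] stalk_pull_carrier[OF M \<gamma>]]
        stalk_pull_add[OF M \<beta> \<gamma>] by (simp add: differential_def)
    show "differential X Y \<phi> x D (\<beta> \<otimes>\<^bsub>?S\<^esub> \<gamma>) = differential X Y \<phi> x D \<beta> * germ_value Y ?y \<gamma> +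
        germ_value Y ?y \<beta> * differential X Y \<phi> x D \<gamma>"
      by (rule mult[OF \<beta> \<gamma>])
  }
  fix r
  let ?k = "r \<odot>\<^bsub>?S\<^esub> \<one>\<^bsub>?S\<^esub>"
  have k: "?k \<in> carrier ?S" by (rule const_in_stalk[OF y])
  obtain V g where V: "openin (body Y) V" "?y \<in> V" "g \<in> carrier (sec Y V)" "\<beta> = germ Y ?y V g"
    using stalk_cases[OF tgt.sheaf \<beta>] .
  interpret A: ring "sec Y V" by (rule sec_ring[OF tgt.sheaf V(1)])
  have "?k \<otimes>\<^bsub>?S\<^esub> \<beta> = r \<odot>\<^bsub>?S\<^esub> \<beta>"
    unfolding V(4) germ_one[OF tgt.sheaf V(1,2)] germ_smult[OF tgt.sheaf V(1,2) A.one_closed]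
      germ_smult[OF tgt.sheaf V(1-3)]
      germ_mult[OF tgt.sheaf V(1,2) sec_smult_closed[OF tgt.sheaf V(1) A.one_closed] V(3)]
      sec_smult_mult[OF tgt.sheaf V(1) A.one_closed V(3)]
    using V(3) by simp
  moreover have "differential X Y \<phi> x D ?k = 0"
    using derivation_stalk_pull_const[OF x y D] k by (simp add: differential_def)
  moreover have "germ_value Y ?y ?k = r"
    using tgt.germ_value_smult[OF y S.one_closed] tgt.germ_value_one[OF y] by simp
  ultimately show "differential X Y \<phi> x D (r \<odot>\<^bsub>?S\<^esub> \<beta>) = r * differential X Y \<phi> x D \<beta>"
    using mult[OF k \<beta>] by simp
qed

text \<open>The first index is the source coordinate, the second the target coordinate:
  \<open>jacobian x k\<close> is the image of the k-th coordinate vector, a column in the usual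
  convention. Coefficient vectors therefore multiply from the left.\<close>

definition jacobian :: "'x \<Rightarrow> nat \<Rightarrow> nat \<Rightarrow> real" where
  "jacobian x k j = src.partial_at x k (stalk_pull X \<phi> x (tgt.coord_germ (underlying \<phi> x) j))"

lemma differential_coord_germ:
  assumes "x \<in> Q" "underlying \<phi> x \<in> Q'" "j < c + d"
  shows "differential X Y \<phi> x (src.tangent_vec x v) (tgt.coord_germ (underlying \<phi> x) j) =
    (\<Sum>k<a + b. v k * jacobian x k j)"
  using tgt.representsD(10)[OF tgt.represents_coord_germ[OF assms(2,3)]]
    stalk_pull_carrier[OF src.sheaf tgt.sheaf morphism in_topspace[OF assms(1)]]
  by (simp add: differential_def src.tangent_vec_def jacobian_def)

text \<open>A derivation is determined by its values on the coordinate germs, and on those the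
  differential acts through the Jacobian.\<close>

lemma differential_image_tangent_space:
  assumes "x \<in> Q" "underlying \<phi> x \<in> Q'"
  shows "differential X Y \<phi> x ` tangent_space X x =
    range (\<lambda>v. tgt.tangent_vec (underlying \<phi> x) (\<lambda>j. \<Sum>k<a + b. v k * jacobian x k j))"
proof -
  have ts: "tangent_space X x = range (src.tangent_vec x)"
    using src.tangent_space_eq[OF assms(1)] src.tangent_vec_derivation[OF assms(1)]
      src.point_derivation_eq_tangent_vec[OF assms(1)] by blast
  have "differential X Y \<phi> x (src.tangent_vec x v) =
      tgt.tangent_vec (underlying \<phi> x) (\<lambda>j. \<Sum>k<a + b. v k * jacobian x k j)" for v
  proof -
    have "point_derivation Y (underlying \<phi> x) (differential X Y \<phi> x (src.tangent_vec x v))"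
      by (rule differential_derivation[OF assms src.tangent_vec_derivation[OF assms(1)]])
    note tgt.point_derivation_eq_tangent_vec[OF assms(2) this]
    also have "tgt.tangent_vec (underlying \<phi> x)
        (\<lambda>j. differential X Y \<phi> x (src.tangent_vec x v) (tgt.coord_germ (underlying \<phi> x) j)) =
        tgt.tangent_vec (underlying \<phi> x) (\<lambda>j. \<Sum>k<a + b. v k * jacobian x k j)"
      unfolding tgt.tangent_vec_def by (auto simp: fun_eq_iff differential_coord_germ[OF assms]
          simp flip: src.tangent_vec_def intro!: sum.cong)
    finally show ?thesis .
  qed
  then show ?thesis unfolding ts image_image by simp
qed

end

section \<open>Spanning is an open condition\<close>

text \<open>Gaussian elimination by induction on the size. The pivot tends to 1, hence is eventually
  nonzero, and after the last row and column are eliminated the remaining matrix still tends to the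
  identity.\<close>

lemma eventually_solvable_near_identity:
  fixes B :: "'z \<Rightarrow> nat \<Rightarrow> nat \<Rightarrow> real"
  assumes "\<And>i j. i < N \<Longrightarrow> j < N \<Longrightarrow> ((\<lambda>z. B z i j) \<longlongrightarrow> (if i = j then 1 else 0)) F"
  shows "\<forall>\<^sub>F z in F. \<forall>\<omega>. \<exists>v. \<forall>j<N. (\<Sum>i<N. v i * B z i j) = \<omega> j"
  using assms
proof (induction N arbitrary: B)
  case (Suc N)
  \<comment> \<open>The Schur complement of the entry \<open>B z N N\<close>.\<close>
  let ?C = "\<lambda>z i j. B z i j - B z i N * B z N j / B z N N"
  have NN: "((\<lambda>z. B z N N) \<longlongrightarrow> 1) F" using Suc.prems[of N N] by simp
  have "((\<lambda>z. ?C z i j) \<longlongrightarrow> (if i = j then 1 else 0)) F" if "i < N" "j < N" for i j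
  proof -
    have "((\<lambda>z. ?C z i j) \<longlongrightarrow> (if i = j then 1 else 0) - 0 * 0 / 1) F"
      using Suc.prems[of i j] Suc.prems[of i N] Suc.prems[of N j] that NN
      by (intro tendsto_intros) auto
    then show ?thesis by simp
  qed
  from Suc.IH[OF this] have "\<forall>\<^sub>F z in F. \<forall>\<omega>. \<exists>v. \<forall>j<N. (\<Sum>i<N. v i * ?C z i j) = \<omega> j" by simp
  moreover have "\<forall>\<^sub>F z in F. B z N N \<in> - {0}"
    using topological_tendstoD[OF NN, of "- {0}"] by auto
  ultimately show ?case
  proof eventually_elim
    case (elim z)
    show ?case
    proof
      fix \<omega> :: "nat \<Rightarrow> real"
      obtain v where v: "\<And>j. j < N \<Longrightarrow> (\<Sum>i<N. v i * ?C z i j) = \<omega> j - \<omega> N / B z N N * B z N j"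
        using elim(1)[rule_format, of "\<lambda>j. \<omega> j - \<omega> N / B z N N * B z N j"] by blast
      \<comment> \<open>The last unknown, chosen to satisfy the last equation; the right-hand side
        used for \<open>v\<close> anticipates its effect on the others.\<close>
      define w where "w = (\<omega> N - (\<Sum>i<N. v i * B z i N)) / B z N N"
      have "(\<Sum>i<N. v i * B z i j) + w * B z N j = \<omega> j" if j: "j < Suc N" for j
      proof (cases "j = N")
        case True
        then show ?thesis using elim(2) by (simp add: w_def)
      next
        case False
        then have "j < N" using j by simp
        have "(\<Sum>i<N. v i * ?C z i j) =
            (\<Sum>i<N. v i * B z i j) - (\<Sum>i<N. v i * B z i N) / B z N N * B z N j"
          by (simp add: algebra_simps sum_subtractf sum_distrib_left sum_divide_distrib)
        with v[OF \<open>j < N\<close>] show ?thesis by (simp add: w_def diff_divide_distrib algebra_simps)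
      qed
      then have "\<forall>j<Suc N. (\<Sum>i<Suc N. (v(N := w)) i * B z i j) = \<omega> j"
        by (simp cong: sum.cong_simp)
      then show "\<exists>v. \<forall>j<Suc N. (\<Sum>i<Suc N. v i * B z i j) = \<omega> j" by blast
    qed
  qed
qed simp

text \<open>If the rows of the limit span, it has a left inverse \<open>R\<close>. The square
  matrices \<open>R A\<close> then tend to the identity, and a solution \<open>v\<close> for
  \<open>R A\<close> becomes the solution \<open>v R\<close> for \<open>A\<close>.\<close>

lemma eventually_spanning:
  fixes A :: "'z \<Rightarrow> nat \<Rightarrow> nat \<Rightarrow> real"
  assumes lim: "\<And>k j. k < K \<Longrightarrow> j < N \<Longrightarrow> ((\<lambda>z. A z k j) \<longlongrightarrow> A\<^sub>0 k j) F"
    and span: "\<And>\<omega>. \<exists>v. \<forall>j<N. (\<Sum>k<K. v k * A\<^sub>0 k j) = \<omega> j"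
  shows "\<forall>\<^sub>F z in F. \<forall>\<omega>. \<exists>v. \<forall>j<N. (\<Sum>k<K. v k * A z k j) = \<omega> j"
proof -
  have "\<exists>v. \<forall>j<N. (\<Sum>k<K. v k * A\<^sub>0 k j) = (if i = j then 1 else 0)" for i
    using span[of "\<lambda>j. if i = j then 1 else 0"] by simp
  then obtain R where R: "\<And>i j. j < N \<Longrightarrow> (\<Sum>k<K. R i k * A\<^sub>0 k j) = (if i = j then 1 else 0)"
    by metis
  have "\<forall>\<^sub>F z in F. \<forall>\<omega>. \<exists>v. \<forall>j<N. (\<Sum>i<N. v i * (\<Sum>k<K. R i k * A z k j)) = \<omega> j"
  proof (rule eventually_solvable_near_identity)
    fix i j assume "i < N" "j < N"
    then have "((\<lambda>z. \<Sum>k<K. R i k * A z k j) \<longlongrightarrow> (\<Sum>k<K. R i k * A\<^sub>0 k j)) F"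
      by (intro tendsto_intros lim) auto
    then show "((\<lambda>z. \<Sum>k<K. R i k * A z k j) \<longlongrightarrow> (if i = j then 1 else 0)) F"
      using R \<open>j < N\<close> by simp
  qed
  then show ?thesis
  proof eventually_elim
    case (elim z)
    show ?case
    proof
      fix \<omega>
      obtain v where v: "\<forall>j<N. (\<Sum>i<N. v i * (\<Sum>k<K. R i k * A z k j)) = \<omega> j" using elim by blast
      have "(\<Sum>k<K. (\<Sum>i<N. v i * R i k) * A z k j) = (\<Sum>i<N. v i * (\<Sum>k<K. R i k * A z k j))" for j
        by (simp add: sum_distrib_left sum_distrib_right mult.assoc) (rule sum.swap)
      with v show "\<exists>v. \<forall>j<N. (\<Sum>k<K. v k * A z k j) = \<omega> j"
        by (intro exI[of _ "\<lambda>k. \<Sum>i<N. v i * R i k"]) simp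
    qed
  qed
qed

section \<open>Transversality at a point in terms of Jacobians\<close>

definition transversal_at ::
    "('x, 's) superspace \<Rightarrow> ('y, 't) superspace \<Rightarrow> ('y, 'u) superspace \<Rightarrow>
     ('y, 'u, 'y, 't) supermap \<Rightarrow> ('x, 's, 'y, 't) supermap \<Rightarrow> 'x \<Rightarrow> bool" where
  "transversal_at X Y Z \<iota> \<psi> x \<longleftrightarrow>
     {\<lambda>b. \<eta> b + \<zeta> b |\<eta> \<zeta>.
        \<eta> \<in> differential X Y \<psi> x ` tangent_space X x \<and>
        \<zeta> \<in> differential Z Y \<iota> (underlying \<psi> x) ` tangent_space Z (underlying \<psi> x)}
     = tangent_space Y (underlying \<psi> x)"

lemma supertransversal_iff:
  "supertransversal X Y Z \<iota> \<psi> \<longleftrightarrow>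
     (\<forall>x\<in>topspace (body X). underlying \<psi> x \<in> topspace (body Z) \<longrightarrow> transversal_at X Y Z \<iota> \<psi> x)"
  unfolding supertransversal_def transversal_at_def ..

lemma (in super_chart) tangent_vec_add:
  "tangent_vec x (\<lambda>k. v k + w k) = (\<lambda>\<alpha>. tangent_vec x v \<alpha> + tangent_vec x w \<alpha>)"
  by (auto simp: tangent_vec_def fun_eq_iff algebra_simps sum.distrib)

lemma (in super_chart) tangent_vec_coord_germ:
  assumes "x \<in> Q" "l < a + b"
  shows "tangent_vec x v (coord_germ x l) = v l"
proof -
  have "tangent_vec x v (coord_germ x l) = (\<Sum>k<a + b. v k * (if k = l then 1 else 0))"
    using representsD(10)[OF represents_coord_germ[OF assms]] partial_at_coord_germ[OF assms]
    by (simp add: tangent_vec_def)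
  also have "\<dots> = (\<Sum>k<a + b. if k = l then v k else 0)" by (intro sum.cong) auto
  finally show ?thesis using assms(2) by simp
qed

lemma (in super_chart) tangent_vec_eq_iff:
  assumes "x \<in> Q"
  shows "tangent_vec x v = tangent_vec x w \<longleftrightarrow> (\<forall>k<a + b. v k = w k)"
proof
  assume "tangent_vec x v = tangent_vec x w"
  then show "\<forall>k<a + b. v k = w k" using tangent_vec_coord_germ[OF assms] by metis
qed (auto simp: tangent_vec_def fun_eq_iff intro!: sum.cong)

lemma sums_of_ranges:
  fixes A :: "'i \<Rightarrow> 'b \<Rightarrow> real" and B :: "'j \<Rightarrow> 'b \<Rightarrow> real"
  shows "{\<lambda>b. \<eta> b + \<zeta> b |\<eta> \<zeta>. \<eta> \<in> range A \<and> \<zeta> \<in> range B} =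
    range (\<lambda>(v, w). \<lambda>b. A v b + B w b)"
proof (intro subset_antisym subsetI)
  fix f assume "f \<in> {\<lambda>b. \<eta> b + \<zeta> b |\<eta> \<zeta>. \<eta> \<in> range A \<and> \<zeta> \<in> range B}"
  then obtain v w where "f = (\<lambda>b. A v b + B w b)" by blast
  then show "f \<in> range (\<lambda>(v, w). \<lambda>b. A v b + B w b)" by (intro image_eqI[of _ _ "(v, w)"]) auto
qed auto

lemma range_case_prod_eq_iff:
  assumes "\<And>v w. f v w \<in> range g"
  shows "range (\<lambda>(v, w). f v w) = range g \<longleftrightarrow> (\<forall>\<omega>. \<exists>v w. f v w = g \<omega>)"
proof
  assume "range (\<lambda>(v, w). f v w) = range g"
  then have *: "g \<omega> \<in> range (\<lambda>(v, w). f v w)" for \<omega> by simp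
  show "\<forall>\<omega>. \<exists>v w. f v w = g \<omega>"
  proof
    fix \<omega> show "\<exists>v w. f v w = g \<omega>" using *[of \<omega>] by (auto; blast)
  qed
next
  assume *: "\<forall>\<omega>. \<exists>v w. f v w = g \<omega>"
  show "range (\<lambda>(v, w). f v w) = range g"
  proof (intro subset_antisym subsetI)
    fix z assume "z \<in> range g"
    then obtain \<omega> where "z = g \<omega>" by blast
    with * obtain v w where "f v w = z" by blast
    then show "z \<in> range (\<lambda>(v, w). f v w)" by (intro image_eqI[of _ _ "(v, w)"]) auto
  qed (use assms in auto)
qed

text \<open>In one chart of \<open>Y\<close> about the common point, both images and the whole
  tangent space are ranges of \<open>tangent_vec\<close>, which is injective on the first
  \<open>c + d\<close> coefficients. The assumption \<open>fixed\<close> ensures that the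
  differential of \<open>\<iota>\<close> lands in the tangent space at the same point.\<close>

lemma transversal_at_iff_spanning:
  assumes \<phi>: "chart_morphism a b X Q U \<kappa> c d Y Q' U' \<kappa>' \<phi>"
    and \<iota>: "chart_morphism a' b' Z R W \<sigma> c d Y Q' U' \<kappa>' \<iota>"
    and x: "x \<in> Q" "underlying \<phi> x \<in> Q'" "underlying \<phi> x \<in> R"
    and fixed: "underlying \<iota> (underlying \<phi> x) = underlying \<phi> x"
  shows "transversal_at X Y Z \<iota> \<phi> x \<longleftrightarrow> (\<forall>\<omega>. \<exists>v w. \<forall>j<c + d.
    (\<Sum>k<a + b. v k * chart_morphism.jacobian a b X Q U \<kappa> c Y Q' U' \<kappa>' \<phi> x k j) +
    (\<Sum>k<a' + b'. w k * chart_morphism.jacobian a' b' Z R W \<sigma> c Y Q' U' \<kappa>' \<iota> (underlying \<phi> x) k j) = \<omega> j)"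
proof -
  interpret P: chart_morphism a b X Q U \<kappa> c d Y Q' U' \<kappa>' \<phi> by (rule \<phi>)
  interpret I: chart_morphism a' b' Z R W \<sigma> c d Y Q' U' \<kappa>' \<iota> by (rule \<iota>)
  let ?y = "underlying \<phi> x"
  let ?T = "P.tgt.tangent_vec ?y"
  let ?p = "\<lambda>v j. \<Sum>k<a + b. v k * P.jacobian x k j"
  let ?i = "\<lambda>w j. \<Sum>k<a' + b'. w k * I.jacobian ?y k j"
  have 1: "differential X Y \<phi> x ` tangent_space X x = range (\<lambda>v. ?T (?p v))"
    by (rule P.differential_image_tangent_space[OF x(1,2)])
  have 2: "differential Z Y \<iota> ?y ` tangent_space Z ?y = range (\<lambda>w. ?T (?i w))"
    using I.differential_image_tangent_space[OF x(3)] fixed x(2) by simp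
  have 3: "tangent_space Y ?y = range ?T"
    using P.tgt.tangent_space_eq[OF x(2)] P.tgt.tangent_vec_derivation[OF x(2)]
      P.tgt.point_derivation_eq_tangent_vec[OF x(2)] by blast
  have "transversal_at X Y Z \<iota> \<phi> x \<longleftrightarrow>
      range (\<lambda>(v, w). ?T (\<lambda>j. ?p v j + ?i w j)) = range ?T"
  proof -
    have "{\<lambda>b. \<eta> b + \<zeta> b |\<eta> \<zeta>. \<eta> \<in> range (\<lambda>v. ?T (?p v)) \<and> \<zeta> \<in> range (\<lambda>w. ?T (?i w))} =
        range (\<lambda>(v, w). ?T (\<lambda>j. ?p v j + ?i w j))"
      unfolding P.tgt.tangent_vec_add by (rule sums_of_ranges)
    then show ?thesis unfolding transversal_at_def 1 2 3 by simp
  qed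
  also have "\<dots> \<longleftrightarrow> (\<forall>\<omega>. \<exists>v w. ?T (\<lambda>j. ?p v j + ?i w j) = ?T \<omega>)"
    by (rule range_case_prod_eq_iff) simp
  also have "\<dots> \<longleftrightarrow> (\<forall>\<omega>. \<exists>v w. \<forall>j<c + d. ?p v j + ?i w j = \<omega> j)"
    unfolding P.tgt.tangent_vec_eq_iff[OF x(2)] ..
  finally show ?thesis .
qed

section \<open>Continuity of Jacobians\<close>

lemma filterlim_nhdsin:
  assumes "continuous_map X Y f" "x \<in> topspace X"
  shows "filterlim f (nhdsin Y (f x)) (nhdsin X x)"
  unfolding filterlim_iff
proof (intro allI impI)
  fix P assume "eventually P (nhdsin Y (f x))"
  moreover have "f x \<in> topspace Y" using assms by (auto simp: continuous_map_def)
  ultimately obtain S where S: "openin Y S" "f x \<in> S" "\<forall>y\<in>S. P y"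
    unfolding eventually_nhdsin by blast
  have "openin X {x \<in> topspace X. f x \<in> S}" by (rule openin_continuous_map_preimage[OF assms(1) S(1)])
  with S assms(2) show "eventually (\<lambda>x. P (f x)) (nhdsin X x)"
    unfolding eventually_nhdsin by (intro disjI2 exI[of _ "{x \<in> topspace X. f x \<in> S}"]) auto
qed

lemma eventually_nhdsin_openin: "openin X S \<Longrightarrow> x \<in> S \<Longrightarrow> eventually (\<lambda>y. y \<in> S) (nhdsin X x)"
  unfolding eventually_nhdsin by blast

lemma continuous_on_super_partial:
  assumes "openin (Euclidean_space a) V" "f \<in> superfun_carrier a b V"
  shows "continuous_on V (super_partial a k f)"
proof (cases "k < a")
  case True
  have "continuous_on V (partial_deriv k (f {}))"
    by (intro smooth_fun_on_imp_continuous[OF assms(1)] smooth_fun_on_partial_deriv[OF assms(1)]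
        superfun_carrier_smooth[OF assms(2)] True)
  then show ?thesis using True by (simp add: super_partial_def[abs_def])
next
  case False
  have "continuous_on V (f {k - a})"
    by (intro smooth_fun_on_imp_continuous[OF assms(1)] superfun_carrier_smooth[OF assms(2)])
  then show ?thesis using False by (simp add: super_partial_def[abs_def])
qed

lemma (in super_chart) tendsto_super_partial:
  assumes "openin (Euclidean_space a) V" "V \<subseteq> U" "f \<in> superfun_carrier a b V" "x \<in> over V"
  shows "((\<lambda>x'. super_partial a k f (underlying \<kappa> x')) \<longlongrightarrow> super_partial a k f (underlying \<kappa> x))
    (nhdsin (body X) x)"
proof (rule topological_tendstoI)
  fix T assume T: "open T" "super_partial a k f (underlying \<kappa> x) \<in> T"
  let ?W = "{z \<in> V. super_partial a k f z \<in> T}"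
  have W: "openin (Euclidean_space a) ?W"
    by (rule openin_Euclidean_preimage[OF assms(1) continuous_on_super_partial[OF assms(1,3)] T(1)])
  have "\<forall>\<^sub>F x' in nhdsin (body X) x. x' \<in> over ?W"
    by (rule eventually_nhdsin_openin[OF openin_over[OF W]]) (use assms T in \<open>auto simp: over_iff\<close>)
  then show "\<forall>\<^sub>F x' in nhdsin (body X) x. super_partial a k f (underlying \<kappa> x') \<in> T"
    by eventually_elim (simp add: over_iff)
qed

text \<open>Near \<open>x\<close> the pulled-back coordinate is expressed by a single superfunction
  \<open>f\<close>, so the Jacobian entry is a continuous first-order coefficient of
  \<open>f\<close> evaluated at the moving point.\<close>

lemma (in chart_morphism) tendsto_jacobian:
  assumes x: "x \<in> Q" and y: "underlying \<phi> x \<in> Q'" and j: "j < c + d"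
  shows "((\<lambda>x'. jacobian x' k j) \<longlongrightarrow> jacobian x k j) (nhdsin (body X) x)"
proof -
  note M = src.sheaf tgt.sheaf morphism
  note oQ = tgt.open_Q
  let ?s = "pull \<kappa>' U' (super_coord c U' j)"
  let ?W = "preim X \<phi> Q'"
  have s: "?s \<in> carrier (sec Y Q')"
    using tgt.pull_simps(1)[OF tgt.open_U order.refl super_coord_carrier[OF tgt.open_U j]] tgt.over_U
    by simp
  have oW: "openin (body X) ?W" by (rule openin_preim[OF M oQ])
  have xW: "x \<in> ?W" by (rule in_preim[OF M in_topspace[OF x] y])
  have germ_s: "stalk_pull X \<phi> x' (tgt.coord_germ (underlying \<phi> x') j) = germ X x' ?W (pull \<phi> Q' ?s)"
    if "x' \<in> Q" "underlying \<phi> x' \<in> Q'" for x'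
    unfolding tgt.coord_germ_def by (rule stalk_pull_germ[OF M in_topspace[OF that(1)] oQ that(2) s])
  have c: "pull \<phi> Q' ?s \<in> carrier (sec X ?W)" by (rule morphism_simps(1)[OF M oQ s])
  obtain V f where f: "src.represents x V f (germ X x ?W (pull \<phi> Q' ?s))"
    using src.represents_ex[OF x germ_in_stalk[OF src.sheaf oW xW c]] .
  note R = src.representsD[OF f]
  obtain N where N: "openin (body X) N" "x \<in> N" "N \<subseteq> src.over V \<inter> ?W"
      "\<And>x'. x' \<in> N \<Longrightarrow> src.represents x' V f (germ X x' ?W (pull \<phi> Q' ?s))"
    by (rule src.represents_nearby[OF f oW xW c]) blast
  have eq: "jacobian x' k j = super_partial a k f (underlying \<kappa> x')" if "x' \<in> N" for x'
  proof -
    have "x' \<in> Q" "underlying \<phi> x' \<in> Q'" using N(3) that by (auto simp: src.over_iff preim_def)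
    then show ?thesis
      unfolding jacobian_def using germ_s src.partial_at_eq[OF N(4)[OF that]] by simp
  qed
  have "\<forall>\<^sub>F x' in nhdsin (body X) x. super_partial a k f (underlying \<kappa> x') = jacobian x' k j"
    using eventually_nhdsin_openin[OF N(1,2)] by eventually_elim (simp add: eq)
  moreover have "((\<lambda>x'. super_partial a k f (underlying \<kappa> x')) \<longlongrightarrow> jacobian x k j) (nhdsin (body X) x)"
    using src.tendsto_super_partial[OF R(1,2,4,3)] eq[OF N(2)] by simp
  ultimately show ?thesis by (rule Lim_transform_eventually[rotated])
qed

section \<open>Slices of a homotopy\<close>

lemma openin_slice:
  assumes "openin (Euclidean_space (Suc a)) V"
  shows "openin (Euclidean_space a) (slice a t V)"
proof -
  obtain T where T: "open T" "V = topspace (Euclidean_space (Suc a)) \<inter> T"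
    using assms by (metis Euclidean_space_eq_top_of_set openin_open)
  have "open ((\<lambda>x. x(a := t)) -` T)"
    by (rule open_vimage[OF T(1) continuous_on_upd[OF continuous_on_id continuous_on_const]])
  moreover have "slice a t V = topspace (Euclidean_space a) \<inter> (\<lambda>x. x(a := t)) -` T"
    using T(2) by (auto simp: slice_def topspace_Euclidean_space)
  ultimately show ?thesis
    by (subst Euclidean_space_eq_top_of_set) (auto simp: openin_open)
qed

text \<open>Only indices below \<open>a\<close> are differentiated, and updating those commutes with
  freezing the coordinate of index \<open>a\<close> at \<open>t\<close>.\<close>

lemma Ck_on_slice:
  assumes V: "openin (Euclidean_space (Suc a)) V"
  shows "Ck_on k (Suc a) V h \<Longrightarrow> Ck_on k a (slice a t V) (\<lambda>x. h (x(a := t)))"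
proof (induction k arbitrary: h)
  note simps = Ck_on_simps[OF openin_slice[OF V]]
  have cont: "continuous_on (slice a t V) (\<lambda>x. h (x(a := t)))" if "continuous_on V h"
    for h :: "(nat \<Rightarrow> real) \<Rightarrow> real"
    by (rule continuous_on_compose2[OF that continuous_on_upd[OF continuous_on_id continuous_on_const]])
      (auto simp: slice_def)
  {
    case 0
    then show ?case unfolding simps by (intro cont Ck_on_imp_continuous[OF V])
  next
    case (Suc k)
    show ?case unfolding simps
    proof (intro conjI allI impI cont Ck_on_imp_continuous[OF V Suc.prems])
      fix l assume l: "l < a"
      then obtain g where g: "Ck_on k (Suc a) V g"
          "\<And>x. x \<in> V \<Longrightarrow> ((\<lambda>s. h (x(l := s))) has_real_derivative g x) (at (x l))"
        using Suc.prems unfolding Ck_on_simps[OF V] by (meson less_SucI)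
      have "((\<lambda>s. h ((x(l := s))(a := t))) has_real_derivative g (x(a := t))) (at (x l))"
        if "x \<in> slice a t V" for x
        using g(2)[of "x(a := t)"] that l by (simp add: slice_def fun_upd_twist)
      with Suc.IH[OF g(1)] show "\<exists>g. Ck_on k a (slice a t V) g \<and> (\<forall>x\<in>slice a t V.
          ((\<lambda>s. h ((x(l := s))(a := t))) has_real_derivative g x) (at (x l)))"
        by blast
    qed
  }
qed

definition superfun_slice :: "nat \<Rightarrow> real \<Rightarrow> (nat \<Rightarrow> real) set \<Rightarrow> superfun \<Rightarrow> superfun" where
  "superfun_slice a t V f = (\<lambda>I x. if x \<in> slice a t V then f I (x(a := t)) else 0)"

lemma superfun_slice_carrier:
  assumes V: "openin (Euclidean_space (Suc a)) V" and f: "f \<in> superfun_carrier (Suc a) b V"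
  shows "superfun_slice a t V f \<in> superfun_carrier a b (slice a t V)"
proof (rule superfun_carrierI)
  fix I
  have "smooth_fun_on a (slice a t V) (\<lambda>x. f I (x(a := t)))"
    using superfun_carrier_smooth[OF f] Ck_on_slice[OF V] unfolding smooth_fun_on_def by blast
  then show "smooth_fun_on a (slice a t V) (superfun_slice a t V f I)"
    by (rule smooth_fun_on_cong[OF openin_slice[OF V]]) (simp add: superfun_slice_def)
qed (use superfun_carrier_support[OF f] in \<open>auto simp: superfun_slice_def\<close>)

text \<open>The product with the line has its additional coordinate at index \<open>a\<close>,
  between the even and the odd coordinates; so the even ones keep their index and the odd ones move
  up by one.\<close>

lemma super_partial_slice:
  assumes V: "openin (Euclidean_space (Suc a)) V" and x: "x \<in> slice a t V"
  shows "super_partial a k (superfun_slice a t V f) x =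
    super_partial (Suc a) (if k < a then k else Suc k) f (x(a := t))"
proof (cases "k < a")
  case True
  have "partial_deriv k (superfun_slice a t V f {}) x = partial_deriv k (\<lambda>x. f {} (x(a := t))) x"
    by (rule partial_deriv_cong[OF openin_slice[OF V] _ x True]) (simp add: superfun_slice_def)
  also have "\<dots> = partial_deriv k (f {}) (x(a := t))"
    using True by (simp add: partial_deriv_def fun_upd_twist)
  finally show ?thesis using True by (simp add: super_partial_def)
qed (use x in \<open>simp add: super_partial_def superfun_slice_def\<close>)

lemma is_morphism_comp:
  assumes i: "is_morphism X P i" and \<Psi>: "is_morphism P Y \<Psi>"
  shows "is_morphism X Y (supermap_comp P \<Psi> i)"
proof -
  note ci = i[unfolded is_morphism_def, THEN conjunct1]
    and cp = \<Psi>[unfolded is_morphism_def, THEN conjunct1]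
  have preim: "preim X (supermap_comp P \<Psi> i) V = preim X i (preim P \<Psi> V)" for V
    using ci by (auto simp: preim_def supermap_comp_def continuous_map_def)
  have pull: "pull (supermap_comp P \<Psi> i) V = (\<lambda>g. pull i (preim P \<Psi> V) (pull \<Psi> V g))" for V
    by (simp add: supermap_comp_def)
  have op: "openin (body P) (preim P \<Psi> V)" if "openin (body Y) V" for V
    using openin_continuous_map_preimage[OF cp that] by (simp add: preim_def)
  note hi = i[unfolded is_morphism_def, THEN conjunct2, THEN conjunct1, rule_format]
    and hp = \<Psi>[unfolded is_morphism_def, THEN conjunct2, THEN conjunct1, rule_format]
    and ri = i[unfolded is_morphism_def, THEN conjunct2, THEN conjunct2, rule_format]
    and rp = \<Psi>[unfolded is_morphism_def, THEN conjunct2, THEN conjunct2, rule_format]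
  show ?thesis
    unfolding is_morphism_def preim pull
  proof (intro conjI allI impI ballI)
    show "continuous_map (body X) (body Y) (underlying (supermap_comp P \<Psi> i))"
      using continuous_map_compose[OF ci cp] by (simp add: supermap_comp_def)
  next
    fix V assume V: "openin (body Y) V"
    show "(\<lambda>g. pull i (preim P \<Psi> V) (pull \<Psi> V g))
        \<in> superring_hom (sec Y V) (sec X (preim X i (preim P \<Psi> V)))"
      by (rule superring_hom_comp[OF hp[OF V] hi[OF op[OF V]]])
  next
    fix V W g assume *: "openin (body Y) V \<and> openin (body Y) W \<and> W \<subseteq> V" and g: "g \<in> carrier (sec Y V)"
    have "preim P \<Psi> W \<subseteq> preim P \<Psi> V" using * by (auto simp: preim_def)
    then show "res X (preim X i (preim P \<Psi> V)) (preim X i (preim P \<Psi> W))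
        (pull i (preim P \<Psi> V) (pull \<Psi> V g)) = pull i (preim P \<Psi> W) (pull \<Psi> W (res Y V W g))"
      using ri[of "preim P \<Psi> V" "preim P \<Psi> W" "pull \<Psi> V g"] rp[OF * g] op *
        superring_homD(1)[OF hp g] by simp
  qed
qed

text \<open>A single chart of \<open>X\<close>, the one underlying the product chart, is used for
  all parameters; Jacobians of different slices are thus numbers in the same coordinates and can be
  compared.\<close>

locale homotopy_chart =
  src: super_chart a b X Q U \<kappa> + tgt: super_chart c d Y Q' U' \<kappa>'
  for a b and X :: "('x, 's) superspace" and Q U \<kappa>
    and c d and Y :: "('y, 't) superspace" and Q' U' \<kappa>' +
  fixes P :: "('x \<times> real, 'w) superspace"
    and pr\<^sub>1 :: "('x \<times> real, 'w, 'x, 's) supermap"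
    and pr\<^sub>2 :: "('x \<times> real, 'w, nat \<Rightarrow> real, superfun) supermap"
    and \<mu> :: "('x \<times> real, 'w, nat \<Rightarrow> real, superfun) supermap"
    and \<Psi> :: "('x \<times> real, 'w, 'y, 't) supermap"
    and i :: "real \<Rightarrow> ('x, 's, 'x \<times> real, 'w) supermap"
  assumes P_sheaf: "super_ringed_space P"
    and product: "product_chart a b X P pr\<^sub>1 pr\<^sub>2 Q U \<kappa> \<mu>"
    and homotopy: "is_morphism P Y \<Psi>"
    and inclusion: "is_slice_inclusion a b X P pr\<^sub>1 pr\<^sub>2 t (i t)"
begin

sublocale cyl: super_chart "Suc a" b P "Q \<times> UNIV" "cylinder a U" \<mu>
  by standard (use P_sheaf product in \<open>simp_all add: product_chart_def\<close>)

lemma inclusion_morphism: "is_morphism X P (i t)"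
  using inclusion unfolding is_slice_inclusion_def by blast

sublocale sl: chart_morphism a b X Q U \<kappa> c d Y Q' U' \<kappa>' "supermap_comp P \<Psi> (i t)" for t
  by standard (rule is_morphism_comp[OF inclusion_morphism homotopy])

lemma underlying_inclusion: "x \<in> topspace (body X) \<Longrightarrow> underlying (i t) x = (x, t)"
  using inclusion unfolding is_slice_inclusion_def by blast

lemma underlying_\<mu>: "x \<in> Q \<Longrightarrow> underlying \<mu> (x, t) = (underlying \<kappa> x)(a := t)"
  using product[unfolded product_chart_def, THEN conjunct2, THEN conjunct2, THEN conjunct1] by blast

lemma in_Euclidean: "x \<in> Q \<Longrightarrow> underlying \<kappa> x \<in> topspace (Euclidean_space a)"
  using src.underlying_in_U openin_subset[OF src.open_U] by blast

lemma pull_inclusion: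
  assumes "openin (Euclidean_space (Suc a)) V" "V \<subseteq> cylinder a U" "f \<in> superfun_carrier (Suc a) b V"
  shows "pull (i t) (cyl.over V) (pull \<mu> V f) = pull \<kappa> (slice a t V) (superfun_slice a t V f)"
proof -
  have "\<forall>V. openin (Euclidean_space (Suc a)) V \<and> V \<subseteq> cylinder a U \<longrightarrow>
      (\<forall>f\<in>superfun_carrier (Suc a) b V.
        pull (i t) (preim (open_subspace P (Q \<times> UNIV)) \<mu> V) (pull \<mu> V f) =
        pull \<kappa> (slice a t V) (\<lambda>I x. if x \<in> slice a t V then f I (x(a := t)) else 0))"
    using inclusion[of t] product unfolding is_slice_inclusion_def by blast
  with assms show ?thesis by (simp add: cyl.over_def superfun_slice_def)
qed

text \<open>Pulling a germ back along \<open>i t\<close> is substitution of \<open>t\<close> for the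
  line coordinate in its coordinate expression.\<close>

lemma represents_slice:
  assumes "cyl.represents (x, t) V f \<alpha>"
  shows "src.represents x (slice a t V) (superfun_slice a t V f) (stalk_pull X (i t) x \<alpha>)"
proof -
  note R = cyl.representsD[OF assms]
  have xQ: "x \<in> Q" using R(7) by simp
  then have xX: "x \<in> topspace (body X)" using src.Q_subset by blast
  have sub: "slice a t V \<subseteq> U"
  proof
    fix z assume z: "z \<in> slice a t V"
    then have "z(a := t) \<in> cylinder a U" using R(2) by (auto simp: slice_def)
    \<comment> \<open>A point of the space of dimension \<open>a\<close> already vanishes at index
      \<open>a\<close>.\<close>
    moreover have "z(a := 0) = z" using z by (auto simp: slice_def topspace_Euclidean_space)
    ultimately show "z \<in> U" by (simp add: cylinder_def)
  qed
  have preim: "preim X (i t) (cyl.over V) = src.over (slice a t V)"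
    using in_Euclidean src.Q_subset
    by (auto simp: preim_def cyl.over_iff src.over_iff slice_def underlying_inclusion underlying_\<mu>)
  have x: "x \<in> src.over (slice a t V)"
    using R(3) xQ in_Euclidean by (auto simp: cyl.over_iff src.over_iff slice_def underlying_\<mu>)
  have "stalk_pull X (i t) x \<alpha> = germ X x (preim X (i t) (cyl.over V)) (pull (i t) (cyl.over V) (pull \<mu> V f))"
    unfolding R(5) underlying_inclusion[OF xX, of t, symmetric]
    by (rule stalk_pull_germ[OF src.sheaf P_sheaf inclusion_morphism xX R(8) _ R(9)])
      (simp add: underlying_inclusion[OF xX] R(3))
  then show ?thesis
    unfolding preim pull_inclusion[OF R(1,2,4)]
    using x sub openin_slice[OF R(1)] superfun_slice_carrier[OF R(1,4)] by (simp add: src.represents_def)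
qed

text \<open>The target coordinate is pulled back along \<open>\<Psi>\<close> once, to the product.
  One superfunction there yields the Jacobian entries of all slices, and continuity of its
  first-order coefficients is continuity jointly in point and parameter.\<close>

lemma tendsto_slice_jacobian:
  assumes x: "x \<in> Q" and y: "underlying \<Psi> (x, t) \<in> Q'" and j: "j < c + d"
  shows "((\<lambda>p. sl.jacobian (snd p) (fst p) k j) \<longlongrightarrow> sl.jacobian t x k j) (nhdsin (body P) (x, t))"
proof -
  note M = P_sheaf tgt.sheaf homotopy
  note oQ = tgt.open_Q
  let ?s = "pull \<kappa>' U' (super_coord c U' j)"
  let ?W = "preim P \<Psi> Q'"
  let ?G = "pull \<Psi> Q' ?s"
  \<comment> \<open>Skips the direction of the line, as in
    \<open>super_partial_slice\<close>.\<close>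
  let ?k = "if k < a then k else Suc k"
  have s: "?s \<in> carrier (sec Y Q')"
    using tgt.pull_simps(1)[OF tgt.open_U order.refl super_coord_carrier[OF tgt.open_U j]] tgt.over_U
    by simp
  have oW: "openin (body P) ?W" by (rule openin_preim[OF M oQ])
  have "(x, t) \<in> topspace (body P)" using cyl.Q_subset x by auto
  then have xW: "(x, t) \<in> ?W" using y by (rule in_preim[OF M])
  have c: "?G \<in> carrier (sec P ?W)" by (rule morphism_simps(1)[OF M oQ s])
  have "(x, t) \<in> Q \<times> UNIV" using x by simp
  then obtain V f where f: "cyl.represents (x, t) V f (germ P (x, t) ?W ?G)"
    using cyl.represents_ex germ_in_stalk[OF P_sheaf oW xW c] by metis
  note R = cyl.representsD[OF f]
  obtain N where N: "openin (body P) N" "(x, t) \<in> N" "N \<subseteq> cyl.over V \<inter> ?W"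
      "\<And>p. p \<in> N \<Longrightarrow> cyl.represents p V f (germ P p ?W ?G)"
    by (rule cyl.represents_nearby[OF f oW xW c]) blast
  have eq: "sl.jacobian (snd p) (fst p) k j = super_partial (Suc a) ?k f (underlying \<mu> p)"
    if "p \<in> N" for p
  proof -
    obtain z r where p: "p = (z, r)" by fastforce
    note rep = represents_slice[OF N(4)[OF that, unfolded p]]
    have z: "z \<in> Q" "underlying \<Psi> (z, r) \<in> Q'"
      using N(3) that unfolding p by (auto simp: cyl.over_iff preim_def)
    then have zX: "z \<in> topspace (body X)" using src.Q_subset by blast
    let ?\<phi> = "supermap_comp P \<Psi> (i r)"
    have u: "underlying ?\<phi> z = underlying \<Psi> (z, r)"
      using underlying_inclusion[OF zX] by (simp add: supermap_comp_def)
    have y: "underlying ?\<phi> z \<in> Q'" using z(2) u by simp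
    have zW: "underlying (i r) z \<in> ?W"
      using underlying_inclusion[OF zX] N(3) that p by auto
    \<comment> \<open>The pullback along the composite is taken in two stages, first to
      \<open>P\<close> and then to the slice, so that the common superfunction \<open>f\<close>
      enters.\<close>
    have "stalk_pull X ?\<phi> z (tgt.coord_germ (underlying ?\<phi> z) j) = germ X z (preim X ?\<phi> Q') (pull ?\<phi> Q' ?s)"
      unfolding tgt.coord_germ_def
      by (rule stalk_pull_germ[OF src.sheaf tgt.sheaf sl.morphism zX oQ y s])
    also have "preim X ?\<phi> Q' = preim X (i r) ?W"
      using underlying_inclusion cyl.Q_subset inclusion_morphism[of r, unfolded is_morphism_def, THEN conjunct1]
      by (auto simp: preim_def supermap_comp_def continuous_map_def)
    also have "pull ?\<phi> Q' ?s = pull (i r) ?W ?G" by (simp add: supermap_comp_def)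
    also have "germ X z (preim X (i r) ?W) (pull (i r) ?W ?G) = stalk_pull X (i r) z (germ P (underlying (i r) z) ?W ?G)"
      by (rule stalk_pull_germ[symmetric, OF src.sheaf P_sheaf inclusion_morphism zX oW zW c])
    finally have "sl.jacobian r z k j = src.partial_at z k (stalk_pull X (i r) z (germ P (z, r) ?W ?G))"
      unfolding sl.jacobian_def underlying_inclusion[OF zX] by simp
    also have "\<dots> = super_partial (Suc a) ?k f (underlying \<mu> (z, r))"
      using src.partial_at_eq[OF rep] super_partial_slice[OF R(1)] src.representsD(6)[OF rep]
        underlying_\<mu>[OF z(1)] by simp
    finally show ?thesis by (simp add: p)
  qed
  have "\<forall>\<^sub>F p in nhdsin (body P) (x, t).
      super_partial (Suc a) ?k f (underlying \<mu> p) = sl.jacobian (snd p) (fst p) k j"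
    using eventually_nhdsin_openin[OF N(1,2)] by eventually_elim (simp only: eq)
  moreover have "((\<lambda>p. super_partial (Suc a) ?k f (underlying \<mu> p)) \<longlongrightarrow> sl.jacobian t x k j)
      (nhdsin (body P) (x, t))"
    using cyl.tendsto_super_partial[OF R(1,2,4,3), of ?k] eq[OF N(2)] by simp
  ultimately show ?thesis by (rule Lim_transform_eventually[rotated])
qed

end

section \<open>Stability of transversality\<close>

text \<open>\<open>supermap_eq\<close> controls the maps only at points of the space, on open sets
  and on sections. The differential uses nothing else, since the elements of a stalk contain genuine
  representatives only.\<close>

lemma transversal_at_cong:
  assumes eq: "supermap_eq X Y \<phi> \<psi>" and Y: "super_ringed_space Y" and x: "x \<in> topspace (body X)"
  shows "transversal_at X Y Z \<iota> \<phi> x \<longleftrightarrow> transversal_at X Y Z \<iota> \<psi> x"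
proof -
  have u: "underlying \<phi> z = underlying \<psi> z" if "z \<in> topspace (body X)" for z
    using eq that unfolding supermap_eq_def by blast
  have preim: "preim X \<phi> V = preim X \<psi> V" for V using u by (auto simp: preim_def)
  have pull: "pull \<phi> V g = pull \<psi> V g" if "openin (body Y) V" "g \<in> carrier (sec Y V)" for V g
    using eq that unfolding supermap_eq_def by blast
  have "stalk_pull X \<phi> x \<beta> = stalk_pull X \<psi> x \<beta>" if "\<beta> \<in> carrier (stalk Y (underlying \<psi> x))" for \<beta>
  proof -
    have "openin (body Y) V \<and> g \<in> carrier (sec Y V)" if "(V, g) \<in> \<beta>" for V g
      using \<open>\<beta> \<in> carrier _\<close> that by (auto simp: stalk_def germ_def)
    then have "germ X x (preim X \<phi> (fst p)) (pull \<phi> (fst p) (snd p)) =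
        germ X x (preim X \<psi> (fst p)) (pull \<psi> (fst p) (snd p))" if "p \<in> \<beta>" for p
      using that preim pull by (metis prod.collapse)
    then show ?thesis unfolding stalk_pull_def case_prod_unfold by (intro SUP_cong) auto
  qed
  then have "differential X Y \<phi> x \<eta> = differential X Y \<psi> x \<eta>" for \<eta>
    using u[OF x] by (auto simp: differential_def fun_eq_iff)
  then show ?thesis unfolding transversal_at_def u[OF x] by simp
qed

lemma supermanifold_chart:
  assumes "supermanifold a b X" "x \<in> topspace (body X)"
  obtains Q U \<kappa> where "x \<in> Q" "super_chart a b X Q U \<kappa>"
  using assms unfolding supermanifold_def super_chart_def by blast

text \<open>An embedding whose map is the identity on points forces the subspace topology. This is
  what makes a map into \<open>Y\<close> with values in \<open>Z\<close> continuous as a map into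
  \<open>Z\<close>.\<close>

lemma subsupermanifold_body:
  assumes "subsupermanifold p q Z \<iota> Y"
  shows "body Z = subtopology (body Y) (topspace (body Z))"
proof -
  have "embedding_map (body Z) (body Y) (underlying \<iota>)"
    and id: "\<And>z. z \<in> topspace (body Z) \<Longrightarrow> underlying \<iota> z = z"
    using assms unfolding subsupermanifold_def is_embedding_def by blast+
  then have "homeomorphic_map (body Z) (subtopology (body Y) (underlying \<iota> ` topspace (body Z)))
      (underlying \<iota>)"
    unfolding embedding_map_def by blast
  then have "homeomorphic_map (body Z) (subtopology (body Y) (underlying \<iota> ` topspace (body Z))) id"
    by (rule homeomorphic_map_eq) (simp add: id)
  moreover have "underlying \<iota> ` topspace (body Z) = topspace (body Z)" using id by force
  ultimately show ?thesis by simp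
qed

lemma transversal_nearby:
  assumes X: "supermanifold a b X" and Y: "supermanifold c d Y" and Z: "subsupermanifold p q Z \<iota> Y"
    and closed: "closedin (body Y) (topspace (body Z))"
    and P: "product_with_line a b X P pr\<^sub>1 pr\<^sub>2"
    and \<Psi>: "is_morphism P Y \<Psi>" and i: "\<And>t. is_slice_inclusion a b X P pr\<^sub>1 pr\<^sub>2 t (i t)"
    and x: "x \<in> topspace (body X)"
    and trans: "underlying \<Psi> (x, 0) \<in> topspace (body Z) \<Longrightarrow>
      transversal_at X Y Z \<iota> (supermap_comp P \<Psi> (i 0)) x"
  obtains N e where "openin (body X) N" "x \<in> N" "(0::real) < e"
    "\<And>x' t. x' \<in> N \<Longrightarrow> \<bar>t\<bar> < e \<Longrightarrow> underlying \<Psi> (x', t) \<in> topspace (body Z) \<Longrightarrow>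
      transversal_at X Y Z \<iota> (supermap_comp P \<Psi> (i t)) x'"
proof -
  have body: "body P = prod_topology (body X) euclideanreal" and P_man: "supermanifold (Suc a) b P"
    using P unfolding product_with_line_def by blast+
  have p0: "(x, 0) \<in> topspace (body P)" using x body by simp
  note cont = \<Psi>[unfolded is_morphism_def, THEN conjunct1]
  have ZY: "topspace (body Z) \<subseteq> topspace (body Y)" and \<iota>: "is_morphism Z Y \<iota>"
    and Z_man: "supermanifold p q Z" and id: "\<And>z. z \<in> topspace (body Z) \<Longrightarrow> underlying \<iota> z = z"
    using Z unfolding subsupermanifold_def is_embedding_def is_immersion_def by blast+
  have "\<exists>S. openin (body P) S \<and> (x, 0) \<in> S \<and> (\<forall>(x', t)\<in>S. underlying \<Psi> (x', t) \<in> topspace (body Z) \<longrightarrow>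
      transversal_at X Y Z \<iota> (supermap_comp P \<Psi> (i t)) x')"
  proof (cases "underlying \<Psi> (x, 0) \<in> topspace (body Z)")
    case False
    \<comment> \<open>Closedness of \<open>Z\<close> makes this set open; on it there is nothing to
      prove.\<close>
    let ?S = "{p \<in> topspace (body P). underlying \<Psi> p \<in> topspace (body Y) - topspace (body Z)}"
    have "openin (body P) ?S"
      by (rule openin_continuous_map_preimage[OF cont]) (use closed in \<open>simp add: openin_diff\<close>)
    moreover have "(x, 0) \<in> ?S" using False p0 cont by (auto simp: continuous_map_def)
    ultimately show ?thesis by (intro exI[of _ ?S]) auto
  next
    case True
    let ?y = "underlying \<Psi> (x, 0)"
    \<comment> \<open>The chart of \<open>X\<close> has to come from a product chart, because the
      coordinate form of the slice inclusions is given for product charts.\<close>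
    obtain Q U \<kappa> \<mu> where xQ: "x \<in> Q" and pc: "product_chart a b X P pr\<^sub>1 pr\<^sub>2 Q U \<kappa> \<mu>"
      using P x unfolding product_with_line_def by blast
    have "?y \<in> topspace (body Y)" using True ZY by blast
    then obtain Q' U' \<kappa>' where yQ: "?y \<in> Q'" and cY: "super_chart c d Y Q' U' \<kappa>'"
      using supermanifold_chart[OF Y] by metis
    obtain R W \<sigma> where yR: "?y \<in> R" and cZ: "super_chart p q Z R W \<sigma>"
      using supermanifold_chart[OF Z_man True] by metis
    have cX: "super_chart a b X Q U \<kappa>"
      using X pc unfolding super_chart_def product_chart_def supermanifold_def by blast
    interpret H: homotopy_chart a b X Q U \<kappa> c d Y Q' U' \<kappa>' P pr\<^sub>1 pr\<^sub>2 \<mu> \<Psi> i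
      using cX cY pc \<Psi> i P_man unfolding homotopy_chart_def homotopy_chart_axioms_def supermanifold_def
      by blast
    interpret I: chart_morphism p q Z R W \<sigma> c d Y Q' U' \<kappa>' \<iota>
      using cZ cY \<iota> unfolding chart_morphism_def chart_morphism_axioms_def by blast
    \<comment> \<open>The Jacobian of \<open>\<iota>\<close> is available only at points of
      \<open>Z\<close>, so all limits are taken within this subspace of \<open>P\<close>.\<close>
    let ?S = "{p \<in> topspace (body P). underlying \<Psi> p \<in> topspace (body Z)}"
    let ?T = "subtopology (body P) ?S"
    have topT: "topspace ?T = ?S" by auto
    have pT: "(x, 0) \<in> topspace ?T" using p0 True by simp
    have "continuous_map ?T (subtopology (body Y) (topspace (body Z))) (underlying \<Psi>)"
      using continuous_map_from_subtopology[OF cont] by (auto simp: continuous_map_in_subtopology)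
    then have contZ: "continuous_map ?T (body Z) (underlying \<Psi>)"
      using subsupermanifold_body[OF Z] by simp
    have id_lim: "filterlim (\<lambda>p. p) (nhdsin (body P) (x, 0)) (nhdsin ?T (x, 0))"
      by (rule filterlim_nhdsin[OF continuous_map_from_subtopology[OF continuous_map_id[unfolded id_def]] pT])
    have \<Psi>_lim: "filterlim (underlying \<Psi>) (nhdsin (body Z) ?y) (nhdsin ?T (x, 0))"
      by (rule filterlim_nhdsin[OF contZ pT])
    let ?K = "(a + b) + (p + q)"
    \<comment> \<open>The two Jacobians stacked into one family of \<open>?K\<close> vectors: the
      first \<open>a + b\<close> belong to the slice, the others to \<open>\<iota>\<close>.\<close>
    let ?A = "\<lambda>z k j. if k < a + b then H.sl.jacobian (snd z) (fst z) k j
      else I.jacobian (underlying \<Psi> z) (k - (a + b)) j"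
    have split: "(\<Sum>k<?K. v k * ?A z k j) = (\<Sum>k<a + b. v k * H.sl.jacobian (snd z) (fst z) k j) +
        (\<Sum>k<p + q. v (a + b + k) * I.jacobian (underlying \<Psi> z) k j)" for v z j
      by (simp add: sum_lessThan_add[of _ "a + b" "p + q"])
    have iff: "transversal_at X Y Z \<iota> (supermap_comp P \<Psi> (i t)) x' \<longleftrightarrow>
        (\<forall>\<omega>. \<exists>v. \<forall>j<c + d. (\<Sum>k<?K. v k * ?A (x', t) k j) = \<omega> j)"
      if "x' \<in> Q" "underlying \<Psi> (x', t) \<in> Q'" "underlying \<Psi> (x', t) \<in> R" for x' t
    proof -
      have u: "underlying (supermap_comp P \<Psi> (i t)) x' = underlying \<Psi> (x', t)"
        using H.underlying_inclusion[of x'] that(1) H.src.Q_subset by (auto simp: supermap_comp_def)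
      have "transversal_at X Y Z \<iota> (supermap_comp P \<Psi> (i t)) x' \<longleftrightarrow> (\<forall>\<omega>. \<exists>v w. \<forall>j<c + d.
          (\<Sum>k<a + b. v k * H.sl.jacobian t x' k j) +
          (\<Sum>k<p + q. w k * I.jacobian (underlying \<Psi> (x', t)) k j) = \<omega> j)"
        using transversal_at_iff_spanning[OF H.sl.chart_morphism_axioms[of t] I.chart_morphism_axioms that(1),
            unfolded u, OF that(2,3) id] that(3) I.src.Q_subset by blast
      also have "\<dots> \<longleftrightarrow> (\<forall>\<omega>. \<exists>v. \<forall>j<c + d. (\<Sum>k<?K. v k * ?A (x', t) k j) = \<omega> j)"
      proof (intro all_cong1 iffI; elim exE)
        fix \<omega> v w assume *: "\<forall>j<c + d. (\<Sum>k<a + b. v k * H.sl.jacobian t x' k j) +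
          (\<Sum>k<p + q. w k * I.jacobian (underlying \<Psi> (x', t)) k j) = \<omega> j"
        show "\<exists>v. \<forall>j<c + d. (\<Sum>k<?K. v k * ?A (x', t) k j) = \<omega> j"
          unfolding split using * by (intro exI[of _ "\<lambda>k. if k < a + b then v k else w (k - (a + b))"]) simp
      next
        fix \<omega> v assume *: "\<forall>j<c + d. (\<Sum>k<?K. v k * ?A (x', t) k j) = \<omega> j"
        show "\<exists>v w. \<forall>j<c + d. (\<Sum>k<a + b. v k * H.sl.jacobian t x' k j) +
          (\<Sum>k<p + q. w k * I.jacobian (underlying \<Psi> (x', t)) k j) = \<omega> j"
          using *[unfolded split] by (intro exI[of _ v] exI[of _ "\<lambda>k. v (a + b + k)"]) simp
      qed
      finally show ?thesis .
    qed
    have "\<forall>\<^sub>F z in nhdsin ?T (x, 0). \<forall>\<omega>. \<exists>v. \<forall>j<c + d. (\<Sum>k<?K. v k * ?A z k j) = \<omega> j"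
    proof (rule eventually_spanning)
      fix k j assume "k < ?K" and j: "j < c + d"
      show "((\<lambda>z. ?A z k j) \<longlongrightarrow> ?A (x, 0) k j) (nhdsin ?T (x, 0))"
      proof (cases "k < a + b")
        case True
        have "((\<lambda>z. H.sl.jacobian (snd z) (fst z) k j) \<longlongrightarrow> H.sl.jacobian 0 x k j) (nhdsin (body P) (x, 0))"
          by (rule H.tendsto_slice_jacobian[OF xQ yQ j])
        from filterlim_compose[OF this id_lim] True show ?thesis by simp
      next
        case False
        have "((\<lambda>z. I.jacobian z (k - (a + b)) j) \<longlongrightarrow> I.jacobian ?y (k - (a + b)) j) (nhdsin (body Z) ?y)"
          by (rule I.tendsto_jacobian[OF yR _ j]) (use id[OF True] yQ in simp)
        from filterlim_compose[OF this \<Psi>_lim] False show ?thesis by simp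
      qed
    next
      show "\<exists>v. \<forall>j<c + d. (\<Sum>k<?K. v k * ?A (x, 0) k j) = \<omega> j" for \<omega>
        using iff[OF xQ yQ yR] trans[OF True] by blast
    qed
    moreover have "\<forall>\<^sub>F z in nhdsin ?T (x, 0). fst z \<in> Q"
    proof -
      have "openin (body P) (Q \<times> UNIV)" by (rule H.cyl.open_Q)
      then have "\<forall>\<^sub>F z in nhdsin (body P) (x, 0). z \<in> Q \<times> UNIV"
        by (rule eventually_nhdsin_openin) (use xQ in simp)
      from eventually_compose_filterlim[OF this id_lim] show ?thesis by (auto elim: eventually_mono)
    qed
    moreover have "\<forall>\<^sub>F z in nhdsin ?T (x, 0). underlying \<Psi> z \<in> R"
      by (rule eventually_compose_filterlim[OF eventually_nhdsin_openin[OF I.src.open_Q yR] \<Psi>_lim])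
    moreover have "\<forall>\<^sub>F z in nhdsin ?T (x, 0). underlying \<Psi> z \<in> Q'"
      by (rule eventually_compose_filterlim[OF eventually_nhdsin_openin[OF H.tgt.open_Q yQ]
            filterlim_nhdsin[OF continuous_map_from_subtopology[OF cont] pT]])
    ultimately have "\<forall>\<^sub>F z in nhdsin ?T (x, 0). transversal_at X Y Z \<iota> (supermap_comp P \<Psi> (i (snd z))) (fst z)"
    proof eventually_elim
      case (elim z)
      then show ?case by (cases z) (simp only: iff fst_conv snd_conv simp_thms)
    qed
    then obtain S where S: "openin ?T S" "(x, 0) \<in> S"
        "\<forall>z\<in>S. transversal_at X Y Z \<iota> (supermap_comp P \<Psi> (i (snd z))) (fst z)"
      using pT unfolding eventually_nhdsin by blast
    \<comment> \<open>Passing from \<open>S\<close> to a set open in \<open>P\<close> adds only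
      points that \<open>\<Psi>\<close> sends outside \<open>Z\<close>, where nothing is
      claimed.\<close>
    then obtain S' where S': "openin (body P) S'" "S = S' \<inter> ?S" unfolding openin_subtopology by blast
    have "transversal_at X Y Z \<iota> (supermap_comp P \<Psi> (i t)) x'"
      if "(x', t) \<in> S'" "underlying \<Psi> (x', t) \<in> topspace (body Z)" for x' t
    proof -
      have "(x', t) \<in> S" using S' that openin_subset[OF S'(1)] by blast
      then show ?thesis using S(3) by fastforce
    qed
    then show ?thesis using S' S(2) by (intro exI[of _ S']) blast
  qed
  then obtain S where S: "openin (body P) S" "(x, 0) \<in> S"
      "\<And>x' t. (x', t) \<in> S \<Longrightarrow> underlying \<Psi> (x', t) \<in> topspace (body Z) \<Longrightarrow>
        transversal_at X Y Z \<iota> (supermap_comp P \<Psi> (i t)) x'"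
    by blast
  obtain N T where NT: "openin (body X) N" "open T" "x \<in> N" "0 \<in> T" "N \<times> T \<subseteq> S"
    using S(1,2) unfolding body openin_prod_topology_alt by (metis open_openin)
  obtain e where e: "e > 0" "\<And>t. \<bar>t\<bar> < e \<Longrightarrow> t \<in> T"
    using NT(2,4) unfolding open_dist by (auto simp: dist_real_def)
  show ?thesis
    by (rule that[OF NT(1,3) e(1)]) (use S(3) NT(5) e(2) in blast)
qed

theorem theorem4p5:
  fixes m n p q r s :: nat
    and X :: "('x, 'a) superspace"
    and Y :: "('y, 'b) superspace"
    and Z :: "('y, 'c) superspace"
    and \<iota> :: "('y, 'c, 'y, 'b) supermap"
    and P :: "('x \<times> real, 'd) superspace"
    and pr\<^sub>1 :: "('x \<times> real, 'd, 'x, 'a) supermap"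
    and pr\<^sub>2 :: "('x \<times> real, 'd, nat \<Rightarrow> real, superfun) supermap"
    and \<psi>\<^sub>0 :: "('x, 'a, 'y, 'b) supermap"
    and \<psi> :: "real \<Rightarrow> ('x, 'a, 'y, 'b) supermap"
  assumes "supermanifold (m + r) (n + s) X"
    and "supermanifold (p + r) (q + s) Y"
    and "subsupermanifold p q Z \<iota> Y"
    and "is_morphism X Y \<psi>\<^sub>0"
    and "supertransversal X Y Z \<iota> \<psi>\<^sub>0"
    and "compact_space (body X)"
    and "closedin (body Y) (topspace (body Z))"
    and "product_with_line (m + r) (n + s) X P pr\<^sub>1 pr\<^sub>2"
    and "superhomotopy (m + r) (n + s) X P pr\<^sub>1 pr\<^sub>2 Y \<psi>\<^sub>0 \<psi>"
  shows "\<exists>\<epsilon>>0. \<forall>t. 0 \<le> t \<and> t < \<epsilon> \<longrightarrow> supertransversal X Y Z \<iota> (\<psi> t)"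
proof -
  obtain \<Psi> i where \<Psi>: "is_morphism P Y \<Psi>"
    and i: "\<And>t. is_slice_inclusion (m + r) (n + s) X P pr\<^sub>1 pr\<^sub>2 t (i t)"
    and eq0: "supermap_eq X Y (supermap_comp P \<Psi> (i 0)) \<psi>\<^sub>0"
    and eq: "\<And>t. supermap_eq X Y (supermap_comp P \<Psi> (i t)) (\<psi> t)"
    using assms(9) unfolding superhomotopy_def by blast
  have Y: "super_ringed_space Y" using assms(2) unfolding supermanifold_def by blast
  have u: "underlying (supermap_comp P \<Psi> (i t)) x = underlying \<Psi> (x, t)"
    if "x \<in> topspace (body X)" for x t
    using i[of t] that unfolding is_slice_inclusion_def by (simp add: supermap_comp_def)
  \<comment> \<open>Phrased for \<open>\<Psi>\<close> and the slices \<open>i t\<close>, since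
    \<open>\<psi> t\<close> and \<open>\<psi>\<^sub>0\<close> are only equal to the composites in
    the sense of \<open>supermap_eq\<close>.\<close>
  define good where "good x N e \<longleftrightarrow> openin (body X) N \<and> x \<in> N \<and> (0::real) < e \<and>
      (\<forall>x'\<in>N. \<forall>t. \<bar>t\<bar> < e \<longrightarrow> underlying \<Psi> (x', t) \<in> topspace (body Z) \<longrightarrow>
        transversal_at X Y Z \<iota> (supermap_comp P \<Psi> (i t)) x')" for x N e
  have "\<exists>N e. good x N e" if x: "x \<in> topspace (body X)" for x
  proof -
    have "underlying \<psi>\<^sub>0 x = underlying \<Psi> (x, 0)"
      using eq0 u[OF x] x unfolding supermap_eq_def by metis
    then have "transversal_at X Y Z \<iota> (supermap_comp P \<Psi> (i 0)) x"
      if "underlying \<Psi> (x, 0) \<in> topspace (body Z)"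
      using assms(5)[unfolded supertransversal_iff] x that transversal_at_cong[OF eq0 Y x, of Z \<iota>] by simp
    from transversal_nearby[OF assms(1,2,3,7,8) \<Psi> i x this] show ?thesis
      unfolding good_def by metis
  qed
  then obtain N e where good: "\<And>x. x \<in> topspace (body X) \<Longrightarrow> good x (N x) (e x)" by metis
  then have N: "\<And>x. x \<in> topspace (body X) \<Longrightarrow> openin (body X) (N x)"
      "\<And>x. x \<in> topspace (body X) \<Longrightarrow> x \<in> N x" "\<And>x. x \<in> topspace (body X) \<Longrightarrow> (0::real) < e x"
    unfolding good_def by simp_all
  have "(\<forall>V\<in>N ` topspace (body X). openin (body X) V) \<and> topspace (body X) \<subseteq> \<Union>(N ` topspace (body X))"
    using N(1,2) by auto
  then obtain \<F> where "finite \<F>" "\<F> \<subseteq> N ` topspace (body X)" "topspace (body X) \<subseteq> \<Union>\<F>"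
    using assms(6) unfolding compact_space_alt by meson
  then obtain C where C: "finite C" "C \<subseteq> topspace (body X)" "topspace (body X) \<subseteq> \<Union>(N ` C)"
    by (metis finite_subset_image)
  \<comment> \<open>The 1 keeps the minimum defined when \<open>X\<close>, and with it
    \<open>C\<close>, is empty.\<close>
  define \<epsilon> where "\<epsilon> = Min (insert 1 (e ` C))"
  have \<epsilon>: "\<epsilon> > 0" "\<And>x. x \<in> C \<Longrightarrow> \<epsilon> \<le> e x"
    using C(1,2) N(3) by (auto simp: \<epsilon>_def)
  have "supertransversal X Y Z \<iota> (\<psi> t)" if t: "0 \<le> t" "t < \<epsilon>" for t
    unfolding supertransversal_iff
  proof (intro ballI impI)
    fix x assume x: "x \<in> topspace (body X)" "underlying (\<psi> t) x \<in> topspace (body Z)"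
    then obtain x\<^sub>0 where "x\<^sub>0 \<in> C" "x \<in> N x\<^sub>0" using C(3) by blast
    moreover have "underlying \<Psi> (x, t) \<in> topspace (body Z)"
      using eq[of t] u[OF x(1)] x unfolding supermap_eq_def by metis
    moreover have "\<bar>t\<bar> < e x\<^sub>0" using t \<epsilon>(2)[OF \<open>x\<^sub>0 \<in> C\<close>] by simp
    ultimately have "transversal_at X Y Z \<iota> (supermap_comp P \<Psi> (i t)) x"
      using good[of x\<^sub>0] C(2) unfolding good_def by blast
    then show "transversal_at X Y Z \<iota> (\<psi> t) x" using transversal_at_cong[OF eq Y x(1)] by blast
  qed
  with \<epsilon>(1) show ?thesis by blast
qed

end
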